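(* Let $M\subset\mathbb R^m$ be a bounded semialgebraic set. Every point of $\widehat\partial M$ has a countable basis of neighborhoods in $\beta_s^*M$.
   Context: $\mathcal S^*(M)$ is the ring of bounded continuous semialgebraic functions on $M$; $\beta_s^*M$ is the set of its maximal ideals with the Zariski topology; $M$ is identified with $\{\mathfrak m^*_a=\{f:f(a)=0\}:a\in M\}$ and $\partial M:=\beta_s^*M\setminus M$. $F_1=\mathbb R((t^* ))$ is the real closed field of Puiseux series ordered with $t>0$ infinitesimal; $M_{F_1}$ is the extension of $M$ to $F_1$ and $f_{F_1}$ that of $f\in\mathcal S^*(M)$. A formal path is $\alpha\in\mathbb R[[t]]^m$ (constant term $\alpha(0)$). For a formal path $\alpha\in M_{F_1}$, $f_{F_1}(\alpha)$ is a Puiseux series with nonnegative exponents for $f\in\mathcal S^*(M)$ and $\mathfrak m^*_\alpha:=\{f\in\mathcal S^*(M): f_{F_1}(\alpha)\text{ has zero constant term}\}$ is a maximal ideal, lying in $\partial M$ if $\alpha(0)\in\operatorname{Cl}(M)\setminus M$. $\widehat\partial M$ is the set of all such $\mathfrak m^*_\alpha$ with $\alpha(0)\in\operatorname{Cl}(M)\setminus M$. *)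

theory Defs
  imports "HOL-Analysis.Analysis"
begin

datatype 'v rpoly = PVar 'v | PConst real | PAdd "'v rpoly" "'v rpoly"
  | PMul "'v rpoly" "'v rpoly" | PNeg "'v rpoly"

datatype 'v sfml = FPos "'v rpoly" | FZero "'v rpoly" | FNot "'v sfml"
  | FAnd "'v sfml" "'v sfml" | FOr "'v sfml" "'v sfml"

primrec peval_r :: "'v rpoly \<Rightarrow> ('v \<Rightarrow> real) \<Rightarrow> real" where
  "peval_r (PVar v) x = x v"
| "peval_r (PConst c) x = c"
| "peval_r (PAdd p q) x = peval_r p x + peval_r q x"
| "peval_r (PMul p q) x = peval_r p x * peval_r q x"
| "peval_r (PNeg p) x = - peval_r p x"

primrec holds_r :: "'v sfml \<Rightarrow> ('v \<Rightarrow> real) \<Rightarrow> bool" where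
  "holds_r (FPos p) x = (peval_r p x > 0)"
| "holds_r (FZero p) x = (peval_r p x = 0)"
| "holds_r (FNot f) x = (\<not> holds_r f x)"
| "holds_r (FAnd f g) x = (holds_r f x \<and> holds_r g x)"
| "holds_r (FOr f g) x = (holds_r f x \<or> holds_r g x)"

definition semialg :: "('v \<Rightarrow> real) set \<Rightarrow> bool" where
  "semialg S \<longleftrightarrow> (\<exists>\<Phi>. S = {x. holds_r \<Phi> x})"

text \<open>A Puiseux series is represented by its coefficient function q \<mapsto> coefficient of t^q;
  exponents bounded below and with bounded denominators.\<close>
type_synonym ps = "rat \<Rightarrow> real"

definition is_puiseux :: "ps \<Rightarrow> bool" where
  "is_puiseux a \<longleftrightarrow> (\<exists>(N::int) (d::nat). d > 0 \<and>
      (\<forall>q. a q \<noteq> 0 \<longrightarrow> of_int N \<le> q \<and> q * of_nat d \<in> \<int>))"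

definition ps_const :: "real \<Rightarrow> ps" where
  "ps_const c = (\<lambda>q. if q = 0 then c else 0)"

definition ps_add :: "ps \<Rightarrow> ps \<Rightarrow> ps" where
  "ps_add a b = (\<lambda>q. a q + b q)"

definition ps_neg :: "ps \<Rightarrow> ps" where
  "ps_neg a = (\<lambda>q. - a q)"

definition ps_mult :: "ps \<Rightarrow> ps \<Rightarrow> ps" where
  "ps_mult a b = (\<lambda>q. \<Sum>p\<in>{p. a p \<noteq> 0 \<and> b (q - p) \<noteq> 0}. a p * b (q - p))"

definition ps_pos :: "ps \<Rightarrow> bool" where
  "ps_pos a \<longleftrightarrow> (\<exists>q. a q \<noteq> 0) \<and> a (LEAST q. a q \<noteq> 0) > 0"

primrec peval_ps :: "'v rpoly \<Rightarrow> ('v \<Rightarrow> ps) \<Rightarrow> ps" where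
  "peval_ps (PVar v) x = x v"
| "peval_ps (PConst c) x = ps_const c"
| "peval_ps (PAdd p q) x = ps_add (peval_ps p x) (peval_ps q x)"
| "peval_ps (PMul p q) x = ps_mult (peval_ps p x) (peval_ps q x)"
| "peval_ps (PNeg p) x = ps_neg (peval_ps p x)"

primrec holds_ps :: "'v sfml \<Rightarrow> ('v \<Rightarrow> ps) \<Rightarrow> bool" where
  "holds_ps (FPos p) x = ps_pos (peval_ps p x)"
| "holds_ps (FZero p) x = (peval_ps p x = ps_const 0)"
| "holds_ps (FNot f) x = (\<not> holds_ps f x)"
| "holds_ps (FAnd f g) x = (holds_ps f x \<and> holds_ps g x)"
| "holds_ps (FOr f g) x = (holds_ps f x \<or> holds_ps g x)"

text \<open>Extension S_{F1} of a semialgebraic set S to F1 (well defined by the transfer principle: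
  any defining formula gives the same set).\<close>
definition ext_F1 :: "('v \<Rightarrow> real) set \<Rightarrow> ('v \<Rightarrow> ps) set" where
  "ext_F1 S = {x. (\<forall>v. is_puiseux (x v)) \<and> (\<exists>\<Phi>. S = {y. holds_r \<Phi> y} \<and> holds_ps \<Phi> x)}"

definition coords :: "real^'m \<Rightarrow> ('m \<Rightarrow> real)" where
  "coords x = (\<lambda>i. x $ i)"

definition semialg_set :: "(real^'m) set \<Rightarrow> bool" where
  "semialg_set M \<longleftrightarrow> semialg (coords ` M)"

definition graph_on :: "(real^'m) set \<Rightarrow> (real^'m \<Rightarrow> real) \<Rightarrow> ('m option \<Rightarrow> real) set" where
  "graph_on M f = (\<lambda>x. (\<lambda>v. case v of None \<Rightarrow> f x | Some i \<Rightarrow> x $ i)) ` M"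

text \<open>S*(M): bounded continuous semialgebraic functions on M. Elements are represented
  by functions vanishing outside M (so that functions agreeing on M coincide).\<close>
definition Sstar :: "(real^'m) set \<Rightarrow> (real^'m \<Rightarrow> real) set" where
  "Sstar M = {f. continuous_on M f \<and> bounded (f ` M) \<and> semialg (graph_on M f)
                 \<and> (\<forall>x. x \<notin> M \<longrightarrow> f x = 0)}"

definition is_ideal :: "(real^'m) set \<Rightarrow> (real^'m \<Rightarrow> real) set \<Rightarrow> bool" where
  "is_ideal M I \<longleftrightarrow> I \<subseteq> Sstar M \<and> (\<lambda>x. 0) \<in> I
     \<and> (\<forall>f\<in>I. \<forall>g\<in>I. (\<lambda>x. f x + g x) \<in> I)
     \<and> (\<forall>f\<in>I. \<forall>g\<in>Sstar M. (\<lambda>x. g x * f x) \<in> I)"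

definition is_max_ideal :: "(real^'m) set \<Rightarrow> (real^'m \<Rightarrow> real) set \<Rightarrow> bool" where
  "is_max_ideal M I \<longleftrightarrow> is_ideal M I \<and> I \<noteq> Sstar M
     \<and> (\<forall>J. is_ideal M J \<and> I \<subseteq> J \<longrightarrow> J = I \<or> J = Sstar M)"

definition betaS :: "(real^'m) set \<Rightarrow> (real^'m \<Rightarrow> real) set set" where
  "betaS M = {I. is_max_ideal M I}"

definition Dopen :: "(real^'m) set \<Rightarrow> (real^'m \<Rightarrow> real) \<Rightarrow> (real^'m \<Rightarrow> real) set set" where
  "Dopen M f = {I \<in> betaS M. f \<notin> I}"

definition zariski_open :: "(real^'m) set \<Rightarrow> (real^'m \<Rightarrow> real) set set \<Rightarrow> bool" where
  "zariski_open M U \<longleftrightarrow> U \<subseteq> betaS M \<and> (\<forall>p\<in>U. \<exists>f\<in>Sstar M. p \<in> Dopen M f \<and> Dopen M f \<subseteq> U)"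

definition has_countable_nbhd_basis ::
  "(real^'m) set \<Rightarrow> (real^'m \<Rightarrow> real) set \<Rightarrow> bool" where
  "has_countable_nbhd_basis M p \<longleftrightarrow>
     (\<exists>B :: nat \<Rightarrow> (real^'m \<Rightarrow> real) set set.
        (\<forall>n. zariski_open M (B n) \<and> p \<in> B n) \<and>
        (\<forall>U. zariski_open M U \<and> p \<in> U \<longrightarrow> (\<exists>n. B n \<subseteq> U)))"

text \<open>A formal path alpha \<in> R[[t]]^m: alpha i k = coefficient of t^k in the i-th coordinate.\<close>
definition fps_to_ps :: "(nat \<Rightarrow> real) \<Rightarrow> ps" where
  "fps_to_ps c = (\<lambda>q. if q \<in> \<int> \<and> q \<ge> 0 then c (nat \<lfloor>q\<rfloor>) else 0)"

definition path_F1 :: "('m \<Rightarrow> nat \<Rightarrow> real) \<Rightarrow> ('m \<Rightarrow> ps)" where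
  "path_F1 \<alpha> = (\<lambda>i. fps_to_ps (\<alpha> i))"

definition path_origin :: "('m::finite \<Rightarrow> nat \<Rightarrow> real) \<Rightarrow> real^'m" where
  "path_origin \<alpha> = (\<chi> i. \<alpha> i 0)"

definition f_F1 :: "(real^'m) set \<Rightarrow> (real^'m \<Rightarrow> real) \<Rightarrow> ('m \<Rightarrow> nat \<Rightarrow> real) \<Rightarrow> ps" where
  "f_F1 M f \<alpha> = (THE y. (\<lambda>v. case v of None \<Rightarrow> y | Some i \<Rightarrow> path_F1 \<alpha> i) \<in> ext_F1 (graph_on M f))"

definition mstar_path :: "(real^'m) set \<Rightarrow> ('m \<Rightarrow> nat \<Rightarrow> real) \<Rightarrow> (real^'m \<Rightarrow> real) set" where
  "mstar_path M \<alpha> = {f \<in> Sstar M. f_F1 M f \<alpha> 0 = 0}"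

definition hat_boundary :: "(real^'m::finite) set \<Rightarrow> (real^'m \<Rightarrow> real) set set" where
  "hat_boundary M = {mstar_path M \<alpha> | \<alpha>.
      path_F1 \<alpha> \<in> ext_F1 (coords ` M) \<and> path_origin \<alpha> \<in> closure M - M}"

end

theory Submission
  imports Defs "HOL-Library.Multiset" "HOL-Computational_Algebra.Formal_Laurent_Series"
begin

text \<open>
  Puiseux series form a real closed field, so by quantifier elimination first-order statements
  transfer between the reals and \<open>F\<^sub>1\<close>. Hence \<open>f \<mapsto> f(\<alpha>)(0)\<close> is a ring homomorphism
  on \<open>S*(M)\<close> with kernel the given point \<open>p\<close>, which is therefore a maximal ideal.
  If \<open>f(\<alpha>)(0)\<close> is nonzero, then by continuity of the extension of \<open>f\<close> the function \<open>f\<close> is bounded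
  away from 0 on the \<open>t^N\<close>-ball around the truncation \<open>\<alpha>\<^sub>N(t)\<close> for some \<open>N\<close>, the powers of \<open>t\<close>
  being coinitial in the positive Puiseux series; replacing \<open>t\<close> by a small real
  \<open>s\<close>, it is bounded away from 0 on the union of the \<open>s^N\<close>-balls around \<open>\<alpha>\<^sub>N(s)\<close>, \<open>0 < s \<le> c\<close>.
  A function \<open>h\<close> in \<open>S*(M)\<close> outside \<open>p\<close> that vanishes off this set is divisible by \<open>f\<close>, so
  \<open>D(h) \<subseteq> D(f)\<close>. Countably many such \<open>h\<close>, one for each \<open>N\<close> and each \<open>c = 1/j\<close>, suffice.
\<close>

text \<open>A formal path need not converge, so no real number can be substituted for t in \<alpha>
  itself. Its truncations are polynomials with real coefficients, hence definable over the reals,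
  and \<alpha> differs from the truncation of order N only by multiples of t^(N+1), well inside the
  ball of radius t^N. The bound c must vary as well, since a statement true at the infinitesimal t
  holds over the reals only for all sufficiently small s > 0. Each bump function is continuous
  because the origin of the path lies outside M: near a point of M only parameters s bounded away
  from 0 count. Transfer is needed even to unfold the definitions: \<open>ext_F1\<close> accepts any
  defining formula and \<open>f_F1\<close> is a definite description, so independence of the
  formula, existence and uniqueness are themselves transferred statements. Elimination compares two
  real closed fields from the outset. If finitely many parameter polynomials have equal signs at a
  tuple of each field, the sign diagrams in one further variable are matched back and forth; so the
  same finite set of sign conditions yields one formula valid in both fields.\<close>

section \<open>Real closed fields\<close>

text \<open>A class axiom cannot mention \<^const>\<open>poly\<close> over the type being axiomatised,
  so the intermediate value property is stated for Horner evaluation of coefficient lists.\<close>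
class rcf = linordered_field + real_algebra_1 +
  assumes horner_ivt: "a < b \<Longrightarrow> foldr (\<lambda>c v. c + a * v) cs 0 < 0 \<Longrightarrow> foldr (\<lambda>c v. c + b * v) cs 0 > 0 \<Longrightarrow>
    \<exists>c>a. c < b \<and> foldr (\<lambda>d v. d + c * v) cs 0 = 0"

lemma horner_conv_poly: "foldr (\<lambda>c v. c + x * v) cs 0 = poly (Poly cs) x"
  by (induction cs) auto

instance real :: rcf
  by standard (unfold horner_conv_poly, blast dest: poly_IVT_pos)

lemma poly_ivt:
  fixes p :: "'a::rcf poly"
  assumes "a < b" "poly p a < 0" "poly p b > 0"
  shows "\<exists>c>a. c < b \<and> poly p c = 0"
  using horner_ivt[of a b "coeffs p"] assms by (simp add: horner_conv_poly)

text \<open>Integer-valued, unlike \<open>sgn\<close>, so that signs taken in two different fields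
  can be equated.\<close>

definition sg :: "'a::linordered_idom \<Rightarrow> int" where
  "sg x = (if x > 0 then 1 else if x = 0 then 0 else - 1)"

lemma sg_eq_iff [simp]:
  "sg x = 0 \<longleftrightarrow> x = 0" "sg x = 1 \<longleftrightarrow> x > 0" "sg x = - 1 \<longleftrightarrow> x < 0" "0 = sg x \<longleftrightarrow> x = 0"
  by (auto simp: sg_def)

lemma sg_0_1 [simp]: "sg 0 = 0" "sg 1 = 1"
  by simp_all

lemma sg_minus [simp]: "sg (- x) = - sg x"
  by (auto simp: sg_def)

lemma sg_mult: "sg (x * y) = sg x * sg y"
  by (auto simp: sg_def zero_less_mult_iff mult_less_0_iff not_less le_less)

lemma sg_power: "sg (x ^ n) = sg x ^ n"
  by (induction n) (simp_all add: sg_mult)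

lemma sg_cong:
  assumes "sg x = sg y"
  shows "x > 0 \<longleftrightarrow> y > 0" "x < 0 \<longleftrightarrow> y < 0" "x = 0 \<longleftrightarrow> y = 0"
  using assms by (auto simp: sg_def split: if_splits)

lemma sg_range: "sg x \<in> {- 1, 0, 1}"
  by (auto simp: sg_def)

text \<open>The classes do not relate scalar multiplication to the order. A positive real is a
  square, however, so its image is a nonzero square.\<close>

lemma of_real_pos_iff: "(of_real c :: 'a::{linordered_field,real_algebra_1}) > 0 \<longleftrightarrow> c > 0"
proof -
  have pos: "(of_real c :: 'a) > 0" if "c > 0" for c
  proof -
    have "(of_real c :: 'a) = of_real (sqrt c) ^ 2"
      using that by (simp flip: of_real_power)
    thus ?thesis using that by (simp add: zero_less_power2)
  qed
  show ?thesis
    using pos[of c] pos[of "- c"] by (cases c "0::real" rule: linorder_cases) auto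
qed

lemma sg_of_real [simp]: "sg (of_real c :: 'a::{linordered_field,real_algebra_1}) = sg c"
  using of_real_pos_iff[of c, where 'a = 'a] by (auto simp: sg_def)

section \<open>Signs of polynomials, Rolle's theorem and the mean value theorem\<close>

lemma poly_IVT_rcf:
  fixes p :: "'a::rcf poly"
  assumes "a < b" "poly p a * poly p b < 0"
  shows "\<exists>c>a. c < b \<and> poly p c = 0"
  using assms(2) poly_ivt[of a b p] poly_ivt[of a b "- p"] \<open>a < b\<close>
  by (auto simp: mult_less_0_iff)

lemma sg_poly_constant:
  fixes p :: "'a::rcf poly"
  assumes "\<And>c. x \<le> c \<Longrightarrow> c \<le> y \<Longrightarrow> poly p c \<noteq> 0" "x \<le> y"
  shows "sg (poly p x) = sg (poly p y)"
proof (rule ccontr)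
  assume ne: "sg (poly p x) \<noteq> sg (poly p y)"
  have "poly p x \<noteq> 0" "poly p y \<noteq> 0" using assms by auto
  with ne have "poly p x * poly p y < 0"
    by (auto simp: sg_def mult_less_0_iff split: if_splits)
  moreover have "x < y" using ne assms(2) by (auto simp: le_less)
  ultimately obtain c where "x < c" "c < y" "poly p c = 0" using poly_IVT_rcf by blast
  thus False using assms(1)[of c] by auto
qed

lemma poly_ge_lead_coeff:
  fixes p :: "'a::linordered_field poly"
  assumes "lead_coeff p > 0"
  shows "\<exists>n. \<forall>x\<ge>n. poly p x \<ge> lead_coeff p"
  using assms
proof (induct p)
  case 0
  then show ?case by auto
next
  case (pCons a p)
  show ?case
  proof (cases "p = 0")
    case False
    with pCons obtain n where n: "\<And>x. x \<ge> n \<Longrightarrow> lead_coeff p \<le> poly p x" and lc: "lead_coeff p > 0"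
      by auto
    define m where "m = max (max n 0) ((lead_coeff p - a) / lead_coeff p)"
    have "lead_coeff p \<le> a + x * poly p x" if "x \<ge> m" for x
    proof -
      have x: "x \<ge> n" "x \<ge> 0" "x \<ge> (lead_coeff p - a) / lead_coeff p" using that by (auto simp: m_def)
      have "lead_coeff p - a \<le> x * lead_coeff p" using x(3) lc by (simp add: field_simps)
      also have "\<dots> \<le> x * poly p x" using n[OF x(1)] x(2) by (intro mult_left_mono)
      finally show ?thesis by (simp add: algebra_simps)
    qed
    with False show ?thesis by auto
  qed auto
qed

lemma sg_poly_at_top:
  fixes p :: "'a::linordered_field poly"
  shows "\<exists>n. \<forall>x\<ge>n. sg (poly p x) = sg (lead_coeff p)"
proof (cases "lead_coeff p" "0::'a" rule: linorder_cases)
  case greater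
  from poly_ge_lead_coeff[OF this] obtain n where "\<forall>x\<ge>n. lead_coeff p \<le> poly p x" by auto
  with greater show ?thesis by (intro exI[of _ n]) (force simp: sg_def)
next
  case less
  hence "lead_coeff (- p) > 0" by simp
  from poly_ge_lead_coeff[OF this] obtain n where "\<forall>x\<ge>n. - lead_coeff p \<le> - poly p x" by auto
  with less show ?thesis by (intro exI[of _ n]) (force simp: sg_def)
qed auto

lemma sg_poly_at_bot:
  fixes p :: "'a::linordered_field poly"
  shows "\<exists>n. \<forall>x\<le>n. sg (poly p x) = sg (lead_coeff p) * (- 1) ^ degree p"
proof -
  let ?q = "pcompose p [:0, - 1:]"
  from sg_poly_at_top[of ?q] obtain n where n: "\<forall>x\<ge>n. sg (poly ?q x) = sg (lead_coeff ?q)" by auto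
  have "lead_coeff ?q = lead_coeff p * (- 1) ^ degree p"
    by (subst lead_coeff_comp) auto
  moreover have "sg ((- 1 :: 'a) ^ degree p) = (- 1) ^ degree p"
    by (simp add: sg_power)
  ultimately have "\<forall>x\<ge>n. sg (poly p (- x)) = sg (lead_coeff p) * (- 1) ^ degree p"
    using n by (simp add: poly_pcompose sg_mult)
  thus ?thesis by (intro exI[of _ "- n"]) (metis le_minus_iff minus_minus)
qed

text \<open>Between consecutive roots \<^term>\<open>a\<close>, \<^term>\<open>b\<close> write \<^term>\<open>p\<close> as
  \<^term>\<open>(x - a) ^ m * (x - b) ^ n * q x\<close>; the cofactor of
  \<^term>\<open>(x - a) ^ (m - 1) * (x - b) ^ (n - 1)\<close> in the derivative changes sign.\<close>
lemma rolle_consecutive: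
  fixes p :: "'a::rcf poly"
  assumes "a < b" "poly p a = 0" "poly p b = 0" "p \<noteq> 0"
    and noroot: "\<And>c. a < c \<Longrightarrow> c < b \<Longrightarrow> poly p c \<noteq> 0"
  shows "\<exists>c>a. c < b \<and> poly (pderiv p) c = 0"
proof -
  define m where "m = order a p"
  obtain q0 where q0: "p = [:- a, 1:] ^ m * q0" "\<not> [:- a, 1:] dvd q0"
    using order_decomp[OF \<open>p \<noteq> 0\<close>] by (auto simp: m_def)
  have "q0 \<noteq> 0" using q0 by auto
  define n where "n = order b q0"
  obtain q where q: "q0 = [:- b, 1:] ^ n * q" "\<not> [:- b, 1:] dvd q"
    using order_decomp[OF \<open>q0 \<noteq> 0\<close>] by (auto simp: n_def)
  have p: "p = [:- a, 1:] ^ m * ([:- b, 1:] ^ n * q)" using q0 q by simp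
  have qa: "poly q a \<noteq> 0" using q0(2) unfolding q(1) by (auto simp: poly_eq_0_iff_dvd)
  have qb: "poly q b \<noteq> 0" using q(2) by (simp add: poly_eq_0_iff_dvd)
  have "m \<noteq> 0" using assms(2,4) by (auto simp: m_def order_root)
  then obtain m' where m': "m = Suc m'" by (cases m) auto
  have "poly q0 b = 0" using assms(1,3) unfolding q0(1) by auto
  hence "n \<noteq> 0" using \<open>q0 \<noteq> 0\<close> by (auto simp: n_def order_root)
  then obtain n' where n': "n = Suc n'" by (cases n) auto
  define A B where "A = [:- a, 1:]" and "B = [:- b, 1:]"
  define r where "r = of_nat m * (B * q) + of_nat n * (A * q) + A * B * pderiv q"
  have smult_of_nat: "smult (of_nat k) f = of_nat k * f" for k and f :: "'a poly"
    by (simp add: of_nat_poly)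
  have AB: "pderiv A = 1" "pderiv B = 1" by (auto simp: A_def B_def pderiv_pCons)
  have "pderiv p = A ^ m' * B ^ n' * r"
    unfolding p A_def[symmetric] B_def[symmetric] r_def m' n' pderiv_mult pderiv_power_Suc AB smult_of_nat
    by (simp add: algebra_simps)
  hence d: "pderiv p = [:- a, 1:] ^ m' * [:- b, 1:] ^ n' * r" by (simp add: A_def B_def)
  have noq: "poly q c \<noteq> 0" if "a \<le> c" "c \<le> b" for c
    using noroot[of c] that qa qb unfolding p by (cases "c = a \<or> c = b") (auto simp: le_less)
  have "sg (poly q a) = sg (poly q b)" using sg_poly_constant[OF noq] \<open>a < b\<close> by auto
  hence s: "poly q a * poly q b > 0" using qa qb
    by (auto simp: sg_def zero_less_mult_iff split: if_splits)
  have "poly r a * poly r b = - (of_nat m * of_nat n * (b - a)\<^sup>2 * (poly q a * poly q b))"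
    by (simp add: r_def A_def B_def algebra_simps power2_eq_square)
  moreover have "of_nat m * of_nat n * (b - a)\<^sup>2 * (poly q a * poly q b) > 0"
    using \<open>a < b\<close> \<open>m \<noteq> 0\<close> \<open>n \<noteq> 0\<close> by (intro mult_pos_pos[OF _ s]) (auto intro!: mult_pos_pos)
  ultimately have "poly r a * poly r b < 0" by simp
  from poly_IVT_rcf[OF \<open>a < b\<close> this] obtain c where "a < c" "c < b" "poly r c = 0" by auto
  thus ?thesis by (auto simp: d)
qed

lemma rolle_rcf:
  fixes p :: "'a::rcf poly"
  assumes "a < b" "poly p a = 0" "poly p b = 0"
  shows "\<exists>c>a. c < b \<and> poly (pderiv p) c = 0"
proof (cases "p = 0")
  case True
  thus ?thesis using dense[OF assms(1)] by auto
next
  case False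
  \<comment> \<open>The root next to \<open>a\<close> suffices: \<open>rolle_consecutive\<close>
    needs an interval without interior roots, and \<open>b'\<close> is at most
    \<open>b\<close>.\<close>
  define b' where "b' = Min {x. poly p x = 0 \<and> a < x}"
  have fin: "finite {x. poly p x = 0 \<and> a < x}"
    using poly_roots_finite[OF False] by (rule rev_finite_subset) auto
  have ne: "{x. poly p x = 0 \<and> a < x} \<noteq> {}" using assms by auto
  have b': "poly p b' = 0" "a < b'" using Min_in[OF fin ne] by (auto simp: b'_def)
  have "b' \<le> b" using fin assms by (auto simp: b'_def)
  moreover have "poly p c \<noteq> 0" if "a < c" "c < b'" for c
    using Min_le[OF fin, of c] that by (auto simp: b'_def)
  from rolle_consecutive[OF b'(2) assms(2) b'(1) False this]
  obtain c where "a < c" "c < b'" "poly (pderiv p) c = 0" by auto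
  ultimately show ?thesis by (intro exI[of _ c]) auto
qed

lemma mvt_rcf:
  fixes p :: "'a::rcf poly"
  assumes "a < b"
  shows "\<exists>c>a. c < b \<and> poly p b - poly p a = (b - a) * poly (pderiv p) c"
proof -
  define k where "k = (poly p b - poly p a) / (b - a)"
  define q where "q = p - [:poly p a - k * a, k:]"
  have "poly q a = 0" by (simp add: q_def algebra_simps)
  moreover have "k * (b - a) = poly p b - poly p a" using assms by (simp add: k_def)
  hence "poly q b = 0" by (simp add: q_def algebra_simps)
  ultimately obtain c where c: "a < c" "c < b" "poly (pderiv q) c = 0"
    using rolle_rcf[OF assms] by blast
  have "poly (pderiv p) c = k" using c(3) by (simp add: q_def pderiv_diff pderiv_pCons)
  thus ?thesis using c assms by (intro exI[of _ c]) (auto simp: k_def)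
qed

lemma poly_strict_mono:
  fixes p :: "'a::rcf poly"
  assumes "\<And>x. a < x \<Longrightarrow> x < b \<Longrightarrow> poly (pderiv p) x > 0" "a \<le> x" "x < y" "y \<le> b"
  shows "poly p x < poly p y"
proof -
  obtain c where c: "x < c" "c < y" "poly p y - poly p x = (y - x) * poly (pderiv p) c"
    using mvt_rcf[OF assms(3)] by blast
  have "poly (pderiv p) c > 0" using assms c by auto
  hence "poly p y - poly p x > 0" using assms by (simp add: c(3))
  thus ?thesis by simp
qed

text \<open>A zero of \<open>q\<close> comes from the intermediate value property. For a positive
  sign take a point right of a root or, if there is none, of the left end, since \<open>q\<close>
  increases; the negative sign is symmetric. Equal signs at the ends ensure that the sign of
  \<open>p\<close> at \<open>y\<close> is possible for \<open>q\<close>.\<close>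

lemma match_sign_mono:
  fixes p :: "'a::rcf poly" and q :: "'b::rcf poly"
  assumes p: "\<And>x. a < x \<Longrightarrow> x < c \<Longrightarrow> poly (pderiv p) x > 0"
    and q: "\<And>x. a' < x \<Longrightarrow> x < c' \<Longrightarrow> poly (pderiv q) x > 0"
    and "a < y" "y < c" "a' < c'"
    and sa: "sg (poly p a) = sg (poly q a')" and sc: "sg (poly p c) = sg (poly q c')"
  shows "\<exists>b'>a'. b' < c' \<and> sg (poly p y) = sg (poly q b')"
proof -
  have ay: "poly p a < poly p y" and yc: "poly p y < poly p c"
    using poly_strict_mono[OF p, of a y] poly_strict_mono[OF p, of y c] assms by auto
  have qm: "poly q u < poly q v" if "a' \<le> u" "u < v" "v \<le> c'" for u v
    using poly_strict_mono[OF q that] .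
  have mid: "\<exists>b>u. b < v" if "u < v" for u v :: 'b
    using dense[OF that] by auto
  consider "poly p y = 0" | "poly p y > 0" | "poly p y < 0" by fastforce
  then show ?thesis
  proof cases
    case 1
    hence "poly q a' < 0" "poly q c' > 0" using ay yc sg_cong[OF sa] sg_cong[OF sc] by auto
    from poly_ivt[OF \<open>a' < c'\<close> this] show ?thesis using 1 by (auto simp: sg_def)
  next
    case 2
    hence c0: "poly q c' > 0" using ay yc sg_cong[OF sa] sg_cong[OF sc] by auto
    have "\<exists>d\<ge>a'. d < c' \<and> poly q d \<ge> 0"
    proof (cases "poly q a' < 0")
      case True
      from poly_ivt[OF \<open>a' < c'\<close> this c0] show ?thesis by (force simp: le_less)
    next
      case False
      thus ?thesis using \<open>a' < c'\<close> by (intro exI[of _ a']) auto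
    qed
    then obtain d where d: "d \<ge> a'" "d < c'" "poly q d \<ge> 0" by auto
    obtain b where b: "d < b" "b < c'" using mid[OF d(2)] by auto
    have "poly q b > 0" using qm[of d b] d b by auto
    thus ?thesis using b d 2 by (intro exI[of _ b]) (auto simp: sg_def)
  next
    case 3
    hence a0: "poly q a' < 0" using ay yc sg_cong[OF sa] sg_cong[OF sc] by auto
    have "\<exists>d\<le>c'. d > a' \<and> poly q d \<le> 0"
    proof (cases "poly q c' > 0")
      case True
      from poly_ivt[OF \<open>a' < c'\<close> a0 this] show ?thesis by (force simp: le_less)
    next
      case False
      thus ?thesis using \<open>a' < c'\<close> by (intro exI[of _ c']) auto
    qed
    then obtain d where d: "d \<le> c'" "d > a'" "poly q d \<le> 0" by auto
    obtain b where b: "a' < b" "b < d" using mid[OF d(2)] by auto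
    have "poly q b < 0" using qm[of b d] d b by auto
    thus ?thesis using b d 3 by (intro exI[of _ b]) (auto simp: sg_def)
  qed
qed

lemma match_sign:
  fixes p :: "'a::rcf poly" and q :: "'b::rcf poly"
  assumes p: "\<And>x. a < x \<Longrightarrow> x < c \<Longrightarrow> sg (poly (pderiv p) x) = s"
    and q: "\<And>x. a' < x \<Longrightarrow> x < c' \<Longrightarrow> sg (poly (pderiv q) x) = s"
    and "a < y" "y < c" "a' < c'" "s \<noteq> 0"
    and sa: "sg (poly p a) = sg (poly q a')" and sc: "sg (poly p c) = sg (poly q c')"
  shows "\<exists>b'>a'. b' < c' \<and> sg (poly p y) = sg (poly q b')"
proof -
  have "s = 1 \<or> s = - 1" using p[of y] assms sg_range[of "poly (pderiv p) y"] by auto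
  then show ?thesis
  proof
    assume "s = 1"
    thus ?thesis using assms by (intro match_sign_mono[of a c p a' c' q y]) auto
  next
    assume s: "s = - 1"
    have "\<exists>b'>a'. b' < c' \<and> sg (poly (- p) y) = sg (poly (- q) b')"
      using assms s by (intro match_sign_mono[of a c "- p" a' c' "- q" y]) (auto simp: pderiv_minus)
    thus ?thesis by auto
  qed
qed

section \<open>Comparing sign diagrams over two real closed fields\<close>

definition good :: "('a::rcf poly \<times> 'b::rcf poly) set \<Rightarrow> ('a \<times> 'b) set \<Rightarrow> bool" where
  "good D r \<longleftrightarrow> finite r
     \<and> (\<forall>a b c d. (a, b) \<in> r \<longrightarrow> (c, d) \<in> r \<longrightarrow> (a < c \<longleftrightarrow> b < d))
     \<and> (\<forall>p q a b. (p, q) \<in> D \<longrightarrow> (a, b) \<in> r \<longrightarrow> sg (poly p a) = sg (poly q b))"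

definition fwd :: "('a::rcf poly \<times> 'b::rcf poly) set \<Rightarrow> ('a \<times> 'b) set \<Rightarrow> bool" where
  "fwd D r \<longleftrightarrow> (\<forall>a. \<exists>b. good D (insert (a, b) r))"

definition bwd :: "('a::rcf poly \<times> 'b::rcf poly) set \<Rightarrow> ('a \<times> 'b) set \<Rightarrow> bool" where
  "bwd D r \<longleftrightarrow> (\<forall>b. \<exists>a. good D (insert (a, b) r))"

text \<open>A good relation is a finite partial order isomorphism that respects the signs of the paired
  polynomials. The two sign diagrams agree when, from some good relation on, one can go back and
  forth: every further point of either line finds a partner.\<close>
definition sim :: "('a::rcf poly \<times> 'b::rcf poly) set \<Rightarrow> bool" where
  "sim D \<longleftrightarrow> (\<exists>r0. good D r0 \<and> (\<forall>r. r0 \<subseteq> r \<and> good D r \<longrightarrow> fwd D r \<and> bwd D r))"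

lemma goodD:
  assumes "good D r"
  shows "finite r" "\<And>a b c d. (a, b) \<in> r \<Longrightarrow> (c, d) \<in> r \<Longrightarrow> a < c \<longleftrightarrow> b < d"
    "\<And>p q a b. (p, q) \<in> D \<Longrightarrow> (a, b) \<in> r \<Longrightarrow> sg (poly p a) = sg (poly q b)"
  using assms unfolding good_def by blast+

lemma good_le_iff: "good D r \<Longrightarrow> (a, b) \<in> r \<Longrightarrow> (c, d) \<in> r \<Longrightarrow> a \<le> c \<longleftrightarrow> b \<le> d"
  using goodD(2)[of D r c d a b] by (auto simp flip: not_less)

lemma good_converse [simp]: "good (D\<inverse>) (r\<inverse>) \<longleftrightarrow> good D r"
  unfolding good_def converse_iff finite_converse
  by (rule iffI; elim conjE; intro conjI allI impI; (assumption | blast | simp))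

text \<open>Exchanging the two fields turns the backward half into the forward half, so only the
  latter needs an argument.\<close>

lemma bwd_conv_fwd: "bwd D r \<longleftrightarrow> fwd (D\<inverse>) (r\<inverse>)"
proof -
  have "good D (insert (a, b) r) \<longleftrightarrow> good (D\<inverse>) (insert (b, a) (r\<inverse>))" for a b
  proof -
    have "(insert (a, b) r)\<inverse> = insert (b, a) (r\<inverse>)" by auto
    thus ?thesis using good_converse[of D "insert (a, b) r"] by simp
  qed
  thus ?thesis by (simp add: bwd_def fwd_def)
qed

lemma good_insertI:
  assumes "good D r"
    and "\<And>c d. (c, d) \<in> r \<Longrightarrow> (y < c \<longleftrightarrow> b < d) \<and> (c < y \<longleftrightarrow> d < b)"
    and "\<And>p q. (p, q) \<in> D \<Longrightarrow> sg (poly p y) = sg (poly q b)"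
  shows "good D (insert (y, b) r)"
  using assms unfolding good_def insert_iff prod.inject
  by (intro conjI allI impI; (elim disjE conjE)?; simp)

text \<open>A finite order isomorphism takes neighbours to neighbours; hence each case bounds both
  coordinates of every pair, which is what the choice of a partner for \<open>y\<close>
  needs.\<close>

lemma gap_cases [consumes 2, case_names empty below above between]:
  assumes "good D r" "y \<notin> Domain r"
  obtains "r = {}"
  | l l' where "(l, l') \<in> r" "y < l" "\<And>c d. (c, d) \<in> r \<Longrightarrow> l \<le> c \<and> l' \<le> d"
  | u u' where "(u, u') \<in> r" "u < y" "\<And>c d. (c, d) \<in> r \<Longrightarrow> c \<le> u \<and> d \<le> u'"
  | a a' c c' where "(a, a') \<in> r" "(c, c') \<in> r" "a < y" "y < c" "a' < c'"
      "\<And>x x'. (x, x') \<in> r \<Longrightarrow> x \<le> a \<and> x' \<le> a' \<or> c \<le> x \<and> c' \<le> x'"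
proof (cases "r = {}")
  case True
  then show ?thesis using that by blast
next
  case ne: False
  have fin: "finite (Domain r)" using goodD(1)[OF assms(1)] by (rule finite_Domain)
  note le = good_le_iff[OF assms(1)]
  let ?A = "{a\<in>Domain r. a < y}" and ?C = "{c\<in>Domain r. y < c}"
  have fA: "finite ?A" and fC: "finite ?C" using fin by auto
  have split: "x \<in> ?A \<or> x \<in> ?C" if "(x, x') \<in> r" for x x'
    using that assms(2) by (metis (mono_tags) Domain.intros mem_Collect_eq neqE)
  show ?thesis
  proof (cases "?A = {}")
    case True
    hence "?C \<noteq> {}" using split ne by fastforce
    from Min_in[OF fC this] obtain l' where l: "(Min ?C, l') \<in> r" "y < Min ?C" by auto
    have "Min ?C \<le> c" if "(c, d) \<in> r" for c d using Min_le[OF fC] split[OF that] True by auto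
    with le[OF l(1)] show ?thesis using that(2)[of "Min ?C" l'] l by blast
  next
    case A: False
    from Max_in[OF fA this] obtain a' where a: "(Max ?A, a') \<in> r" "Max ?A < y" by auto
    show ?thesis
    proof (cases "?C = {}")
      case True
      have "c \<le> Max ?A" if "(c, d) \<in> r" for c d using Max_ge[OF fA] split[OF that] True by auto
      with le[OF _ a(1)] show ?thesis using that(3)[of "Max ?A" a'] a by blast
    next
      case False
      from Min_in[OF fC this] obtain c' where c: "(Min ?C, c') \<in> r" "y < Min ?C" by auto
      have "x \<le> Max ?A \<and> x' \<le> a' \<or> Min ?C \<le> x \<and> c' \<le> x'" if x: "(x, x') \<in> r" for x x'
        using split[OF x] Max_ge[OF fA, of x] Min_le[OF fC, of x] le[OF x a(1)] le[OF c(1) x] by blast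
      moreover have "a' < c'" using goodD(2)[OF assms(1) a(1) c(1)] a(2) c(2) by auto
      ultimately show ?thesis using that(4)[of "Max ?A" a' "Min ?C" c'] a c by blast
    qed
  qed
qed

text \<open>When the signs do not depend on the points, only the order matters, and a dense order
  without end points always has room for a partner.\<close>

lemma fwd_const:
  fixes D :: "('a::rcf poly \<times> 'b::rcf poly) set"
  assumes "good D r" and "\<And>p q a b. (p, q) \<in> D \<Longrightarrow> sg (poly p a) = sg (poly q b)"
  shows "fwd D r"
  unfolding fwd_def
proof
  fix y
  show "\<exists>b. good D (insert (y, b) r)"
  proof (cases "y \<in> Domain r")
    case True
    then obtain b where "(y, b) \<in> r" by auto
    thus ?thesis using assms by (intro exI[of _ b]) (simp add: insert_absorb)
  next
    case False
    note ins = good_insertI[OF assms(1) _ assms(2)]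
    from assms(1) False show ?thesis
    proof (cases rule: gap_cases)
      case empty
      thus ?thesis using ins[of y 0] by auto
    next
      case (below l l')
      have "(y < c) = (l' - 1 < d) \<and> (c < y) = (d < l' - 1)" if "(c, d) \<in> r" for c d
        using below(2) below(3)[OF that] by (auto simp: not_less intro: less_le_trans[of "l' - 1" l'])
      thus ?thesis using ins[of y "l' - 1"] by blast
    next
      case (above u u')
      have "(y < c) = (u' + 1 < d) \<and> (c < y) = (d < u' + 1)" if "(c, d) \<in> r" for c d
        using above(2) above(3)[OF that] by (auto simp: not_less intro: le_less_trans[of _ u'])
      thus ?thesis using ins[of y "u' + 1"] by blast
    next
      case (between a a' c c')
      obtain b where "a' < b" "b < c'" using dense between by blast
      moreover have "(y < x) = (b < d) \<and> (x < y) = (d < b)" if "(x, d) \<in> r" for x d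
        using between(6)[OF that] between(3,4) \<open>a' < b\<close> \<open>b < c'\<close> by auto
      ultimately show ?thesis using ins[of y b] by blast
    qed
  qed
qed

lemma sim_const:
  fixes D :: "('a::rcf poly \<times> 'b::rcf poly) set"
  assumes "\<And>p q a b. (p, q) \<in> D \<Longrightarrow> sg (poly p a) = sg (poly q b)"
  shows "sim D"
proof -
  have "good D {}" by (simp add: good_def)
  moreover have "fwd D r \<and> bwd D r" if "good D r" for r
  proof
    show "fwd D r" by (rule fwd_const[OF that assms])
    show "bwd D r" unfolding bwd_conv_fwd
    proof (rule fwd_const)
      show "sg (poly p a) = sg (poly q b)" if "(p, q) \<in> D\<inverse>" for p q a b
        using assms[of q p b a] that by auto
    qed (use that in simp)
  qed
  ultimately show ?thesis unfolding sim_def by blast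
qed

text \<open>Used to force all roots and the chosen end points of both lines into one relation,
  before \<open>p\<close> and \<open>q\<close> are taken into account.\<close>

lemma sim_extend:
  assumes r0: "good D r0" "\<And>r. r0 \<subseteq> r \<Longrightarrow> good D r \<Longrightarrow> fwd D r \<and> bwd D r"
    and "finite A" "finite B"
  shows "\<exists>r. r0 \<subseteq> r \<and> good D r \<and> A \<subseteq> Domain r \<and> B \<subseteq> Range r"
proof -
  have "\<exists>r. r0 \<subseteq> r \<and> good D r \<and> A \<subseteq> Domain r"
    using \<open>finite A\<close>
  proof induction
    case empty
    thus ?case using r0 by auto
  next
    case (insert a A)
    then obtain r where r: "r0 \<subseteq> r" "good D r" "A \<subseteq> Domain r" by auto
    then obtain b where "good D (insert (a, b) r)" using r0(2) unfolding fwd_def by blast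
    thus ?case using r by (intro exI[of _ "insert (a, b) r"]) auto
  qed
  then obtain r where r: "r0 \<subseteq> r" "good D r" "A \<subseteq> Domain r" by auto
  show ?thesis
    using \<open>finite B\<close>
  proof induction
    case empty
    thus ?case using r by auto
  next
    case (insert b B)
    then obtain r where r: "r0 \<subseteq> r" "good D r" "A \<subseteq> Domain r" "B \<subseteq> Range r" by auto
    then obtain a where "good D (insert (a, b) r)" using r0(2) unfolding bwd_def by blast
    thus ?case using r by (intro exI[of _ "insert (a, b) r"]) auto
  qed
qed

text \<open>Hoermander's elimination step. The signs of \<^term>\<open>p\<close> at the roots of the other polynomials are read
  off from their remainders in \<^term>\<open>E\<close>; between two such roots \<^term>\<open>p\<close> is strictly monotone, so its
  signs there are determined by those at the end points.\<close>
lemma hormander_fwd: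
  fixes p :: "'a::rcf poly" and q :: "'b::rcf poly" and D0 :: "('a poly \<times> 'b poly) set"
  defines "D1 \<equiv> insert (pderiv p, pderiv q) D0" and "D \<equiv> insert (p, q) D0"
  assumes R: "good E R" "fwd E R" and sub: "D1 \<subseteq> E" and r: "good D r"
    and zero: "\<And>f g. (f, g) \<in> D1 \<Longrightarrow> f = 0 \<longleftrightarrow> g = 0" and "pderiv p \<noteq> 0"
    and rootsf: "\<And>f g a. (f, g) \<in> D1 \<Longrightarrow> f \<noteq> 0 \<Longrightarrow> poly f a = 0 \<Longrightarrow> a \<in> Domain (R \<inter> r)"
    and rootsg: "\<And>f g b. (f, g) \<in> D1 \<Longrightarrow> g \<noteq> 0 \<Longrightarrow> poly g b = 0 \<Longrightarrow> b \<in> Range (R \<inter> r)"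
    and l: "(l, l') \<in> r" "\<And>f g a b. (f, g) \<in> D \<Longrightarrow> a \<le> l \<Longrightarrow> b \<le> l' \<Longrightarrow> sg (poly f a) = sg (poly g b)"
    and u: "(u, u') \<in> r" "\<And>f g a b. (f, g) \<in> D \<Longrightarrow> u \<le> a \<Longrightarrow> u' \<le> b \<Longrightarrow> sg (poly f a) = sg (poly g b)"
  shows "fwd D r"
  unfolding fwd_def
proof
  fix y
  show "\<exists>b. good D (insert (y, b) r)"
  proof (cases "y \<in> Domain r")
    case True
    then obtain b where "(y, b) \<in> r" by auto
    thus ?thesis using r by (intro exI[of _ b]) (simp add: insert_absorb)
  next
    case y: False
    note ins = good_insertI[OF r]
    from r y show ?thesis
    proof (cases rule: gap_cases)
      case empty
      thus ?thesis using l by auto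
    next
      case (below m m')
      have "m \<le> l" "m' \<le> l'" using below(3)[OF l(1)] by auto
      have "(y < c) = (m' - 1 < d) \<and> (c < y) = (d < m' - 1)" if "(c, d) \<in> r" for c d
        using below(2) below(3)[OF that] by (auto simp: not_less intro: less_le_trans[of "m' - 1" m'])
      moreover have "sg (poly f y) = sg (poly g (m' - 1))" if "(f, g) \<in> D" for f g
      proof (rule l(2)[OF that])
        show "y \<le> l" using below(2) \<open>m \<le> l\<close> by simp
        have "m' - 1 \<le> m'" by simp
        thus "m' - 1 \<le> l'" using \<open>m' \<le> l'\<close> by (rule order_trans)
      qed
      ultimately show ?thesis using ins[of y "m' - 1"] by blast
    next
      case (above m m')
      have "u \<le> m" "u' \<le> m'" using above(3)[OF u(1)] by auto
      have "(y < c) = (m' + 1 < d) \<and> (c < y) = (d < m' + 1)" if "(c, d) \<in> r" for c d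
        using above(2) above(3)[OF that] by (auto simp: not_less intro: le_less_trans[of _ m'])
      moreover have "sg (poly f y) = sg (poly g (m' + 1))" if "(f, g) \<in> D" for f g
      proof (rule u(2)[OF that])
        show "u \<le> y" using above(2) \<open>u \<le> m\<close> by simp
        have "m' \<le> m' + 1" by simp
        with \<open>u' \<le> m'\<close> show "u' \<le> m' + 1" by (rule order_trans)
      qed
      ultimately show ?thesis using ins[of y "m' + 1"] by blast
    next
      case (between a a' c c')
      \<comment> \<open>The partner \<open>z\<close> of \<open>y\<close> under \<open>R\<close> need
        not lie between \<open>a'\<close> and \<open>c'\<close>, as \<open>R\<close> and
        \<open>r\<close> share only some pairs. It still serves as a sample point: the roots of
        nonzero members of \<open>D1\<close> are shared, so none of them separates \<open>z\<close>
        from that interval.\<close>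
      obtain z where z: "good E (insert (y, z) R)" using R(2) unfolding fwd_def by blast
      have nof: "poly f x \<noteq> 0" if f: "(f, g) \<in> D1" "f \<noteq> 0" and x: "a < x" "x < c" for f g x
      proof
        assume "poly f x = 0"
        then obtain x' where "(x, x') \<in> r" using rootsf[OF f] by auto
        with between(6)[OF this] x show False by auto
      qed
      have sgf: "sg (poly f x) = sg (poly f y)" if f: "(f, g) \<in> D1" and x: "a < x" "x < c" for f g x
      proof (cases "f = 0")
        case False
        show ?thesis
        proof (cases "x \<le> y")
          case True
          show ?thesis using True x between(3,4) by (intro sg_poly_constant nof[OF f False]) auto
        next
          case le: False
          have "sg (poly f y) = sg (poly f x)" using le x between(3,4)
            by (intro sg_poly_constant nof[OF f False]) auto
          thus ?thesis by simp
        qed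
      qed auto
      have nog: "poly g x' \<noteq> 0" if f: "(f, g) \<in> D1" "g \<noteq> 0"
        and x: "a' < x' \<and> x' < c' \<or> a' < x' \<and> x' \<le> z \<or> x' < c' \<and> z \<le> x'" for f g x'
      proof
        assume 0: "poly g x' = 0"
        then obtain x where xx: "(x, x') \<in> r" "(x, x') \<in> R" using rootsg[OF f] by auto
        have "f \<noteq> 0" using zero f by auto
        have ord: "y < x \<longleftrightarrow> z < x'" "x < y \<longleftrightarrow> x' < z"
          using goodD(2)[OF z, of y z x x'] goodD(2)[OF z, of x x' y z] xx by auto
        have "poly f y \<noteq> 0" using nof[OF f(1) \<open>f \<noteq> 0\<close>] between by auto
        hence "poly g z \<noteq> 0" using goodD(3)[OF z, of f g y z] f sub sg_cong(3) by blast
        hence "x' \<noteq> z" using 0 by auto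
        show False using between(6)[OF xx(1)] x ord \<open>x' \<noteq> z\<close> between by auto
      qed
      have sgg: "sg (poly g x') = sg (poly f y)" if f: "(f, g) \<in> D1" and x: "a' < x'" "x' < c'" for f g x'
      proof (cases "g = 0")
        case True
        thus ?thesis using zero[OF f] by simp
      next
        case False
        have "sg (poly g x') = sg (poly g z)"
        proof (cases "x' \<le> z")
          case True
          show ?thesis using True x by (intro sg_poly_constant nog[OF f False]) auto
        next
          case le: False
          have "sg (poly g z) = sg (poly g x')" using le x
            by (intro sg_poly_constant nog[OF f False]) auto
          thus ?thesis by simp
        qed
        also have "\<dots> = sg (poly f y)" using goodD(3)[OF z, of f g y z] f sub by auto
        finally show ?thesis .
      qed
      have p': "(pderiv p, pderiv q) \<in> D1" by (simp add: D1_def)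
      have "\<exists>b>a'. b < c' \<and> sg (poly p y) = sg (poly q b)"
      proof (rule match_sign[where s = "sg (poly (pderiv p) y)"])
        show "sg (poly (pderiv p) x) = sg (poly (pderiv p) y)" if "a < x" "x < c" for x
          using sgf[OF p' that] .
        show "sg (poly (pderiv q) x) = sg (poly (pderiv p) y)" if "a' < x" "x < c'" for x
          using sgg[OF p' that] .
        show "sg (poly (pderiv p) y) \<noteq> 0" using nof[OF p' \<open>pderiv p \<noteq> 0\<close>] between by simp
        show "sg (poly p a) = sg (poly q a')" "sg (poly p c) = sg (poly q c')"
          using goodD(3)[OF r, of p q] between by (auto simp: D_def)
      qed (use between in auto)
      then obtain b where b: "a' < b" "b < c'" "sg (poly p y) = sg (poly q b)" by auto
      have "sg (poly f y) = sg (poly g b)" if "(f, g) \<in> D" for f g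
        using that b sgg[of f g b] unfolding D_def D1_def by auto
      moreover have "(y < x) = (b < d) \<and> (x < y) = (d < b)" if "(x, d) \<in> r" for x d
        using between(6)[OF that] between(3,4) b by auto
      ultimately show ?thesis using ins[of y b] by blast
    qed
  qed
qed

text \<open>Equal degrees are required at this end because the parity of the degree enters the
  sign.\<close>

lemma sg_common_at_bot:
  assumes "finite D"
    and "\<And>f g. (f, g) \<in> D \<Longrightarrow> degree f = degree g \<and> sg (lead_coeff f) = sg (lead_coeff g)"
  shows "\<exists>(L::'a::linordered_field) (L'::'b::linordered_field). \<forall>(f, g)\<in>D. \<forall>a\<le>L. \<forall>b\<le>L'. sg (poly f a) = sg (poly g b)"
  using assms
proof induction
  case (insert fg D)
  obtain f g where fg: "fg = (f, g)" by (cases fg)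
  from insert obtain L L' where L: "\<forall>(f, g)\<in>D. \<forall>a\<le>L. \<forall>b\<le>L'. sg (poly f a) = sg (poly g b)" by blast
  obtain m where m: "\<forall>x\<le>m. sg (poly f x) = sg (lead_coeff f) * (- 1) ^ degree f"
    using sg_poly_at_bot by blast
  obtain m' where m': "\<forall>x\<le>m'. sg (poly g x) = sg (lead_coeff g) * (- 1) ^ degree g"
    using sg_poly_at_bot by blast
  show ?case
    using L m m' insert(4)[of f g] fg by (intro exI[of _ "min L m"] exI[of _ "min L' m'"]) auto
qed auto

lemma sg_common_at_top:
  assumes "finite D"
    and "\<And>f g. (f, g) \<in> D \<Longrightarrow> sg (lead_coeff f) = sg (lead_coeff g)"
  shows "\<exists>(U::'a::linordered_field) (U'::'b::linordered_field). \<forall>(f, g)\<in>D. \<forall>a\<ge>U. \<forall>b\<ge>U'. sg (poly f a) = sg (poly g b)"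
  using assms
proof induction
  case (insert fg D)
  obtain f g where fg: "fg = (f, g)" by (cases fg)
  from insert obtain L L' where L: "\<forall>(f, g)\<in>D. \<forall>a\<ge>L. \<forall>b\<ge>L'. sg (poly f a) = sg (poly g b)" by blast
  obtain m where m: "\<forall>x\<ge>m. sg (poly f x) = sg (lead_coeff f)"
    using sg_poly_at_top by blast
  obtain m' where m': "\<forall>x\<ge>m'. sg (poly g x) = sg (lead_coeff g)"
    using sg_poly_at_top by blast
  show ?case
    using L m m' insert(4)[of f g] fg by (intro exI[of _ "max L m"] exI[of _ "max L' m'"]) auto
qed auto

text \<open>The hypotheses are what sign conditions on the parameters can guarantee:
  \<open>deg\<close> fixes the signs near both infinities, and \<open>red\<close> provides for each
  nonzero member of \<open>D1\<close> a pair in \<open>E\<close> (later a remainder) that has the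
  signs of \<open>p\<close> and \<open>q\<close> at its roots.\<close>

lemma sim_step:
  fixes p :: "'a::rcf poly" and q :: "'b::rcf poly" and D0 :: "('a poly \<times> 'b poly) set"
  defines "D1 \<equiv> insert (pderiv p, pderiv q) D0" and "D \<equiv> insert (p, q) D0"
  assumes E: "sim E" and sub: "D1 \<subseteq> E" and fin: "finite D0"
    and deg: "\<And>f g. (f, g) \<in> D \<Longrightarrow> degree f = degree g \<and> sg (lead_coeff f) = sg (lead_coeff g)"
    and "degree p \<ge> 1"
    and red: "\<And>f g. (f, g) \<in> D1 \<Longrightarrow> f \<noteq> 0 \<Longrightarrow> g \<noteq> 0 \<Longrightarrow>
      \<exists>(u, w)\<in>E. (\<forall>a. poly f a = 0 \<longrightarrow> sg (poly u a) = sg (poly p a)) \<and> (\<forall>b. poly g b = 0 \<longrightarrow> sg (poly w b) = sg (poly q b))"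
  shows "sim D"
proof -
  have dq: "degree q \<ge> 1" using deg[of p q] \<open>degree p \<ge> 1\<close> by (auto simp: D_def)
  have p'0: "pderiv p \<noteq> 0" and q'0: "pderiv q \<noteq> 0"
    using \<open>degree p \<ge> 1\<close> dq by (auto simp: pderiv_eq_0_iff)
  have zero: "f = 0 \<longleftrightarrow> g = 0" if "(f, g) \<in> D1" for f g
    using that p'0 q'0 deg[of f g] sg_cong(3)[of "lead_coeff f" "lead_coeff g"]
    by (auto simp: D1_def D_def)
  define Z where "Z = (\<Union>(f, g)\<in>{(f, g)\<in>D1. f \<noteq> 0}. {a. poly f a = 0})"
  define Z' where "Z' = (\<Union>(f, g)\<in>{(f, g)\<in>D1. g \<noteq> 0}. {b. poly g b = 0})"
  have "finite D1" "finite D" using fin by (auto simp: D1_def D_def)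
  have fZ: "finite Z" unfolding Z_def
    by (intro finite_UN_I finite_subset[OF _ \<open>finite D1\<close>]) (auto intro: poly_roots_finite)
  have fZ': "finite Z'" unfolding Z'_def
    by (intro finite_UN_I finite_subset[OF _ \<open>finite D1\<close>]) (auto intro: poly_roots_finite)
  obtain L L' where L: "\<forall>(f, g)\<in>D. \<forall>a\<le>L. \<forall>b\<le>L'. sg (poly f a) = sg (poly g b)"
    using sg_common_at_bot[OF \<open>finite D\<close> deg] by blast
  obtain U U' where U: "\<forall>(f, g)\<in>D. \<forall>a\<ge>U. \<forall>b\<ge>U'. sg (poly f a) = sg (poly g b)"
    using sg_common_at_top[OF \<open>finite D\<close>] deg by blast
  obtain r0 where r0: "good E r0" "\<And>r. r0 \<subseteq> r \<Longrightarrow> good E r \<Longrightarrow> fwd E r \<and> bwd E r"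
    using E unfolding sim_def by blast
  have "finite (Z \<union> {L, U})" "finite (Z' \<union> {L', U'})" using fZ fZ' by auto
  from sim_extend[OF r0 this]
  obtain R where R: "r0 \<subseteq> R" "good E R" "Z \<union> {L, U} \<subseteq> Domain R" "Z' \<union> {L', U'} \<subseteq> Range R" by blast
  have fR: "finite (Domain R)" "Domain R \<noteq> {}" using goodD(1)[OF R(2)] R(3) by (auto intro: finite_Domain)
  obtain l' where l': "(Min (Domain R), l') \<in> R" using Min_in[OF fR] by auto
  obtain u' where u': "(Max (Domain R), u') \<in> R" using Max_in[OF fR] by auto
  define l u where "l = Min (Domain R)" and "u = Max (Domain R)"
  have l: "(l, l') \<in> R" "l \<le> L" using l' R(3) fR by (auto simp: l_def)
  have u: "(u, u') \<in> R" "U \<le> u" using u' R(3) fR by (auto simp: u_def)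
  have "l' \<le> L'"
  proof -
    obtain x where x: "(x, L') \<in> R" using R(4) by auto
    have "l \<le> x" unfolding l_def by (rule Min_le[OF fR(1)]) (use x in auto)
    thus ?thesis using good_le_iff[OF R(2) l(1) x] by simp
  qed
  have "U' \<le> u'"
  proof -
    obtain x where x: "(x, U') \<in> R" using R(4) by auto
    have "x \<le> u" unfolding u_def by (rule Max_ge[OF fR(1)]) (use x in auto)
    thus ?thesis using good_le_iff[OF R(2) x u(1)] by simp
  qed
  have Lr: "sg (poly f a) = sg (poly g b)" if "(f, g) \<in> D" "a \<le> l" "b \<le> l'" for f g a b
  proof -
    have "a \<le> L" "b \<le> L'" using that \<open>l' \<le> L'\<close> l(2) by auto
    thus ?thesis using that(1) L by blast
  qed
  have Ur: "sg (poly f a) = sg (poly g b)" if "(f, g) \<in> D" "u \<le> a" "u' \<le> b" for f g a b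
  proof -
    have "U \<le> a" "U' \<le> b" using that \<open>U' \<le> u'\<close> u(2) by auto
    thus ?thesis using that(1) U by blast
  qed
  \<comment> \<open>Other pairs of \<open>R\<close> must be dropped, since nothing relates the signs
    of \<open>p\<close> and \<open>q\<close> there. At roots they agree by the remainders, at the
    two extreme pairs by the behaviour at infinity.\<close>
  define r1 where "r1 = {(a, b)\<in>R. a \<in> Z} \<union> {(l, l'), (u, u')}"
  have r1R: "r1 \<subseteq> R" using l u by (auto simp: r1_def)
  have r1: "good D r1"
    unfolding good_def
  proof (intro conjI)
    show "finite r1" using finite_subset[OF r1R] goodD(1)[OF R(2)] .
    show "\<forall>a b c d. (a, b) \<in> r1 \<longrightarrow> (c, d) \<in> r1 \<longrightarrow> (a < c \<longleftrightarrow> b < d)"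
      using goodD(2)[OF R(2)] r1R by blast
    have "sg (poly f a) = sg (poly g b)" if fg: "(f, g) \<in> D" and ab: "(a, b) \<in> r1" for f g a b
    proof (cases "(a, b) \<in> R \<and> a \<in> Z")
      case False
      thus ?thesis using ab Lr[OF fg] Ur[OF fg] by (auto simp: r1_def)
    next
      case True
      show ?thesis
      proof (cases "(f, g) = (p, q)")
        case False
        thus ?thesis using fg sub goodD(3)[OF R(2), of f g a b] True by (auto simp: D_def D1_def)
      next
        case pq: True
        obtain h k where hk: "(h, k) \<in> D1" "h \<noteq> 0" "poly h a = 0" using True by (auto simp: Z_def)
        have k: "k \<noteq> 0" "poly k b = 0"
          using zero[OF hk(1)] hk goodD(3)[OF R(2), of h k a b] True sub by (auto simp: sg_def split: if_splits)
        obtain v w where "(v, w) \<in> E" "sg (poly v a) = sg (poly p a)" "sg (poly w b) = sg (poly q b)"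
          using red[OF hk(1,2) k(1)] hk k by blast
        thus ?thesis using goodD(3)[OF R(2), of v w a b] True pq by simp
      qed
    qed
    thus "\<forall>p q a b. (p, q) \<in> D \<longrightarrow> (a, b) \<in> r1 \<longrightarrow> sg (poly p a) = sg (poly q b)" by blast
  qed
  have rootsf: "a \<in> Domain (R \<inter> r1)" if "(f, g) \<in> D1" "f \<noteq> 0" "poly f a = 0" for f g a
  proof -
    have "a \<in> Z" using that by (auto simp: Z_def)
    then obtain b where "(a, b) \<in> R" using R(3) by auto
    thus ?thesis using \<open>a \<in> Z\<close> by (auto simp: r1_def)
  qed
  have rootsg: "b \<in> Range (R \<inter> r1)" if fg: "(f, g) \<in> D1" "g \<noteq> 0" "poly g b = 0" for f g b
  proof -
    have "b \<in> Z'" using that by (auto simp: Z'_def)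
    then obtain a where a: "(a, b) \<in> R" using R(4) by auto
    have "poly f a = 0" using goodD(3)[OF R(2), of f g a b] fg a sub by auto
    hence "a \<in> Z" using fg zero[OF fg(1)] by (auto simp: Z_def)
    thus ?thesis using a by (auto simp: r1_def)
  qed
  have ext: "fwd D r \<and> bwd D r" if r: "r1 \<subseteq> r" "good D r" for r
  proof
    have "(l, l') \<in> r" "(u, u') \<in> r" using r by (auto simp: r1_def)
    have "fwd E R" "bwd E R" using r0(2)[OF R(1,2)] by auto
    show "fwd D r" unfolding D_def
    proof (rule hormander_fwd[of E R p q D0 r l l' u u'], fold D_def D1_def)
      show "a \<in> Domain (R \<inter> r)" if "(f, g) \<in> D1" "f \<noteq> 0" "poly f a = 0" for f g a
        using rootsf[OF that] r by auto
      show "b \<in> Range (R \<inter> r)" if "(f, g) \<in> D1" "g \<noteq> 0" "poly g b = 0" for f g b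
        using rootsg[OF that] r by auto
    qed (fact | use r in simp | erule zero | erule (2) Lr | erule (2) Ur)+
    have conv: "insert (pderiv q, pderiv p) (D0\<inverse>) = D1\<inverse>" "insert (q, p) (D0\<inverse>) = D\<inverse>"
      by (auto simp: D_def D1_def)
    have dr: "Domain (R\<inverse> \<inter> r\<inverse>) = Range (R \<inter> r)" "Range (R\<inverse> \<inter> r\<inverse>) = Domain (R \<inter> r)" by auto
    have "fwd (insert (q, p) (D0\<inverse>)) (r\<inverse>)"
    proof (rule hormander_fwd[of "E\<inverse>" "R\<inverse>" q p "D0\<inverse>" "r\<inverse>" l' l u' u], unfold conv dr)
      show "fwd (E\<inverse>) (R\<inverse>)" using \<open>bwd E R\<close> by (simp add: bwd_conv_fwd)
      show "f \<in> Range (R \<inter> r)" if "(h, g) \<in> D1\<inverse>" "h \<noteq> 0" "poly h f = 0" for f h g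
        using rootsg[of g h f] that r by auto
      show "f \<in> Domain (R \<inter> r)" if "(h, g) \<in> D1\<inverse>" "g \<noteq> 0" "poly g f = 0" for f h g
        using rootsf[of g h f] that r by auto
      show "(f = 0) = (g = 0)" if "(f, g) \<in> D1\<inverse>" for f g
        using zero[of g f] that by auto
      show "sg (poly f a) = sg (poly g b)" if "(f, g) \<in> D\<inverse>" "a \<le> l'" "b \<le> l" for f g a b
        using Lr[of g f b a] that by auto
      show "sg (poly f a) = sg (poly g b)" if "(f, g) \<in> D\<inverse>" "u' \<le> a" "u \<le> b" for f g a b
        using Ur[of g f b a] that by auto
    qed (use R sub r q'0 \<open>(l, l') \<in> r\<close> \<open>(u, u') \<in> r\<close> in simp_all)
    thus "bwd D r" by (simp add: bwd_conv_fwd conv)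
  qed
  show ?thesis unfolding sim_def using r1 ext by blast
qed

section \<open>Quantifier elimination\<close>

text \<open>\<open>peval_r\<close> and \<open>peval_ps\<close> have fixed carriers; this common
  version is linked to them by \<open>peval_real\<close> and \<open>peval_ps_cf\<close>.\<close>

primrec peval :: "'v rpoly \<Rightarrow> ('v \<Rightarrow> 'a::rcf) \<Rightarrow> 'a" where
  "peval (PVar v) x = x v"
| "peval (PConst c) x = of_real c"
| "peval (PAdd p q) x = peval p x + peval q x"
| "peval (PMul p q) x = peval p x * peval q x"
| "peval (PNeg p) x = - peval p x"

primrec holds :: "'v sfml \<Rightarrow> ('v \<Rightarrow> 'a::rcf) \<Rightarrow> bool" where
  "holds (FPos p) x = (peval p x > 0)"
| "holds (FZero p) x = (peval p x = 0)"
| "holds (FNot f) x = (\<not> holds f x)"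
| "holds (FAnd f g) x = (holds f x \<and> holds g x)"
| "holds (FOr f g) x = (holds f x \<or> holds g x)"

lemma peval_real: "peval p x = peval_r p x"
  by (induction p) auto

lemma holds_real: "holds f x = holds_r f x"
  by (induction f) (auto simp: peval_real)

lemma peval_of_real: "peval p (\<lambda>v. of_real (x v)) = of_real (peval p x)"
  by (induction p) auto

lemma holds_of_real: "holds f (\<lambda>v. of_real (x v) :: 'a::rcf) = holds f x"
  by (induction f) (auto simp: peval_of_real of_real_pos_iff)

lemma peval_map: "peval (map_rpoly g p) x = peval p (\<lambda>v. x (g v))"
  by (induction p) auto

lemma holds_map: "holds (map_sfml g f) x = holds f (\<lambda>v. x (g v))"
  by (induction f) (auto simp: peval_map)

text \<open>Coefficients remain terms in the parameters, so one list can be evaluated over either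
  field. The last entry may evaluate to 0, which forces a case distinction before degrees can be
  read off.\<close>

definition upoly :: "'v rpoly list \<Rightarrow> ('v \<Rightarrow> 'a::rcf) \<Rightarrow> 'a poly" where
  "upoly cs x = Poly (map (\<lambda>c. peval c x) cs)"

lemma upoly_simps [simp]:
  "upoly [] x = 0" "upoly (c # cs) x = pCons (peval c x) (upoly cs x)"
  by (auto simp: upoly_def)

lemma coeff_upoly: "coeff (upoly cs x) i = (if i < length cs then peval (cs ! i) x else 0)"
  by (simp add: upoly_def nth_default_def)

section \<open>Arithmetic of coefficient lists\<close>

fun ladd :: "'v rpoly list \<Rightarrow> 'v rpoly list \<Rightarrow> 'v rpoly list" where
  "ladd [] ys = ys"
| "ladd xs [] = xs"
| "ladd (x # xs) (y # ys) = PAdd x y # ladd xs ys"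

primrec lmul :: "'v rpoly list \<Rightarrow> 'v rpoly list \<Rightarrow> 'v rpoly list" where
  "lmul [] ys = []"
| "lmul (x # xs) ys = ladd (map (PMul x) ys) (PConst 0 # lmul xs ys)"

lemma upoly_ladd: "upoly (ladd xs ys) x = upoly xs x + upoly ys x"
  by (induction xs ys rule: ladd.induct) auto

lemma upoly_map_PMul: "upoly (map (PMul c) ys) x = smult (peval c x) (upoly ys x)"
  by (induction ys) auto

lemma upoly_map_PNeg: "upoly (map PNeg ys) x = - upoly ys x"
  by (induction ys) auto

lemma upoly_lmul: "upoly (lmul xs ys) x = upoly xs x * upoly ys x"
  by (induction xs) (auto simp: upoly_ladd upoly_map_PMul)

primrec ucoef :: "'v option rpoly \<Rightarrow> 'v rpoly list" where
  "ucoef (PVar v) = (case v of None \<Rightarrow> [PConst 0, PConst 1] | Some w \<Rightarrow> [PVar w])"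
| "ucoef (PConst c) = [PConst c]"
| "ucoef (PAdd p q) = ladd (ucoef p) (ucoef q)"
| "ucoef (PMul p q) = lmul (ucoef p) (ucoef q)"
| "ucoef (PNeg p) = map PNeg (ucoef p)"

lemma poly_upoly_ucoef: "poly (upoly (ucoef p) x) y = peval p (case_option y x)"
  by (induction p) (auto simp: upoly_ladd upoly_lmul upoly_map_PNeg split: option.splits)

definition lderiv :: "'v rpoly list \<Rightarrow> 'v rpoly list" where
  "lderiv cs = map (\<lambda>i. PMul (PConst (real (Suc i))) (cs ! Suc i)) [0..<length cs - 1]"

lemma length_lderiv [simp]: "length (lderiv cs) = length cs - 1"
  by (simp add: lderiv_def)

lemma upoly_lderiv: "upoly (lderiv cs) x = pderiv (upoly cs x)"
  by (rule poly_eqI) (auto simp: coeff_upoly coeff_pderiv lderiv_def simp flip: of_nat_Suc)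

text \<open>The top coefficients cancel identically, so the list can be one entry shorter than
  \<open>ps\<close>. A single step is enough, because the recursion only asks for shorter
  lists.\<close>

definition lreduce :: "'v rpoly list \<Rightarrow> 'v rpoly list \<Rightarrow> 'v rpoly list" where
  "lreduce ps qs = map (\<lambda>i. PAdd (PMul (PMul (last qs) (last qs)) (ps ! i))
      (if i + length qs < length ps then PConst 0
       else PNeg (PMul (PMul (last qs) (last ps)) (qs ! (i + length qs - length ps))))) [0..<length ps - 1]"

lemma length_lreduce [simp]: "length (lreduce ps qs) = length ps - 1"
  by (simp add: lreduce_def)

text \<open>One step of pseudo-division, multiplying by the square of the leading coefficient
  so that signs at the roots of the divisor are preserved.\<close>
lemma upoly_lreduce:
  assumes "qs \<noteq> []" "length qs \<le> length ps"
  shows "upoly (lreduce ps qs) x = smult ((peval (last qs) x)\<^sup>2) (upoly ps x)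
    - smult (peval (last qs) x * peval (last ps) x) (monom 1 (length ps - length qs) * upoly qs x)"
proof (rule poly_eqI)
  fix i
  have ne: "ps \<noteq> []" using assms by auto
  consider "i < length ps - 1" | "i = length ps - 1" | "i \<ge> length ps" by linarith
  then show "coeff (upoly (lreduce ps qs) x) i = coeff (smult ((peval (last qs) x)\<^sup>2) (upoly ps x)
    - smult (peval (last qs) x * peval (last ps) x) (monom 1 (length ps - length qs) * upoly qs x)) i"
  proof cases
    case 1
    have "i + length qs - length ps = i - (length ps - length qs)" using assms by linarith
    thus ?thesis using 1 assms
      by (auto simp: coeff_upoly lreduce_def coeff_monom_mult power2_eq_square)
  next
    case 2
    have *: "length ps - Suc 0 - (length ps - length qs) = length qs - 1"
      "length ps - length qs \<le> length ps - Suc 0" using assms by (cases qs; simp)+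
    have "\<not> length ps - Suc 0 < length ps - length qs" using assms by (cases qs) auto
    with * show ?thesis using 2 assms ne
      by (simp add: coeff_upoly lreduce_def coeff_monom_mult last_conv_nth power2_eq_square *)
  next
    case 3
    thus ?thesis using assms by (auto simp: coeff_upoly lreduce_def coeff_monom_mult)
  qed
qed

lemma sg_upoly_lreduce:
  assumes "qs \<noteq> []" "length qs \<le> length ps" "peval (last qs) x \<noteq> 0" "poly (upoly qs x) a = 0"
  shows "sg (poly (upoly (lreduce ps qs) x) a) = sg (poly (upoly ps x) a)"
proof -
  have "sg ((peval (last qs) x)\<^sup>2) = 1" using assms(3) by simp
  thus ?thesis using assms by (simp add: upoly_lreduce sg_mult)
qed

lemma upoly_butlast:
  assumes "cs \<noteq> []" "peval (last cs) x = 0"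
  shows "upoly (butlast cs) x = upoly cs x"
proof (rule poly_eqI)
  fix i
  show "coeff (upoly (butlast cs) x) i = coeff (upoly cs x) i"
    using assms by (cases "i = length cs - 1") (auto simp: coeff_upoly nth_butlast last_conv_nth)
qed

lemma degree_upoly:
  assumes "cs \<noteq> []" "peval (last cs) x \<noteq> 0"
  shows "degree (upoly cs x) = length cs - 1" "lead_coeff (upoly cs x) = peval (last cs) x"
proof -
  have c: "coeff (upoly cs x) (length cs - 1) = peval (last cs) x"
    using assms by (auto simp: coeff_upoly last_conv_nth)
  have "degree (upoly cs x) \<le> length cs - 1"
    by (rule degree_le) (auto simp: coeff_upoly)
  moreover have "length cs - 1 \<le> degree (upoly cs x)"
    by (rule le_degree) (use c assms in simp)
  ultimately show "degree (upoly cs x) = length cs - 1" by simp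
  thus "lead_coeff (upoly cs x) = peval (last cs) x" using c by simp
qed

section \<open>Sign conditions on the parameters and the elimination recursion\<close>

definition agree :: "'v rpoly set \<Rightarrow> ('v \<Rightarrow> 'a::rcf) \<Rightarrow> ('v \<Rightarrow> 'b::rcf) \<Rightarrow> bool" where
  "agree G x y \<longleftrightarrow> (\<forall>c\<in>G. sg (peval c x) = sg (peval c y))"

definition pairs :: "'v rpoly list set \<Rightarrow> ('v \<Rightarrow> 'a::rcf) \<Rightarrow> ('v \<Rightarrow> 'b::rcf) \<Rightarrow> ('a poly \<times> 'b poly) set" where
  "pairs F x y = (\<lambda>cs. (upoly cs x, upoly cs y)) ` F"

text \<open>Equal signs of the conditions \<open>G\<close> at two parameter tuples force matching
  sign diagrams of the family \<open>F\<close>. The type arguments name the fields of the two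
  tuples.\<close>

definition adeq :: "'a::rcf itself \<Rightarrow> 'b::rcf itself \<Rightarrow> 'v rpoly set \<Rightarrow> 'v rpoly list set \<Rightarrow> bool" where
  "adeq _ _ G F \<longleftrightarrow> (\<forall>(x::'v \<Rightarrow> 'a) (y::'v \<Rightarrow> 'b). agree G x y \<longrightarrow> sim (pairs F x y))"

lemma agree_mono: "agree G x y \<Longrightarrow> H \<subseteq> G \<Longrightarrow> agree H x y"
  by (auto simp: agree_def)

lemma adeq_const:
  fixes F :: "'v rpoly list set"
  assumes "\<And>cs. cs \<in> F \<Longrightarrow> length cs \<le> 1"
  shows "adeq TYPE('a::rcf) TYPE('b::rcf) (\<Union>cs\<in>F. set cs) F"
  unfolding adeq_def
proof (intro allI impI)
  fix x :: "'v \<Rightarrow> 'a" and y :: "'v \<Rightarrow> 'b"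
  assume ag: "agree (\<Union>cs\<in>F. set cs) x y"
  show "sim (pairs F x y)"
  proof (rule sim_const)
    fix p q a b assume "(p, q) \<in> pairs F x y"
    then obtain cs where cs: "cs \<in> F" "p = upoly cs x" "q = upoly cs y" by (auto simp: pairs_def)
    with assms[of cs] have "cs = [] \<or> (\<exists>c. cs = [c])" by (cases cs) auto
    thus "sg (poly p a) = sg (poly q b)" using cs ag by (auto simp: agree_def)
  qed
qed

definition reduced :: "'v rpoly list set \<Rightarrow> 'v rpoly list \<Rightarrow> 'v rpoly list set" where
  "reduced F p = (F - {p}) \<union> (insert (lderiv p) (lreduce p ` ({cs\<in>insert (lderiv p) (F - {p}). cs \<noteq> []})))"

text \<open>Stands in for \<open>F\<close> at parameters where the last coefficient of
  \<open>cs\<close> is 0.\<close>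

definition truncated :: "'v rpoly list set \<Rightarrow> 'v rpoly list \<Rightarrow> 'v rpoly list set" where
  "truncated F cs = (F - {cs}) \<union> {butlast cs}"

text \<open>The leading coefficients belong to the conditions, so both tuples fall into the same
  case: either one of these coefficients vanishes and is cut off, or all are nonzero and
  \<open>sim_step\<close> applies. Maximality of \<open>length p\<close> makes every other member,
  and the derivative, an admissible divisor.\<close>

lemma adeq_step:
  fixes G0 :: "'v rpoly set"
  assumes "finite F" "p \<in> F" "length p \<ge> 2" and max: "\<And>cs. cs \<in> F \<Longrightarrow> length cs \<le> length p"
    and red: "adeq TYPE('a::rcf) TYPE('b::rcf) G0 (reduced F p)"
    and trunc: "\<And>cs. cs \<in> F \<Longrightarrow> cs \<noteq> [] \<Longrightarrow> adeq TYPE('a) TYPE('b) (G1 cs) (truncated F cs)"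
  shows "adeq TYPE('a) TYPE('b) (G0 \<union> (last ` (F - {[]})) \<union> (\<Union>cs\<in>F - {[]}. G1 cs)) F"
  unfolding adeq_def
proof (intro allI impI)
  fix x :: "'v \<Rightarrow> 'a" and y :: "'v \<Rightarrow> 'b"
  assume ag: "agree (G0 \<union> (last ` (F - {[]})) \<union> (\<Union>cs\<in>F - {[]}. G1 cs)) x y"
  show "sim (pairs F x y)"
  proof (cases "\<exists>cs\<in>F - {[]}. peval (last cs) x = 0")
    case True
    then obtain cs where cs: "cs \<in> F" "cs \<noteq> []" "peval (last cs) x = 0" by auto
    hence y0: "peval (last cs) y = 0"
    proof -
      have "sg (peval (last cs) x) = sg (peval (last cs) y)" using ag cs(1,2) by (auto simp: agree_def)
      thus ?thesis using cs(3) sg_cong(3) by blast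
    qed
    have "sim (pairs (truncated F cs) x y)"
      using trunc[OF cs(1,2)] agree_mono[OF ag, of "G1 cs"] cs unfolding adeq_def by blast
    also have "pairs (truncated F cs) x y = pairs (insert cs (F - {cs})) x y"
      unfolding pairs_def truncated_def
      by (simp only: Un_insert_right Un_empty_right image_insert upoly_butlast[OF cs(2,3)] upoly_butlast[OF cs(2) y0])
    also have "insert cs (F - {cs}) = F" using cs by auto
    finally show ?thesis .
  next
    case False
    hence nz: "peval (last cs) x \<noteq> 0" if "cs \<in> F" "cs \<noteq> []" for cs using that by auto
    have lsg: "sg (peval (last cs) x) = sg (peval (last cs) y)" if "cs \<in> F" "cs \<noteq> []" for cs
      using ag that by (auto simp: agree_def)
    have nzy: "peval (last cs) y \<noteq> 0" if "cs \<in> F" "cs \<noteq> []" for cs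
      using nz[OF that] sg_cong(3)[OF lsg[OF that]] by auto
    have p: "p \<noteq> []" using assms by auto
    have "length (lderiv p) \<noteq> 0" using \<open>length p \<ge> 2\<close> unfolding length_lderiv by linarith
    hence d1: "lderiv p \<noteq> []" by (rule contrapos_nn) simp
    have lastd: "last (lderiv p) = PMul (PConst (real (length p - 1))) (last p)"
      using d1 p \<open>length p \<ge> 2\<close> by (simp add: last_conv_nth) (simp add: lderiv_def Suc_diff_Suc)
    have sim': "sim (pairs (reduced F p) x y)"
      using red agree_mono[OF ag, of G0] unfolding adeq_def by blast
    have F: "insert (upoly p x, upoly p y) (pairs (F - {p}) x y) = pairs F x y"
      using image_insert[of "\<lambda>cs. (upoly cs x, upoly cs y)" p "F - {p}"]
      unfolding pairs_def insert_Diff[OF assms(2)] by (rule sym)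
    have "sim (insert (upoly p x, upoly p y) (pairs (F - {p}) x y))"
    proof (rule sim_step[OF sim'])
      show "insert (pderiv (upoly p x), pderiv (upoly p y)) (pairs (F - {p}) x y) \<subseteq> pairs (reduced F p) x y"
        by (auto simp: pairs_def reduced_def upoly_lderiv[symmetric])
      show "finite (pairs (F - {p}) x y)" using assms(1) by (simp add: pairs_def)
      show "1 \<le> degree (upoly p x)" using degree_upoly[OF p nz[OF assms(2) p]] assms(3) by simp
    next
      fix f g assume "(f, g) \<in> insert (upoly p x, upoly p y) (pairs (F - {p}) x y)"
      hence "(f, g) \<in> pairs F x y" unfolding F .
      then obtain cs where cs: "cs \<in> F" "f = upoly cs x" "g = upoly cs y" by (auto simp: pairs_def)
      show "degree f = degree g \<and> sg (lead_coeff f) = sg (lead_coeff g)"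
        using cs nz[OF cs(1)] nzy[OF cs(1)] lsg[OF cs(1)] by (cases "cs = []") (simp_all add: degree_upoly coeff_upoly last_conv_nth)
    next
      fix f g assume fg: "(f, g) \<in> insert (pderiv (upoly p x), pderiv (upoly p y)) (pairs (F - {p}) x y)"
        "f \<noteq> 0" "g \<noteq> 0"
      then obtain cs where cs: "cs \<in> insert (lderiv p) (F - {p})" "f = upoly cs x" "g = upoly cs y"
        by (auto simp: pairs_def upoly_lderiv[symmetric])
      have ne: "cs \<noteq> []" using fg cs by auto
      have len: "length cs \<le> length p" using cs max by auto
      have nzc: "peval (last cs) x \<noteq> 0" "peval (last cs) y \<noteq> 0"
        using cs(1) ne lastd nz nzy assms(2,3) p by auto
      have "(upoly (lreduce p cs) x, upoly (lreduce p cs) y) \<in> pairs (reduced F p) x y"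
        using cs(1) ne by (auto simp: pairs_def reduced_def)
      moreover have "\<forall>a. poly f a = 0 \<longrightarrow> sg (poly (upoly (lreduce p cs) x) a) = sg (poly (upoly p x) a)"
        using sg_upoly_lreduce[OF ne len nzc(1)] cs(2) by simp
      moreover have "\<forall>b. poly g b = 0 \<longrightarrow> sg (poly (upoly (lreduce p cs) y) b) = sg (poly (upoly p y) b)"
        using sg_upoly_lreduce[OF ne len nzc(2)] cs(3) by simp
      ultimately show "\<exists>(u, w)\<in>pairs (reduced F p) x y.
          (\<forall>a. poly f a = 0 \<longrightarrow> sg (poly u a) = sg (poly (upoly p x) a)) \<and>
          (\<forall>b. poly g b = 0 \<longrightarrow> sg (poly w b) = sg (poly (upoly p y) b))"
        by (intro bexI[of _ "(upoly (lreduce p cs) x, upoly (lreduce p cs) y)"]) auto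
    qed
    thus ?thesis unfolding F .
  qed
qed

definition lengths :: "'v rpoly list set \<Rightarrow> nat multiset" where
  "lengths F = image_mset length (mset_set F)"

text \<open>The recursion trades one list for finitely many shorter ones, whose number may be large;
  this calls for the multiset order.\<close>

lemma lengths_decreasing:
  assumes "finite F" "p \<in> F" "finite N" "\<And>n. n \<in> N \<Longrightarrow> length n < length p"
  shows "(lengths ((F - {p}) \<union> N), lengths F) \<in> mult1 less_than"
proof -
  have "mset_set F = add_mset p (mset_set (F - {p}))"
    using assms by (simp add: mset_set.remove)
  \<comment> \<open>New lists that already occur in the rest are not counted again.\<close>
  moreover have "mset_set ((F - {p}) \<union> N) = mset_set (F - {p}) + mset_set (N - (F - {p}))"
    using assms by (subst mset_set_Union[symmetric]) auto
  moreover have "\<forall>b. b \<in># image_mset length (mset_set (N - (F - {p}))) \<longrightarrow> (b, length p) \<in> less_than"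
    using assms(3,4) by auto
  ultimately show ?thesis unfolding mult1_def lengths_def mem_Collect_eq prod.case
    by (intro exI[of _ "length p"] exI[of _ "image_mset length (mset_set (F - {p}))"]
          exI[of _ "image_mset length (mset_set (N - (F - {p})))"]) simp
qed

text \<open>The set \<open>G\<close> is built from syntax alone and is therefore the same for all
  three pairs of fields. Comparisons within each field are included because
  \<open>sign_invariant_definable\<close> asks for them besides the mixed one.\<close>

lemma adeq_exists:
  assumes "finite (F :: 'v rpoly list set)"
  shows "\<exists>G. finite G \<and> adeq TYPE('a::rcf) TYPE('a) G F \<and> adeq TYPE('a) TYPE('b::rcf) G F \<and> adeq TYPE('b) TYPE('b) G F"
    (is "\<exists>G. ?P G F")
  using assms
proof (induction "lengths F" arbitrary: F rule: wf_induct_rule[OF wf_mult1[OF wf_less_than]])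
  case (1 F)
  show ?case
  proof (cases "\<forall>cs\<in>F. length cs \<le> 1")
    case True
    thus ?thesis using \<open>finite F\<close> by (intro exI[of _ "\<Union>cs\<in>F. set cs"] conjI adeq_const) auto
  next
    case False
    define m where "m = Max (length ` F)"
    have "m \<in> length ` F" unfolding m_def using False \<open>finite F\<close> by (intro Max_in) auto
    then obtain p where p: "p \<in> F" "length p = m" by auto
    have max: "length cs \<le> length p" if "cs \<in> F" for cs
      unfolding p(2) m_def using that \<open>finite F\<close> by auto
    have len: "length p \<ge> 2" using False max by force
    have "\<exists>G. ?P G (reduced F p)"
      unfolding reduced_def
      by (intro 1(1) lengths_decreasing) (use p len \<open>finite F\<close> in auto)
    then obtain G0 where G0: "?P G0 (reduced F p)" by blast
    have "\<exists>G. ?P G (truncated F cs)" if "cs \<in> F - {[]}" for cs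
      unfolding truncated_def
      by (intro 1(1) lengths_decreasing) (use that \<open>finite F\<close> in auto)
    hence "\<forall>cs\<in>F - {[]}. \<exists>G. ?P G (truncated F cs)" by blast
    from bchoice[OF this] obtain G1 where G1: "\<And>cs. cs \<in> F \<Longrightarrow> cs \<noteq> [] \<Longrightarrow> ?P (G1 cs) (truncated F cs)"
      by blast
    show ?thesis
    proof (intro exI conjI)
      show "finite (G0 \<union> (last ` (F - {[]})) \<union> (\<Union>cs\<in>F - {[]}. G1 cs))"
        using G0 G1 \<open>finite F\<close> by auto
    qed (rule adeq_step[OF \<open>finite F\<close> p(1) len max], assumption, use G0 in blast, use G1 in blast)+
  qed
qed

section \<open>From sign conditions to formulas\<close>

definition Ftrue :: "'v sfml" where "Ftrue = FZero (PConst 0)"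
definition Ffalse :: "'v sfml" where "Ffalse = FPos (PConst 0)"

lemma holds_Ftrue [simp]: "holds Ftrue x" "\<not> holds Ffalse x"
  by (auto simp: Ftrue_def Ffalse_def)

definition sign_fml :: "'v rpoly \<Rightarrow> int \<Rightarrow> 'v sfml" where
  "sign_fml c s = (if s = 1 then FPos c else if s = 0 then FZero c else FPos (PNeg c))"

lemma holds_sign_fml: "s \<in> {- 1, 0, 1} \<Longrightarrow> holds (sign_fml c s) x \<longleftrightarrow> sg (peval c x) = s"
  by (auto simp: sign_fml_def)

definition signs :: "'v rpoly list \<Rightarrow> ('v \<Rightarrow> 'a::rcf) \<Rightarrow> int list" where
  "signs cs x = map (\<lambda>c. sg (peval c x)) cs"

definition signs_fml :: "'v rpoly list \<Rightarrow> int list \<Rightarrow> 'v sfml" where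
  "signs_fml cs ss = foldr FAnd (map2 sign_fml cs ss) Ftrue"

lemma holds_signs_fml:
  "length ss = length cs \<Longrightarrow> set ss \<subseteq> {- 1, 0, 1} \<Longrightarrow> holds (signs_fml cs ss) x \<longleftrightarrow> signs cs x = ss"
  unfolding signs_fml_def signs_def
proof (induction cs arbitrary: ss)
  case (Cons c cs)
  thus ?case by (cases ss) (simp_all add: holds_sign_fml)
qed simp

lemma holds_disj: "holds (foldr FOr fs Ffalse) x \<longleftrightarrow> (\<exists>f\<in>set fs. holds f x)"
  by (induction fs) auto

lemma agree_conv_signs: "agree (set cs) x y \<longleftrightarrow> signs cs x = signs cs y"
  by (auto simp: agree_def signs_def)

lemma signs_in: "signs cs x \<in> {ss. set ss \<subseteq> {- 1, 0, 1} \<and> length ss = length cs}"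
  unfolding signs_def by (intro CollectI conjI) (unfold set_map, rule image_subsetI, rule sg_range, simp)

lemma holds_disj_signs:
  assumes "set ts \<subseteq> {ss. set ss \<subseteq> {- 1, 0, 1} \<and> length ss = length cs}"
  shows "holds (foldr FOr (map (signs_fml cs) ts) Ffalse) x \<longleftrightarrow> signs cs x \<in> set ts"
proof -
  have "holds (signs_fml cs ss) x \<longleftrightarrow> signs cs x = ss" if "ss \<in> set ts" for ss
    by (rule holds_signs_fml) (use assms that in blast)+
  thus ?thesis unfolding holds_disj set_map by blast
qed

text \<open>There are finitely many sign vectors, and the formula is the disjunction of those at
  which \<open>P\<close> or \<open>Q\<close> holds somewhere. A vector may be realised in either
  field or in both; the three invariance hypotheses cover every way in which it can be met
  again.\<close>

lemma sign_invariant_definable: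
  fixes P :: "('v \<Rightarrow> 'a::rcf) \<Rightarrow> bool" and Q :: "('v \<Rightarrow> 'b::rcf) \<Rightarrow> bool"
  assumes "finite G"
    and PP: "\<And>x x'. agree G x x' \<Longrightarrow> P x \<longleftrightarrow> P x'"
    and PQ: "\<And>x y. agree G x y \<Longrightarrow> P x \<longleftrightarrow> Q y"
    and QQ: "\<And>y y'. agree G y y' \<Longrightarrow> Q y \<longleftrightarrow> Q y'"
  shows "\<exists>f. (\<forall>x. holds f x \<longleftrightarrow> P x) \<and> (\<forall>y. holds f y \<longleftrightarrow> Q y)"
proof -
  from finite_list[OF assms(1)] obtain cs where cs: "set cs = G" ..
  note ag = agree_conv_signs[of cs, unfolded cs]
  define R where "R ss \<longleftrightarrow> (\<exists>x. signs cs x = ss \<and> P x) \<or> (\<exists>y. signs cs y = ss \<and> Q y)" for ss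
  let ?S = "{ss. set ss \<subseteq> {- 1, 0, 1 :: int} \<and> length ss = length cs}"
  have "finite {ss\<in>?S. R ss}"
    using finite_lists_length_eq[of "{- 1, 0, 1 :: int}" "length cs"] by (rule rev_finite_subset) blast+
  from finite_list[OF this] obtain ts where ts: "set ts = {ss\<in>?S. R ss}" ..
  define f where "f = foldr FOr (map (signs_fml cs) ts) Ffalse"
  have "set ts \<subseteq> ?S" unfolding ts by blast
  note f = holds_disj_signs[OF this, folded f_def, unfolded ts]
  have RP: "R (signs cs x) \<longleftrightarrow> P x" for x
  proof
    assume "R (signs cs x)"
    then consider x' where "signs cs x = signs cs x'" "P x'" | y where "signs cs x = signs cs y" "Q y"
      unfolding R_def by metis
    thus "P x"
    proof cases
      case 1
      from PP[of x x', unfolded ag, OF 1(1)] 1(2) show ?thesis by simp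
    next
      case 2
      from PQ[of x y, unfolded ag, OF 2(1)] 2(2) show ?thesis by simp
    qed
  next
    assume "P x"
    thus "R (signs cs x)" unfolding R_def by blast
  qed
  have RQ: "R (signs cs y) \<longleftrightarrow> Q y" for y
  proof
    assume "R (signs cs y)"
    then consider x where "signs cs x = signs cs y" "P x" | y' where "signs cs y = signs cs y'" "Q y'"
      unfolding R_def by metis
    thus "Q y"
    proof cases
      case 1
      from PQ[of x y, unfolded ag, OF 1(1)] 1(2) show ?thesis by simp
    next
      case 2
      from QQ[of y y', unfolded ag, OF 2(1)] 2(2) show ?thesis by simp
    qed
  next
    assume "Q y"
    thus "R (signs cs y)" unfolding R_def by blast
  qed
  have "holds f x \<longleftrightarrow> P x" for x
    unfolding f mem_Collect_eq RP using signs_in[of cs x, unfolded mem_Collect_eq] by blast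
  moreover have "holds f y \<longleftrightarrow> Q y" for y
    unfolding f mem_Collect_eq RQ using signs_in[of cs y, unfolded mem_Collect_eq] by blast
  ultimately show ?thesis by blast
qed

primrec fpolys :: "'v sfml \<Rightarrow> 'v rpoly set" where
  "fpolys (FPos p) = {p}"
| "fpolys (FZero p) = {p}"
| "fpolys (FNot f) = fpolys f"
| "fpolys (FAnd f g) = fpolys f \<union> fpolys g"
| "fpolys (FOr f g) = fpolys f \<union> fpolys g"

lemma finite_fpolys: "finite (fpolys f)"
  by (induction f) auto

lemma holds_cong_signs:
  fixes x :: "'v \<Rightarrow> 'a::rcf" and y :: "'v \<Rightarrow> 'b::rcf"
  shows
  "(\<And>p. p \<in> fpolys f \<Longrightarrow> sg (peval p x) = sg (peval p y)) \<Longrightarrow> holds f x \<longleftrightarrow> holds f y"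
  by (induction f) (auto dest: sg_cong)

text \<open>A witness on one side has a partner on the other at which all polynomials of
  \<open>f\<close> have the same signs.\<close>

lemma sim_imp_ex:
  assumes sim: "sim (pairs (ucoef ` fpolys f) x y)"
  shows "(\<exists>a. holds f (case_option a x)) \<longleftrightarrow> (\<exists>b. holds f (case_option b y))"
proof -
  obtain r where r: "fwd (pairs (ucoef ` fpolys f) x y) r" "bwd (pairs (ucoef ` fpolys f) x y) r"
    using sim unfolding sim_def by blast
  have eq: "holds f (case_option a x) \<longleftrightarrow> holds f (case_option b y)"
    if "good (pairs (ucoef ` fpolys f) x y) (insert (a, b) r)" for a b
  proof (rule holds_cong_signs)
    fix p assume "p \<in> fpolys f"
    hence "(upoly (ucoef p) x, upoly (ucoef p) y) \<in> pairs (ucoef ` fpolys f) x y"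
      by (auto simp: pairs_def)
    from goodD(3)[OF that this, of a b]
    show "sg (peval p (case_option a x)) = sg (peval p (case_option b y))"
      by (simp add: poly_upoly_ucoef)
  qed
  show ?thesis using r eq unfolding fwd_def bwd_def by blast
qed

text \<open>A single \<open>g\<close> for both fields is the point: it carries truth from one field
  to the other.\<close>

theorem quantifier_elimination:
  fixes f :: "'v option sfml"
  shows "\<exists>g. (\<forall>x::'v \<Rightarrow> 'a::rcf. holds g x \<longleftrightarrow> (\<exists>a. holds f (case_option a x)))
    \<and> (\<forall>y::'v \<Rightarrow> 'b::rcf. holds g y \<longleftrightarrow> (\<exists>b. holds f (case_option b y)))"
proof -
  have "finite (ucoef ` fpolys f)" using finite_fpolys by auto
  from adeq_exists[OF this, where 'a = 'a and 'b = 'b]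
  obtain G where G: "finite G" "adeq TYPE('a) TYPE('a) G (ucoef ` fpolys f)"
    "adeq TYPE('a) TYPE('b) G (ucoef ` fpolys f)" "adeq TYPE('b) TYPE('b) G (ucoef ` fpolys f)" by blast
  show ?thesis
    by (rule sign_invariant_definable[OF G(1)]; rule sim_imp_ex) (use G in \<open>auto simp: adeq_def\<close>)
qed

section \<open>First-order formulas\<close>

datatype 'v fo = Qf "'v sfml" | Neg "'v fo" | Conj "'v fo" "'v fo" | Ex 'v "'v fo"

primrec sat :: "'v fo \<Rightarrow> ('v \<Rightarrow> 'a::rcf) \<Rightarrow> bool" where
  "sat (Qf f) x = holds f x"
| "sat (Neg f) x = (\<not> sat f x)"
| "sat (Conj f g) x = (sat f x \<and> sat g x)"
| "sat (Ex v f) x = (\<exists>a. sat f (x(v := a)))"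

text \<open>Renames the bound variable to \<open>None\<close>, the form in which
  \<open>quantifier_elimination\<close> removes it.\<close>

lemma holds_map_bind:
  "holds (map_sfml (\<lambda>w. if w = v then None else Some w) g) (case_option a x) \<longleftrightarrow> holds g (x(v := a))"
proof -
  have "(\<lambda>w. case_option a x (if w = v then None else Some w)) = x(v := a)" by auto
  thus ?thesis by (simp add: holds_map)
qed

theorem fo_quantifier_elimination:
  fixes f :: "'v fo"
  shows "\<exists>g. (\<forall>x::'v \<Rightarrow> 'a::rcf. holds g x \<longleftrightarrow> sat f x) \<and> (\<forall>y::'v \<Rightarrow> 'b::rcf. holds g y \<longleftrightarrow> sat f y)"
proof (induction f)
  case (Qf f)
  thus ?case by auto
next
  case (Neg f)
  then obtain g where "(\<forall>x::'v \<Rightarrow> 'a. holds g x \<longleftrightarrow> sat f x) \<and> (\<forall>y::'v \<Rightarrow> 'b. holds g y \<longleftrightarrow> sat f y)" by blast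
  thus ?case by (intro exI[of _ "FNot g"]) auto
next
  case (Conj f1 f2)
  then obtain g1 g2 where "(\<forall>x::'v \<Rightarrow> 'a. holds g1 x \<longleftrightarrow> sat f1 x) \<and> (\<forall>y::'v \<Rightarrow> 'b. holds g1 y \<longleftrightarrow> sat f1 y)"
    "(\<forall>x::'v \<Rightarrow> 'a. holds g2 x \<longleftrightarrow> sat f2 x) \<and> (\<forall>y::'v \<Rightarrow> 'b. holds g2 y \<longleftrightarrow> sat f2 y)" by blast
  thus ?case by (intro exI[of _ "FAnd g1 g2"]) auto
next
  case (Ex v f)
  then obtain g where g: "\<And>x::'v \<Rightarrow> 'a. holds g x \<longleftrightarrow> sat f x" "\<And>y::'v \<Rightarrow> 'b. holds g y \<longleftrightarrow> sat f y" by blast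
  define h where "h = map_sfml (\<lambda>w. if w = v then None else Some w) g"
  note h = holds_map_bind[of v g, folded h_def]
  from quantifier_elimination[of h, where 'a = 'a and 'b = 'b] show ?case by (simp add: h g)
qed

section \<open>The field of Puiseux series\<close>

notation fls_nth (infixl "$$" 75)

text \<open>The Puiseux series \<^term>\<open>F (t powr (1 / d))\<close> of a Laurent series \<^term>\<open>F\<close>. Any finitely many
  Puiseux series arise in this way with a common \<^term>\<open>d\<close>, which transfers the field axioms
  from Laurent series.\<close>
definition psemb :: "nat \<Rightarrow> real fls \<Rightarrow> ps" where
  "psemb d F = (\<lambda>q. if q * of_nat d \<in> \<int> then F $$ \<lfloor>q * of_nat d\<rfloor> else 0)"

lemma psemb_nth: "d > 0 \<Longrightarrow> psemb d F (of_int n / of_nat d) = F $$ n"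
  by (simp add: psemb_def)

lemma psemb_eq_0: "q * of_nat d \<notin> \<int> \<Longrightarrow> psemb d F q = 0"
  by (simp add: psemb_def)

lemma frac_cases [consumes 1, case_names frac nonfrac]:
  fixes q :: rat
  assumes "d > 0"
  obtains (frac) n where "q = of_int n / of_nat d" | (nonfrac) "q * of_nat d \<notin> \<int>"
proof (cases "q * of_nat d \<in> \<int>")
  case True
  then obtain n where "q * of_nat d = of_int n" by (auto elim: Ints_cases)
  hence "q = of_int n / of_nat d" using assms by (simp add: field_simps)
  thus ?thesis using frac by blast
qed (use nonfrac in blast)

lemma psemb_inject: "d > 0 \<Longrightarrow> psemb d F = psemb d G \<longleftrightarrow> F = G"
  using psemb_nth by (metis fls_eqI)

lemma is_puiseux_psemb:
  assumes "d > 0"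
  shows "is_puiseux (psemb d F)"
  unfolding is_puiseux_def
proof (intro exI conjI allI impI)
  fix q assume q: "psemb d F q \<noteq> 0"
  \<comment> \<open>An integer at most subdegree / \<open>d\<close> is wanted for either sign of the
    subdegree, hence the negated absolute value.\<close>
  from assms show "rat_of_int (- \<bar>fls_subdegree F\<bar>) \<le> q"
  proof (cases rule: frac_cases[where q = q])
    case (frac n)
    hence "F $$ n \<noteq> 0" using q assms by (simp add: psemb_nth)
    hence "fls_subdegree F \<le> n" by (rule fls_subdegree_leI)
    hence "- \<bar>fls_subdegree F\<bar> \<le> n" by linarith
    have "- \<bar>fls_subdegree F\<bar> * int d \<le> - \<bar>fls_subdegree F\<bar> * 1"
      using assms by (intro mult_left_mono_neg) auto
    hence "- \<bar>fls_subdegree F\<bar> * int d \<le> n" using \<open>- \<bar>fls_subdegree F\<bar> \<le> n\<close> by simp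
    hence "rat_of_int (- \<bar>fls_subdegree F\<bar> * int d) \<le> rat_of_int n" by (rule of_int_le_iff[THEN iffD2])
    thus ?thesis using assms by (simp add: frac pos_le_divide_eq)
  qed (use q in \<open>simp add: psemb_eq_0\<close>)
  show "q * rat_of_nat d \<in> \<int>" using q psemb_eq_0 by blast
qed (fact assms)

text \<open>Allowing every multiple of \<open>d\<close> is what later yields a common denominator
  for finitely many series.\<close>

lemma is_puiseux_eq_psemb:
  assumes "is_puiseux a"
  shows "\<exists>d>0. \<forall>k>0. \<exists>F. a = psemb (d * k) F"
proof -
  obtain N d where d: "d > (0::nat)" and a: "\<And>q. a q \<noteq> 0 \<Longrightarrow> of_int N \<le> q \<and> q * of_nat d \<in> \<int>"
    using assms unfolding is_puiseux_def by blast
  show ?thesis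
  proof (intro exI[of _ d] conjI d allI impI)
    fix k :: nat assume "k > 0"
    define e where "e = d * k"
    have e: "e > 0" using d \<open>k > 0\<close> by (simp add: e_def)
    define F where "F = Abs_fls (\<lambda>n. a (of_int n / of_nat e))"
    have F: "F $$ n = a (of_int n / of_nat e)" for n
      unfolding F_def
    proof (rule nth_Abs_fls_lower_bound, intro allI impI, rule ccontr)
      fix n assume n: "n < N * int e" "a (of_int n / of_nat e) \<noteq> 0"
      hence "of_int N \<le> (of_int n / of_nat e :: rat)" using a by blast
      hence "rat_of_int (N * int e) \<le> of_int n" using e by (simp add: pos_le_divide_eq)
      hence "N * int e \<le> n" by (rule of_int_le_iff[THEN iffD1])
      thus False using n by simp
    qed
    have "a q = psemb e F q" for q
      using e
    proof (cases rule: frac_cases[where q = q])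
      case (frac n)
      thus ?thesis using e by (simp add: psemb_nth F)
    next
      case nonfrac
      have "a q = 0"
      proof (rule ccontr)
        assume "a q \<noteq> 0"
        hence "q * of_nat d \<in> \<int>" using a by blast
        hence "q * of_nat d * of_nat k \<in> \<int>" by (rule Ints_mult[OF _ Ints_of_nat])
        thus False using nonfrac unfolding e_def of_nat_mult mult.assoc by blast
      qed
      thus ?thesis using nonfrac by (simp add: psemb_eq_0)
    qed
    thus "\<exists>F. a = psemb (d * k) F" unfolding e_def by blast
  qed
qed

lemma common_psemb:
  assumes "finite A" "\<And>a. a \<in> A \<Longrightarrow> is_puiseux a"
  shows "\<exists>d>0. \<forall>k>0. \<forall>a\<in>A. \<exists>F. a = psemb (d * k) F"
  using assms
proof induction
  case empty
  show ?case by (intro exI[of _ 1]) auto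
next
  case (insert a A)
  then obtain d where d: "d > 0" "\<forall>k>0. \<forall>a\<in>A. \<exists>F. a = psemb (d * k) F" by blast
  obtain e where e: "e > 0" "\<forall>k>0. \<exists>F. a = psemb (e * k) F"
    using is_puiseux_eq_psemb[of a] insert by blast
  have "\<exists>F. b = psemb (d * e * k) F" if "k > 0" "b \<in> insert a A" for k b
  proof (cases "b = a")
    case True
    thus ?thesis using e(2)[rule_format, of "d * k"] d(1) \<open>k > 0\<close> by (simp add: mult_ac)
  next
    case False
    thus ?thesis using d(2)[rule_format, of "e * k" b] e(1) that by (simp add: mult_ac)
  qed
  thus ?case using d e by (intro exI[of _ "d * e"]) simp
qed

lemma psemb_const: "d > 0 \<Longrightarrow> psemb d (fls_const c) = ps_const c"
proof
  fix q assume "d > 0"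
  thus "psemb d (fls_const c) q = ps_const c q"
  proof (cases rule: frac_cases[where q = q])
    case (frac n)
    thus ?thesis using \<open>d > 0\<close> by (simp add: psemb_nth ps_const_def)
  next
    case nonfrac
    thus ?thesis by (auto simp: psemb_eq_0 ps_const_def)
  qed
qed

lemma psemb_add: "psemb d (F + G) = ps_add (psemb d F) (psemb d G)"
  by (auto simp: psemb_def ps_add_def)

lemma psemb_neg: "psemb d (- F) = ps_neg (psemb d F)"
  by (auto simp: psemb_def ps_neg_def)

text \<open>The support of the Puiseux convolution is the image of the finite Laurent index set
  under division by \<open>d\<close>; exponents whose denominator does not divide \<open>d\<close>
  contribute nothing.\<close>

lemma psemb_mult:
  assumes "d > 0"
  shows "psemb d (F * G) = ps_mult (psemb d F) (psemb d G)"
proof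
  fix q
  let ?S = "{p. psemb d F p \<noteq> 0 \<and> psemb d G (q - p) \<noteq> 0}"
  from assms show "psemb d (F * G) q = ps_mult (psemb d F) (psemb d G) q"
  proof (cases rule: frac_cases[where q = q])
    case (frac n)
    let ?I = "{i. F $$ i \<noteq> 0 \<and> G $$ (n - i) \<noteq> 0}"
    have sub: "?I \<subseteq> {fls_subdegree F..n - fls_subdegree G}"
    proof
      fix i assume "i \<in> ?I"
      hence "fls_subdegree F \<le> i" "fls_subdegree G \<le> n - i" by (auto intro: fls_subdegree_leI)
      thus "i \<in> {fls_subdegree F..n - fls_subdegree G}" by simp
    qed
    have diff: "q - of_int i / of_nat d = of_int (n - i) / of_nat d" for i
      by (simp add: frac diff_divide_distrib)
    have S: "?S = (\<lambda>i. of_int i / of_nat d) ` ?I"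
    proof (intro equalityI subsetI)
      fix p assume p: "p \<in> ?S"
      from assms show "p \<in> (\<lambda>i. of_int i / of_nat d) ` ?I"
      proof (cases rule: frac_cases[where q = p])
        case p': (frac i)
        have "F $$ i \<noteq> 0" "G $$ (n - i) \<noteq> 0"
          using p unfolding p' mem_Collect_eq diff psemb_nth[OF assms] by auto
        thus ?thesis unfolding p' by blast
      qed (use p psemb_eq_0 in blast)
    next
      fix p :: rat assume "p \<in> (\<lambda>i. of_int i / of_nat d) ` ?I"
      then obtain i where i: "p = of_int i / of_nat d" "i \<in> ?I" by blast
      thus "p \<in> ?S" unfolding i(1) mem_Collect_eq diff psemb_nth[OF assms] by blast
    qed
    have inj: "inj_on (\<lambda>i. of_int i / of_nat d :: rat) ?I" using assms by (auto intro!: inj_onI)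
    have "psemb d (F * G) q = (\<Sum>i=fls_subdegree F..n - fls_subdegree G. F $$ i * G $$ (n - i))"
      using assms by (simp add: frac psemb_nth fls_times_nth(2))
    also have "\<dots> = (\<Sum>i\<in>?I. F $$ i * G $$ (n - i))"
      by (rule sum.mono_neutral_right) (use sub in auto)
    also have "\<dots> = (\<Sum>i\<in>?I. psemb d F (of_int i / of_nat d) * psemb d G (q - of_int i / of_nat d))"
      by (intro sum.cong refl) (simp only: diff psemb_nth[OF assms])
    also have "\<dots> = (\<Sum>p\<in>?S. psemb d F p * psemb d G (q - p))"
      unfolding S by (subst sum.reindex[OF inj]) simp
    finally show ?thesis by (simp add: ps_mult_def)
  next
    case nonfrac
    have "?S = {}"
    proof (rule ccontr)
      assume "?S \<noteq> {}"
      then obtain p where "psemb d F p \<noteq> 0" "psemb d G (q - p) \<noteq> 0" by blast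
      hence "p * of_nat d \<in> \<int>" "(q - p) * of_nat d \<in> \<int>" using psemb_eq_0 by blast+
      hence "p * of_nat d + (q - p) * of_nat d \<in> \<int>" by (rule Ints_add)
      thus False using nonfrac by (simp add: algebra_simps)
    qed
    thus ?thesis unfolding ps_mult_def psemb_eq_0[OF nonfrac] by (simp only: sum.empty)
  qed
qed

lemma ps_pos_psemb:
  assumes "d > 0"
  shows "ps_pos (psemb d F) \<longleftrightarrow> F $$ fls_subdegree F > 0"
proof (cases "F = 0")
  case True
  hence "psemb d F = (\<lambda>q. 0)" by (simp add: psemb_def fun_eq_iff)
  thus ?thesis using True by (simp add: ps_pos_def)
next
  case False
  have "(LEAST q. psemb d F q \<noteq> 0) = of_int (fls_subdegree F) / of_nat d"
  proof (rule Least_equality)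
    show "psemb d F (of_int (fls_subdegree F) / of_nat d) \<noteq> 0"
      using False assms by (simp add: psemb_nth)
    fix q assume q: "psemb d F q \<noteq> 0"
    from assms show "of_int (fls_subdegree F) / of_nat d \<le> q"
    proof (cases rule: frac_cases[where q = q])
      case (frac n)
      hence "F $$ n \<noteq> 0" using q assms by (simp add: psemb_nth)
      hence "fls_subdegree F \<le> n" by (rule fls_subdegree_leI)
      thus ?thesis using frac by (simp add: divide_right_mono)
    qed (use q psemb_eq_0 in blast)
  qed
  moreover have "\<exists>q. psemb d F q \<noteq> 0"
    using False assms by (intro exI[of _ "of_int (fls_subdegree F) / of_nat d"]) (simp add: psemb_nth)
  ultimately show ?thesis unfolding ps_pos_def by (simp only: psemb_nth[OF assms] simp_thms)
qed

section \<open>The type of Puiseux series, on which the field and order classes can be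
  instantiated\<close>

typedef pui = "{a. is_puiseux a}" morphisms cf Abs_pui
  using is_puiseux_psemb[of 1] by auto

lemma is_puiseux_cf: "is_puiseux (cf a)"
  using cf[of a] by simp

definition emb :: "nat \<Rightarrow> real fls \<Rightarrow> pui" where
  "emb d F = Abs_pui (psemb d F)"

lemma cf_emb: "d > 0 \<Longrightarrow> cf (emb d F) = psemb d F"
  by (simp add: emb_def Abs_pui_inverse is_puiseux_psemb)

lemma emb_inject: "d > 0 \<Longrightarrow> emb d F = emb d G \<longleftrightarrow> F = G"
  using cf_emb[of d F] cf_emb[of d G] psemb_inject[of d F G] by auto

lemma common_emb:
  assumes "finite A"
  shows "\<exists>d>0. \<forall>a\<in>A. \<exists>F. a = emb d F"
proof -
  have "finite (cf ` A)" "\<And>a. a \<in> cf ` A \<Longrightarrow> is_puiseux a" using assms is_puiseux_cf by auto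
  from common_psemb[OF this] obtain d where d: "d > 0" "\<forall>k>0. \<forall>a\<in>cf ` A. \<exists>F. a = psemb (d * k) F" by blast
  have "\<exists>F. a = emb d F" if a: "a \<in> A" for a
  proof -
    obtain F where "cf a = psemb d F" using d(2)[rule_format, OF _ imageI[OF a], of 1] by auto
    hence "emb d F = a" unfolding emb_def by (metis cf_inverse)
    thus ?thesis by blast
  qed
  thus ?thesis using d(1) by blast
qed

lemma emb_cases3:
  obtains d F G H where "d > 0" "a = emb d F" "b = emb d G" "c = emb d H"
proof -
  have "finite {a, b, c}" by simp
  from common_emb[OF this] obtain d where "d > 0" "\<forall>x\<in>{a, b, c}. \<exists>F. x = emb d F" by blast
  then obtain F G H where "a = emb d F" "b = emb d G" "c = emb d H" by blast
  with \<open>d > 0\<close> show ?thesis by (rule that)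
qed

lemma emb_cases2:
  obtains d F G where "d > 0" "a = emb d F" "b = emb d G"
proof -
  have "finite {a, b}" by simp
  from common_emb[OF this] obtain d where "d > 0" "\<forall>x\<in>{a, b}. \<exists>F. x = emb d F" by blast
  then obtain F G where "a = emb d F" "b = emb d G" by blast
  with \<open>d > 0\<close> show ?thesis by (rule that)
qed

lemma emb_cases:
  obtains d F where "d > 0" "a = emb d F"
proof -
  have "finite {a}" by simp
  from common_emb[OF this] obtain d F where "d > 0" "a = emb d F" by blast
  thus ?thesis by (rule that)
qed

instantiation pui :: "{zero, one, plus, minus, uminus, times, inverse, ord, abs, sgn, scaleR}"
begin

definition "0 = Abs_pui (ps_const 0)"
definition "1 = Abs_pui (ps_const 1)"
definition "a + b = Abs_pui (ps_add (cf a) (cf b))"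
definition "- a = Abs_pui (ps_neg (cf a))"
definition "a - b = Abs_pui (ps_add (cf a) (ps_neg (cf b)))"
definition "a * b = Abs_pui (ps_mult (cf a) (cf b))"
definition "inverse a = (if a = 0 then 0 else SOME b. a * b = (1 :: pui))"
definition "a div b = a * inverse (b :: pui)"
definition "a < b \<longleftrightarrow> ps_pos (cf (b - a))"
definition "a \<le> b \<longleftrightarrow> a = b \<or> a < (b :: pui)"
definition "\<bar>a :: pui\<bar> = (if a < 0 then - a else a)"
definition "sgn (a :: pui) = (if a = 0 then 0 else if 0 < a then 1 else - 1)"
definition "scaleR c a = Abs_pui (ps_const c) * a"

instance ..

end

lemma emb_arith:
  assumes "d > 0"
  shows "0 = emb d 0" "1 = emb d 1" "emb d F + emb d G = emb d (F + G)" "- emb d F = emb d (- F)"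
    "emb d F - emb d G = emb d (F - G)" "emb d F * emb d G = emb d (F * G)"
    "scaleR c (emb d F) = emb d (fls_const c * F)"
proof -
  have const: "emb d (fls_const c) = Abs_pui (ps_const c)" for c
    using assms by (simp add: emb_def psemb_const)
  show "0 = emb d 0" "1 = emb d 1" using const[of 0] const[of 1]
    by (simp_all add: zero_pui_def one_pui_def)
  show *: "emb d F * emb d G = emb d (F * G)" for F G
    using assms by (simp add: times_pui_def cf_emb psemb_mult[symmetric]) (simp add: emb_def)
  show "scaleR c (emb d F) = emb d (fls_const c * F)"
    unfolding scaleR_pui_def const[symmetric] * ..
qed (use assms in \<open>simp_all add: plus_pui_def uminus_pui_def minus_pui_def cf_emb
    psemb_add[symmetric] psemb_neg[symmetric]\<close>, simp_all add: emb_def)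

instance pui :: comm_ring_1
proof
  fix a b c :: pui
  obtain d F G H where d: "d > 0" and abc: "a = emb d F" "b = emb d G" "c = emb d H"
    by (rule emb_cases3)
  note e = emb_arith[OF d] and i = emb_inject[OF d]
  show "a + b + c = a + (b + c)" "a + b = b + a" "0 + a = a" "- a + a = 0" "a - b = a + - b"
    "a * b * c = a * (b * c)" "a * b = b * a" "1 * a = a" "(a + b) * c = a * c + b * c" "(0::pui) \<noteq> 1"
    by (simp_all add: abc e i algebra_simps)
qed

instance pui :: field
proof
  fix a b :: pui
  show "a div b = a * inverse b" by (rule divide_pui_def)
  show "inverse (0::pui) = 0" by (simp add: inverse_pui_def)
  assume "a \<noteq> 0"
  obtain d F where d: "d > 0" "a = emb d F" by (rule emb_cases)
  have "F \<noteq> 0" using d emb_arith(1)[OF d(1)] \<open>a \<noteq> 0\<close> by auto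
  hence "a * emb d (inverse F) = 1" using d by (simp add: emb_arith)
  hence "a * (SOME b. a * b = 1) = 1" by (rule someI)
  thus "inverse a * a = 1" using \<open>a \<noteq> 0\<close> by (simp add: inverse_pui_def mult.commute)
qed

lemma emb_less: "d > 0 \<Longrightarrow> emb d F < emb d G \<longleftrightarrow> (G - F) $$ fls_subdegree (G - F) > 0"
  by (simp add: less_pui_def emb_arith cf_emb ps_pos_psemb)

text \<open>The right-hand side suits sums, where the subdegree may jump by cancellation.\<close>

lemma fls_pos_iff:
  fixes F :: "real fls"
  shows "F $$ fls_subdegree F > 0 \<longleftrightarrow> (\<exists>n. F $$ n > 0 \<and> (\<forall>m<n. F $$ m = 0))"
proof
  assume "\<exists>n. F $$ n > 0 \<and> (\<forall>m<n. F $$ m = 0)"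
  then obtain n where n: "F $$ n > 0" "\<forall>m<n. F $$ m = 0" by blast
  hence "fls_subdegree F = n" by (intro fls_subdegree_eqI) auto
  thus "F $$ fls_subdegree F > 0" using n by simp
next
  assume "F $$ fls_subdegree F > 0"
  thus "\<exists>n. F $$ n > 0 \<and> (\<forall>m<n. F $$ m = 0)" by (intro exI[of _ "fls_subdegree F"]) auto
qed

lemma fls_pos_add:
  fixes F G :: "real fls"
  assumes "F $$ fls_subdegree F > 0" "G $$ fls_subdegree G > 0"
  shows "(F + G) $$ fls_subdegree (F + G) > 0"
proof -
  obtain n m where n: "F $$ n > 0" "\<forall>k<n. F $$ k = 0" and m: "G $$ m > 0" "\<forall>k<m. G $$ k = 0"
    using assms unfolding fls_pos_iff by blast
  have "(F + G) $$ min n m > 0" using n m by (cases n m rule: linorder_cases) auto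
  thus ?thesis unfolding fls_pos_iff using n m by (intro exI[of _ "min n m"]) auto
qed

instance pui :: linordered_field
proof
  fix a b c :: pui
  obtain d F G H where d: "d > 0" and abc: "a = emb d F" "b = emb d G" "c = emb d H"
    by (rule emb_cases3)
  note e = emb_arith[OF d] and i = emb_inject[OF d] and l = emb_less[OF d]
  have asym: "\<not> (a < b \<and> b < a)" for a b :: pui
  proof
    assume ab: "a < b \<and> b < a"
    obtain d F G where d: "d > 0" "a = emb d F" "b = emb d G" by (rule emb_cases2)
    with ab have "(G - F) $$ fls_subdegree (G - F) > 0" "(F - G) $$ fls_subdegree (F - G) > 0"
      by (auto simp: emb_less)
    from fls_pos_add[OF this] show False by simp
  qed
  have trans: "a < c" if "a < b" "b < c" for a b c :: pui
  proof -
    obtain d F G H where d: "d > 0" "a = emb d F" "b = emb d G" "c = emb d H" by (rule emb_cases3)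
    from that have "(G - F) $$ fls_subdegree (G - F) > 0" "(H - G) $$ fls_subdegree (H - G) > 0"
      unfolding d by (auto simp: emb_less d)
    from fls_pos_add[OF this] show ?thesis by (simp add: d emb_less)
  qed
  show "(a < b) = (a \<le> b \<and> \<not> b \<le> a)" "a \<le> a" using asym[of a b] asym[of a a] by (auto simp: less_eq_pui_def)
  show "a \<le> c" if "a \<le> b" "b \<le> c" using that trans[of a b c] by (auto simp: less_eq_pui_def)
  show "a = b" if "a \<le> b" "b \<le> a" using that asym[of a b] by (auto simp: less_eq_pui_def)
  show "a \<le> b \<or> b \<le> a"
  proof (cases "F = G")
    case False
    hence "G - F \<noteq> 0" by simp
    hence "(G - F) $$ fls_subdegree (G - F) \<noteq> 0" by (rule nth_fls_subdegree_nonzero)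
    moreover have "(F - G) $$ fls_subdegree (F - G) = - ((G - F) $$ fls_subdegree (G - F))"
      by (simp add: fls_subdegree_minus_sym[of F G])
    ultimately show ?thesis unfolding less_eq_pui_def abc l by linarith
  qed (simp add: less_eq_pui_def abc)
  show "c + a \<le> c + b" if "a \<le> b"
    using that by (auto simp: less_eq_pui_def less_pui_def)
  show "c * a < c * b" if "a < b" "0 < c"
  proof -
    have "(G - F) $$ fls_subdegree (G - F) > 0" "H $$ fls_subdegree H > 0"
      using that d unfolding abc e(1) l by auto
    moreover from this have "H \<noteq> 0" "G - F \<noteq> 0" by force+
    ultimately have "(H * (G - F)) $$ fls_subdegree (H * (G - F)) > 0" by simp
    thus ?thesis by (simp add: abc e l right_diff_distrib)
  qed
  show "\<bar>a\<bar> = (if a < 0 then - a else a)" by (rule abs_pui_def)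
  show "sgn a = (if a = 0 then 0 else if 0 < a then 1 else - 1)" by (rule sgn_pui_def)
qed

instance pui :: real_algebra_1
proof
  fix r s :: real and a b :: pui
  obtain d F G where d: "d > 0" "a = emb d F" "b = emb d G" by (rule emb_cases2)
  note e = emb_arith[OF d(1)] and i = emb_inject[OF d(1)]
  show "r *\<^sub>R (a + b) = r *\<^sub>R a + r *\<^sub>R b" "(r + s) *\<^sub>R a = r *\<^sub>R a + s *\<^sub>R a"
    "r *\<^sub>R s *\<^sub>R a = (r * s) *\<^sub>R a" "1 *\<^sub>R a = a" "r *\<^sub>R a * b = r *\<^sub>R (a * b)"
    "a * r *\<^sub>R b = r *\<^sub>R (a * b)"
    by (simp_all add: d e i algebra_simps flip: fls_plus_const fls_const_mult_const)
qed

lemma cf_add: "cf (a + b) q = cf a q + cf b q"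
proof -
  obtain d F G where d: "d > 0" "a = emb d F" "b = emb d G" by (rule emb_cases2)
  thus ?thesis by (simp add: emb_arith cf_emb psemb_add ps_add_def)
qed

lemma cf_uminus: "cf (- a) q = - cf a q"
proof -
  obtain d F where d: "d > 0" "a = emb d F" by (rule emb_cases)
  thus ?thesis by (simp add: emb_arith cf_emb psemb_neg ps_neg_def)
qed

lemma cf_diff: "cf (a - b) q = cf a q - cf b q"
  using cf_add[of a "- b" q] by (simp add: cf_uminus)

lemma cf_mult: "cf (a * b) = ps_mult (cf a) (cf b)"
proof -
  obtain d F G where d: "d > 0" "a = emb d F" "b = emb d G" by (rule emb_cases2)
  thus ?thesis by (simp add: emb_arith cf_emb psemb_mult)
qed

lemma of_real_pui: "d > 0 \<Longrightarrow> (of_real c :: pui) = emb d (fls_const c)"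
  by (simp add: of_real_def emb_arith(2,7))

lemma cf_of_real: "cf (of_real c) = ps_const c"
  using of_real_pui[of 1 c] by (simp add: cf_emb psemb_const)

lemma cf_0 [simp]: "cf 0 q = 0" and cf_1: "cf 1 = ps_const 1"
  using cf_of_real[of 0] cf_of_real[of 1] by (simp_all add: ps_const_def)

lemma cf_scale: "cf (of_real c * a) q = c * cf a q"
proof -
  obtain d F where d: "d > 0" "a = emb d F" by (rule emb_cases)
  have "(fls_const c * F) $$ n = c * (F $$ n)" for n by simp
  thus ?thesis using d by (simp add: of_real_pui[of d] emb_arith cf_emb psemb_def)
qed

lemma pui_eqI: "(\<And>q. cf a q = cf b q) \<Longrightarrow> a = b"
  by (metis cf_inject ext)

lemma pui_pos_iff: "0 < a \<longleftrightarrow> ps_pos (cf a)"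
  by (simp add: less_pui_def)

section \<open>Puiseux series form a real closed field\<close>

text \<open>The valuation ring of \<open>pui\<close>; by \<open>fin_if_bounded\<close> it contains
  every element whose absolute value is bounded by a real.\<close>

definition fin :: "pui \<Rightarrow> bool" where
  "fin a \<longleftrightarrow> (\<forall>q<0. cf a q = 0)"

text \<open>On \<open>fin\<close> elements this is the residue map onto the reals, a ring
  homomorphism that preserves the weak order; elsewhere it is merely a coefficient.\<close>

definition st :: "pui \<Rightarrow> real" where
  "st a = cf a 0"

lemma st_simps [simp]: "st 0 = 0" "st 1 = 1" "st (of_real c) = c" "st (a + b) = st a + st b"
  "st (- a) = - st a" "st (a - b) = st a - st b" "st (of_real c * a) = c * st a"
  by (simp_all add: st_def cf_add cf_uminus cf_diff cf_1 cf_of_real cf_scale ps_const_def)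

lemma fin_simps [simp]: "fin 0" "fin 1" "fin (of_real c)"
  by (simp_all add: fin_def cf_1 cf_of_real ps_const_def)

lemma fin_add: "fin a \<Longrightarrow> fin b \<Longrightarrow> fin (a + b)" and fin_uminus: "fin a \<Longrightarrow> fin (- a)"
  and fin_diff: "fin a \<Longrightarrow> fin b \<Longrightarrow> fin (a - b)"
  by (simp_all add: fin_def cf_add cf_uminus cf_diff)

lemma fin_mult:
  assumes "fin a" "fin b"
  shows "fin (a * b)"
  unfolding fin_def
proof (intro allI impI)
  fix q :: rat assume "q < 0"
  have "{p. cf a p \<noteq> 0 \<and> cf b (q - p) \<noteq> 0} = {}"
  proof (rule ccontr)
    assume "\<not> ?thesis"
    then obtain p where "cf a p \<noteq> 0" "cf b (q - p) \<noteq> 0" by blast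
    hence "\<not> p < 0" "\<not> q - p < 0" using assms unfolding fin_def by blast+
    thus False using \<open>q < 0\<close> by linarith
  qed
  thus "cf (a * b) q = 0" unfolding cf_mult ps_mult_def by (simp only: sum.empty)
qed

lemma st_mult:
  assumes "fin a" "fin b"
  shows "st (a * b) = st a * st b"
proof -
  have "{p. cf a p \<noteq> 0 \<and> cf b (0 - p) \<noteq> 0} \<subseteq> {0}"
  proof
    fix p assume "p \<in> {p. cf a p \<noteq> 0 \<and> cf b (0 - p) \<noteq> 0}"
    hence "\<not> p < 0" "\<not> 0 - p < 0" using assms unfolding fin_def by blast+
    thus "p \<in> {0}" by simp
  qed
  hence "ps_mult (cf a) (cf b) 0 = (\<Sum>p\<in>{0}. cf a p * cf b (0 - p))"
    unfolding ps_mult_def by (intro sum.mono_neutral_left) auto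
  thus ?thesis by (simp add: st_def cf_mult)
qed

text \<open>Unspecified at 0, so the facts about it assume a nonzero argument or treat 0
  apart.\<close>

definition val :: "pui \<Rightarrow> rat" where
  "val a = (LEAST q. cf a q \<noteq> 0)"

lemma val_eqI: "cf a q \<noteq> 0 \<Longrightarrow> (\<And>p. p < q \<Longrightarrow> cf a p = 0) \<Longrightarrow> val a = q"
  unfolding val_def by (rule Least_equality) (auto simp: not_less[symmetric])

lemma emb_least_exponent:
  assumes "d > 0" "F \<noteq> 0" "q = of_int (fls_subdegree F) / of_nat d"
  shows "cf (emb d F) q \<noteq> 0" "p < q \<Longrightarrow> cf (emb d F) p = 0"
proof -
  show "cf (emb d F) q \<noteq> 0" using assms by (simp add: cf_emb psemb_nth)
  assume p: "p < q"
  from assms(1) show "cf (emb d F) p = 0"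
  proof (cases rule: frac_cases[where q = p])
    case (frac n)
    hence "n < fls_subdegree F" using p assms by (simp add: divide_less_cancel)
    thus ?thesis using frac assms(1) by (simp add: cf_emb psemb_nth)
  qed (simp add: assms(1) cf_emb psemb_eq_0)
qed

lemma val_emb: "d > 0 \<Longrightarrow> F \<noteq> 0 \<Longrightarrow> val (emb d F) = of_int (fls_subdegree F) / of_nat d"
  by (intro val_eqI emb_least_exponent) auto

lemma cf_val: "a \<noteq> 0 \<Longrightarrow> cf a (val a) \<noteq> 0" and cf_less_val: "a \<noteq> 0 \<Longrightarrow> p < val a \<Longrightarrow> cf a p = 0"
proof -
  assume "a \<noteq> 0"
  obtain d F where d: "d > 0" "a = emb d F" by (rule emb_cases)
  have "F \<noteq> 0" using d \<open>a \<noteq> 0\<close> emb_arith(1)[OF d(1)] by auto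
  note * = emb_least_exponent[OF d(1) this val_emb[OF d(1) this]]
  show "cf a (val a) \<noteq> 0" "p < val a \<Longrightarrow> cf a p = 0" using * d(2) by simp_all
qed

lemma pui_pos_iff_val: "a > 0 \<longleftrightarrow> a \<noteq> 0 \<and> cf a (val a) > 0"
proof -
  have "(\<exists>q. cf a q \<noteq> 0) \<longleftrightarrow> a \<noteq> 0" using cf_val by auto
  thus ?thesis unfolding pui_pos_iff ps_pos_def val_def by simp
qed

lemma pui_posI: "cf a q > 0 \<Longrightarrow> (\<And>p. p < q \<Longrightarrow> cf a p = 0) \<Longrightarrow> a > 0"
  using val_eqI[of a q] by (auto simp: pui_pos_iff_val)

lemma st_pos_imp_pos: "fin a \<Longrightarrow> st a > 0 \<Longrightarrow> a > 0"
  by (rule pui_posI[of a 0]) (auto simp: fin_def st_def)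

lemma st_nonneg: "fin a \<Longrightarrow> a \<ge> 0 \<Longrightarrow> st a \<ge> 0"
  using st_pos_imp_pos[of "- a"] by (auto simp: fin_uminus not_less[symmetric])

lemma st_mono: "fin a \<Longrightarrow> fin b \<Longrightarrow> a \<le> b \<Longrightarrow> st a \<le> st b"
  using st_nonneg[of "b - a"] by (simp add: fin_diff)

lemma st_less_imp_less: "fin a \<Longrightarrow> fin b \<Longrightarrow> st a < st b \<Longrightarrow> a < b"
  using st_pos_imp_pos[of "b - a"] by (simp add: fin_diff)

lemma fin_iff_val: "fin a \<longleftrightarrow> a = 0 \<or> val a \<ge> 0"
proof (cases "a = 0")
  case False
  show ?thesis
  proof
    assume "fin a"
    thus "a = 0 \<or> val a \<ge> 0" using cf_val[OF False] by (auto simp: fin_def not_less[symmetric])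
  next
    assume "a = 0 \<or> val a \<ge> 0"
    thus "fin a" using False cf_less_val[OF False] by (auto simp: fin_def)
  qed
qed simp

lemma val_mult:
  assumes "a \<noteq> 0" "b \<noteq> 0"
  shows "val (a * b) = val a + val b"
proof -
  obtain d F G where d: "d > 0" "a = emb d F" "b = emb d G" by (rule emb_cases2)
  have "F \<noteq> 0" "G \<noteq> 0" using assms d emb_arith(1)[OF d(1)] by auto
  thus ?thesis using d by (simp add: emb_arith val_emb add_divide_distrib)
qed

lemma st_eq_0_if_val_pos: "val a > 0 \<Longrightarrow> st a = 0"
  using cf_less_val[of a 0] by (cases "a = 0") (auto simp: st_def)

lemma not_fin_inverse:
  assumes "\<not> fin a"
  shows "fin (inverse a)" "st (inverse a) = 0"
proof -
  have "a \<noteq> 0" using assms by auto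
  have "val (1 :: pui) = 0" by (rule val_eqI) (auto simp: cf_1 ps_const_def)
  hence "val a + val (inverse a) = 0" using val_mult[of a "inverse a"] \<open>a \<noteq> 0\<close> by simp
  hence v: "val (inverse a) > 0" using assms by (auto simp: fin_iff_val)
  thus "fin (inverse a)" "st (inverse a) = 0" using st_eq_0_if_val_pos by (auto simp: fin_iff_val)
qed

text \<open>The monomial t^w; in particular \<open>Tm 1\<close> is the infinitesimal t.\<close>

definition Tm :: "rat \<Rightarrow> pui" where
  "Tm w = Abs_pui (\<lambda>q. if q = w then 1 else 0)"

lemma cf_Tm: "cf (Tm w) = (\<lambda>q. if q = w then 1 else 0)"
proof -
  obtain a b where q: "quotient_of w = (a, b)" by fastforce
  have ab: "w = of_int a / of_int b" "b > 0"
    using quotient_of_div[OF q] quotient_of_denom_pos[OF q] by auto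
  have "is_puiseux (\<lambda>q. if q = w then 1 else 0)"
    unfolding is_puiseux_def
  proof (intro exI[of _ "\<lfloor>w\<rfloor>"] exI[of _ "nat b"] conjI allI impI)
    fix q assume "(if q = w then 1 else 0 :: real) \<noteq> 0"
    hence q: "q = w" by (auto split: if_splits)
    show "rat_of_int \<lfloor>w\<rfloor> \<le> q" unfolding q by simp
    have "q * rat_of_nat (nat b) = of_int a" using ab q by simp
    thus "q * rat_of_nat (nat b) \<in> \<int>" by (simp only: Ints_of_int)
  qed (use ab in simp)
  thus ?thesis by (simp add: Tm_def Abs_pui_inverse)
qed

lemma cf_Tm_mult: "cf (Tm w * a) q = cf a (q - w)"
proof -
  have "(\<Sum>p\<in>{p. cf (Tm w) p \<noteq> 0 \<and> cf a (q - p) \<noteq> 0}. cf (Tm w) p * cf a (q - p))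
    = (\<Sum>p\<in>{w}. cf (Tm w) p * cf a (q - p))"
    by (rule sum.mono_neutral_left) (auto simp: cf_Tm)
  thus ?thesis by (simp add: cf_mult ps_mult_def cf_Tm)
qed

lemma Tm_mult: "Tm w * Tm v = Tm (w + v)"
  by (rule pui_eqI) (auto simp: cf_Tm_mult, auto simp: cf_Tm)

lemma Tm_0: "Tm 0 = 1"
  by (rule pui_eqI) (simp add: cf_Tm cf_1 ps_const_def)

lemma Tm_pos: "Tm w > 0"
  by (rule pui_posI[of _ w]) (auto simp: cf_Tm)

lemma Tm_power: "Tm w ^ n = Tm (of_nat n * w)"
  by (induction n) (auto simp: Tm_0 Tm_mult algebra_simps)

lemma fin_poly:
  assumes "\<And>i. fin (coeff P i)" "fin x"
  shows "fin (poly P x)" "st (poly P x) = poly (map_poly st P) (st x)"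
proof -
  have "fin (poly P x) \<and> st (poly P x) = poly (map_poly st P) (st x)"
    using assms(1)
  proof (induction P)
    case (pCons a P)
    have "fin a" "\<And>i. fin (coeff P i)" using pCons.prems[of 0] pCons.prems[of "Suc i" for i] by simp_all
    with pCons.IH show ?case using assms(2) by (simp add: map_poly_pCons fin_add fin_mult st_mult)
  qed simp
  thus "fin (poly P x)" "st (poly P x) = poly (map_poly st P) (st x)" by auto
qed

section \<open>Power series in t^(1/d) and Hensel's lemma\<close>

definition ser :: "nat \<Rightarrow> (nat \<Rightarrow> real) \<Rightarrow> pui" where
  "ser d c = emb d (fps_to_fls (Abs_fps c))"

lemma ser_add: "d > 0 \<Longrightarrow> ser d c + ser d e = ser d (\<lambda>k. c k + e k)"
  unfolding ser_def by (simp only: emb_arith fps_to_fls_plus[symmetric] fps_plus_def fps_nth_Abs_fps)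

lemma ser_0: "d > 0 \<Longrightarrow> ser d (\<lambda>k. 0) = 0"
  by (simp add: ser_def emb_arith fps_zero_def[symmetric])

lemma ser_sum: "d > 0 \<Longrightarrow> (\<Sum>i\<in>I. ser d (c i)) = ser d (\<lambda>k. \<Sum>i\<in>I. c i k)"
  by (induction I rule: infinite_finite_induct) (simp_all add: ser_0 ser_add)

lemma ser_mult: "d > 0 \<Longrightarrow> ser d c * ser d e = ser d (\<lambda>k. \<Sum>i\<le>k. c i * e (k - i))"
  by (simp add: ser_def emb_arith fls_times_fps_to_fls[symmetric] fps_times_def atLeast0AtMost)

lemma cf_ser: "d > 0 \<Longrightarrow> cf (ser d c) (of_nat k / of_nat d) = c k"
proof -
  assume "d > 0"
  hence "cf (ser d c) (of_int (int k) / of_nat d) = c k"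
    unfolding ser_def by (simp only: cf_emb psemb_nth) simp
  thus ?thesis by simp
qed

lemma fin_eq_ser:
  assumes "d > 0" "a = emb d F" "fin a"
  shows "a = ser d (\<lambda>k. cf a (of_nat k / of_nat d))"
proof -
  have nth: "cf a (of_int n / of_nat d) = F $$ n" for n
    using assms by (simp add: cf_emb psemb_nth)
  have "F $$ n = fps_to_fls (Abs_fps (\<lambda>k. cf a (of_nat k / of_nat d))) $$ n" for n
  proof (cases "n < 0")
    case True
    hence "of_int n / of_nat d < (0::rat)" using assms(1) by (simp add: divide_neg_pos)
    hence "F $$ n = 0" using assms(3) nth[of n] by (simp add: fin_def)
    thus ?thesis using True by simp
  next
    case False
    thus ?thesis using nth[of n] by simp
  qed
  hence "F = fps_to_fls (Abs_fps (\<lambda>k. cf a (of_nat k / of_nat d)))" by (rule fls_eqI)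
  thus ?thesis unfolding ser_def using assms(2) by (simp only:)
qed

text \<open>With a constant \<open>v0\<close> inverting \<open>h\<close> at \<open>r\<close>, the
  polynomial \<open>1 - v0 * h\<close> is divisible by X - r. Its k-th power is divisible by (X -
  r)^k and congruent to 1 modulo \<open>h\<close>.\<close>

lemma poly_bezout_linear_power:
  fixes h :: "real poly"
  assumes "poly h r \<noteq> 0"
  shows "\<exists>u v. u * [:- r, 1:] ^ k + v * h = 1"
proof -
  define v0 where "v0 = [:1 / poly h r:]"
  have "poly (1 - v0 * h) r = 0" using assms by (simp add: v0_def)
  hence "[:- r, 1:] dvd 1 - v0 * h" by (simp only: poly_eq_0_iff_dvd)
  then obtain w where w: "1 - v0 * h = [:- r, 1:] * w" by (rule dvdE)
  have "1 - (1 - v0 * h) ^ k = (1 - (1 - v0 * h)) * (\<Sum>i<k. (1 - v0 * h) ^ i)"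
    by (rule one_diff_power_eq)
  hence "(1 - v0 * h) ^ k + (v0 * (\<Sum>i<k. (1 - v0 * h) ^ i)) * h = 1"
    by (simp add: algebra_simps)
  hence "w ^ k * [:- r, 1:] ^ k + (v0 * (\<Sum>i<k. (1 - v0 * h) ^ i)) * h = 1"
    using arg_cong[OF w, of "\<lambda>x. x ^ k"] by (simp only: power_mult_distrib mult.commute)
  thus ?thesis by blast
qed

text \<open>Bezout's identity multiplied by \<open>R\<close> gives some solution; reducing one
  cofactor modulo \<open>g\<close> bounds its degree, and the equation then bounds the
  other.\<close>

lemma poly_split_degree:
  fixes g h R :: "real poly"
  assumes "u * g + v * h = 1" "degree g \<ge> 1" "degree h \<ge> 1" "degree R < degree g + degree h"
  shows "\<exists>a b. a * h + b * g = R \<and> degree a < degree g \<and> degree b < degree h"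
proof -
  define a where "a = (R * v) mod g"
  define b where "b = R * u + ((R * v) div g) * h"
  have g0: "g \<noteq> 0" and h0: "h \<noteq> 0" using assms by auto
  have "R * v = (R * v) div g * g + a" by (simp add: a_def)
  hence "a = R * v - (R * v) div g * g" by (simp only: add_diff_cancel_left')
  hence "a * h + b * g = R * (u * g + v * h)" unfolding b_def
    by (simp only: ring_distribs left_diff_distrib) (simp only: mult_ac add_ac diff_conv_add_uminus add.right_inverse add.left_inverse)
  hence eq: "a * h + b * g = R" using assms(1) by simp
  have da: "degree a < degree g"
    using degree_mod_less[OF g0, of "R * v"] assms(2) by (auto simp: a_def)
  have "degree b < degree h"
  proof (cases "b = 0")
    case False
    have "degree (b * g) = degree (R - a * h)" using eq by (metis add_diff_cancel_left')
    also have "\<dots> < degree g + degree h"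
    proof (rule degree_diff_less[OF assms(4)])
      have "degree (a * h) \<le> degree a + degree h" by (rule degree_mult_le)
      thus "degree (a * h) < degree g + degree h" using da by simp
    qed
    finally show ?thesis using False g0 by (simp add: degree_mult_eq)
  qed (use assms(3) in simp)
  thus ?thesis using eq da by blast
qed

text \<open>Hensel's lemma: the factors are built coefficient by coefficient in powers of
  \<^term>\<open>t powr (1 / d)\<close>.\<close>
lemma hensel_sequence:
  fixes g h :: "real poly" and A :: "nat \<Rightarrow> real poly"
  assumes bez: "u * g + v * h = 1" and dg: "degree g \<ge> 1" and dh: "degree h \<ge> 1"
    and A0: "A 0 = g * h" and dA: "\<And>k. k > 0 \<Longrightarrow> degree (A k) < degree g + degree h"
  shows "\<exists>G H. G 0 = g \<and> H 0 = h \<and> (\<forall>k>0. degree (G k) < degree g \<and> degree (H k) < degree h)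
    \<and> (\<forall>k. (\<Sum>i\<le>k. G i * H (k - i)) = A k)"
proof -
  \<comment> \<open>The k-th coefficient of the product contains the unknowns of index k only in
    \<open>fst r * h + snd r * g\<close>. The remaining terms have indices strictly between 0 and k,
    so step k is a linear equation with known right-hand side.\<close>
  define P where "P f k r \<longleftrightarrow> (if k = 0 then r = (g, h) else
      degree (fst r) < degree g \<and> degree (snd r) < degree h \<and>
      fst r * h + snd r * g = A k - (\<Sum>i\<in>{0<..<k}. fst (f i) * snd (f (k - i))))"
    for f :: "nat \<Rightarrow> real poly \<times> real poly" and k and r :: "real poly \<times> real poly"
  have "\<exists>f. \<forall>k. P f k (f k)"
  proof (rule dependent_wf_choice[OF wf_less_than])
    fix f f' :: "nat \<Rightarrow> real poly \<times> real poly" and k r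
    assume eq: "\<And>z. (z, k) \<in> less_than \<Longrightarrow> f z = f' z"
    have "(\<Sum>i\<in>{0<..<k}. fst (f i) * snd (f (k - i))) = (\<Sum>i\<in>{0<..<k}. fst (f' i) * snd (f' (k - i)))"
      by (intro sum.cong refl) (auto simp: eq)
    thus "P f k r = P f' k r" by (simp add: P_def)
  next
    fix k and f :: "nat \<Rightarrow> real poly \<times> real poly"
    assume IH: "\<And>y. (y, k) \<in> less_than \<Longrightarrow> P f y (f y)"
    show "\<exists>r. P f k r"
    proof (cases "k = 0")
      case False
      have "degree (\<Sum>i\<in>{0<..<k}. fst (f i) * snd (f (k - i))) < degree g + degree h"
      proof (rule degree_sum_less)
        fix i assume i: "i \<in> {0<..<k}"
        hence "degree (fst (f i)) < degree g" "degree (snd (f (k - i))) < degree h"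
          using IH[of i] IH[of "k - i"] by (auto simp: P_def)
        thus "degree (fst (f i) * snd (f (k - i))) < degree g + degree h"
          using degree_mult_le[of "fst (f i)" "snd (f (k - i))"] by linarith
      qed (use dg in simp)
      hence "degree (A k - (\<Sum>i\<in>{0<..<k}. fst (f i) * snd (f (k - i)))) < degree g + degree h"
        using dA False by (intro degree_diff_less) auto
      from poly_split_degree[OF bez dg dh this] show ?thesis using False by (auto simp: P_def)
    qed (simp add: P_def)
  qed
  then obtain f where f: "\<And>k. P f k (f k)" by blast
  have f0: "f 0 = (g, h)" using f[of 0] by (simp add: P_def)
  have "(\<Sum>i\<le>k. fst (f i) * snd (f (k - i))) = A k" for k
  proof (cases "k = 0")
    case False
    have "{..k} = insert 0 (insert k {0<..<k})" using False by auto
    hence "(\<Sum>i\<le>k. fst (f i) * snd (f (k - i))) = g * snd (f k) + (fst (f k) * h + (\<Sum>i\<in>{0<..<k}. fst (f i) * snd (f (k - i))))"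
      using False f0 by simp
    also have "\<dots> = A k" using f[of k] False by (simp add: P_def algebra_simps)
    finally show ?thesis .
  qed (simp add: f0 A0)
  moreover have "degree (fst (f k)) < degree g \<and> degree (snd (f k)) < degree h" if "k > 0" for k
    using f[of k] that by (simp add: P_def)
  ultimately show ?thesis using f0 by (intro exI[of _ "\<lambda>k. fst (f k)"] exI[of _ "\<lambda>k. snd (f k)"]) auto
qed

text \<open>Turns a series of polynomials into a polynomial of series, for which \<open>n\<close>
  has to bound all degrees.\<close>

definition pser :: "nat \<Rightarrow> nat \<Rightarrow> (nat \<Rightarrow> real poly) \<Rightarrow> pui poly" where
  "pser d n G = Poly (map (\<lambda>j. ser d (\<lambda>k. coeff (G k) j)) [0..<Suc n])"

lemma coeff_pser:
  assumes "d > 0" "\<And>k. degree (G k) \<le> n"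
  shows "coeff (pser d n G) j = ser d (\<lambda>k. coeff (G k) j)"
proof (cases "j \<le> n")
  case True
  thus ?thesis by (simp add: pser_def nth_default_def del: upt_Suc)
next
  case False
  have "coeff (G k) j = 0" for k using assms(2)[of k] False by (intro coeff_eq_0) simp
  thus ?thesis using False assms(1) by (simp add: pser_def nth_default_def ser_0 del: upt_Suc)
qed

lemma degree_pser:
  assumes "d > 0" "\<And>k. degree (G k) \<le> n" "degree (G 0) = n" "n \<ge> 1"
  shows "degree (pser d n G) = n"
proof (rule antisym)
  show "degree (pser d n G) \<le> n"
    by (rule degree_le) (auto simp: pser_def nth_default_def simp del: upt_Suc)
  have "cf (coeff (pser d n G) n) (of_nat 0 / of_nat d) = coeff (G 0) n"
    unfolding coeff_pser[OF assms(1,2)] by (rule cf_ser[OF assms(1)])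
  moreover have "coeff (G 0) n \<noteq> 0" using assms(3,4) by auto
  ultimately have "coeff (pser d n G) n \<noteq> 0" by auto
  thus "n \<le> degree (pser d n G)" by (rule le_degree)
qed

text \<open>With a common denominator \<open>d\<close> for its coefficients, \<open>Q\<close>
  becomes a power series in t^(1/d) whose coefficients are the real polynomials \<open>A k\<close>,
  and \<open>hensel_sequence\<close> applies.\<close>

lemma hensel:
  fixes Q :: "pui poly"
  assumes fin: "\<And>i. fin (coeff Q i)" and lc: "lead_coeff Q = 1" and gh: "map_poly st Q = g * h"
    and dQ: "degree Q = degree g + degree h" and bez: "u * g + v * h = 1"
    and dg: "degree g \<ge> 1" and dh: "degree h \<ge> 1"
  shows "\<exists>G H. Q = G * H \<and> degree G = degree g \<and> degree H = degree h"
proof -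
  have "finite (range (coeff Q))"
    by (simp add: range_coeff)
  from common_emb[OF this] obtain d where d: "d > 0" "\<forall>a\<in>range (coeff Q). \<exists>F. a = emb d F" by blast
  define A where "A k = map_poly (\<lambda>a. cf a (of_nat k / of_nat d)) Q" for k
  have cA: "coeff (A k) i = cf (coeff Q i) (of_nat k / of_nat d)" for k i
    by (simp add: A_def coeff_map_poly)
  have Q: "coeff Q i = ser d (\<lambda>k. coeff (A k) i)" for i
  proof -
    obtain F where "coeff Q i = emb d F" using d(2) by blast
    from fin_eq_ser[OF d(1) this fin] show ?thesis unfolding cA .
  qed
  have "A 0 = g * h" unfolding gh[symmetric] by (rule poly_eqI) (simp add: cA coeff_map_poly st_def)
  \<comment> \<open>The leading coefficient 1 contributes to \<open>A 0\<close> only; this is where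
    monicity enters.\<close>
  have "degree (A k) < degree g + degree h" if "k > 0" for k
  proof (rule degree_lessI)
    show "\<forall>i\<ge>degree g + degree h. coeff (A k) i = 0"
    proof (intro allI impI)
      fix i assume i: "degree g + degree h \<le> i"
      show "coeff (A k) i = 0"
      proof (cases "i = degree Q")
        case True
        hence "coeff Q i = 1" using lc by simp
        thus ?thesis using that d(1) by (simp add: cA cf_1 ps_const_def)
      next
        case False
        hence "coeff Q i = 0" using i dQ by (intro coeff_eq_0) simp
        thus ?thesis by (simp add: cA)
      qed
    qed
  qed (use dg in auto)
  from hensel_sequence[where A = A, OF bez dg dh \<open>A 0 = g * h\<close> this]
  obtain G H where G0: "G 0 = g" "H 0 = h"
    and dGH: "\<And>k. k > 0 \<Longrightarrow> degree (G k) < degree g \<and> degree (H k) < degree h"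
    and sum: "\<And>k. (\<Sum>i\<le>k. G i * H (k - i)) = A k" by blast
  have dG: "degree (G k) \<le> degree g" and dH: "degree (H k) \<le> degree h" for k
    using dGH[of k] G0 by (cases "k = 0"; simp)+
  have "coeff (pser d (degree g) G * pser d (degree h) H) i = coeff Q i" for i
  proof -
    have "coeff (pser d (degree g) G * pser d (degree h) H) i
      = (\<Sum>j\<le>i. ser d (\<lambda>k. coeff (G k) j) * ser d (\<lambda>k. coeff (H k) (i - j)))"
      unfolding coeff_mult coeff_pser[OF d(1) dG] coeff_pser[OF d(1) dH] ..
    also have "\<dots> = ser d (\<lambda>k. \<Sum>j\<le>i. \<Sum>l\<le>k. coeff (G l) j * coeff (H (k - l)) (i - j))"
      unfolding ser_mult[OF d(1)] ser_sum[OF d(1)] ..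
    also have "(\<lambda>k. \<Sum>j\<le>i. \<Sum>l\<le>k. coeff (G l) j * coeff (H (k - l)) (i - j)) = (\<lambda>k. coeff (A k) i)"
    proof
      fix k
      have "(\<Sum>j\<le>i. \<Sum>l\<le>k. coeff (G l) j * coeff (H (k - l)) (i - j))
        = (\<Sum>l\<le>k. \<Sum>j\<le>i. coeff (G l) j * coeff (H (k - l)) (i - j))" by (rule sum.swap)
      also have "\<dots> = coeff (A k) i" by (simp add: sum[symmetric] coeff_sum coeff_mult)
      finally show "(\<Sum>j\<le>i. \<Sum>l\<le>k. coeff (G l) j * coeff (H (k - l)) (i - j)) = coeff (A k) i" .
    qed
    finally show ?thesis unfolding Q .
  qed
  hence "Q = pser d (degree g) G * pser d (degree h) H" by (intro poly_eqI) simp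
  moreover have "degree (pser d (degree g) G) = degree g"
    by (rule degree_pser[OF d(1) dG]) (use G0 dg in simp_all)
  moreover have "degree (pser d (degree h) H) = degree h"
    by (rule degree_pser[OF d(1) dH]) (use G0 dh in simp_all)
  ultimately show ?thesis by blast
qed

section \<open>The intermediate value theorem by induction on the degree\<close>

lemma real_poly_pos_if_no_root:
  fixes p :: "real poly"
  assumes "lead_coeff p = 1" "\<And>x. poly p x \<noteq> 0"
  shows "poly p x > 0" "even (degree p)"
proof -
  obtain n where n: "\<forall>x\<ge>n. sg (poly p x) = sg (lead_coeff p)" using sg_poly_at_top by blast
  obtain m where m: "\<forall>x\<le>m. sg (poly p x) = sg (lead_coeff p) * (- 1) ^ degree p" using sg_poly_at_bot by blast
  have pos: "poly p x > 0" for x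
  proof -
    have "sg (poly p x) = sg (poly p (max x n))" by (rule sg_poly_constant) (use assms(2) in auto)
    also have "\<dots> = 1" using n assms(1) by simp
    finally show ?thesis by simp
  qed
  show "poly p x > 0" by (rule pos)
  have "sg (poly p m) = 1" using pos by simp
  hence "(- 1 :: int) ^ degree p = 1" using m assms(1) by simp
  thus "even (degree p)" by (cases "even (degree p)") auto
qed

text \<open>At a finite point the value has positive residue. At an infinite \<open>x\<close>, with
  y = 1 / x infinitesimal, \<open>y ^ degree Q * poly Q x\<close> is a value of the reversed
  polynomial, whose constant term is 1, and the degree is even.\<close>

lemma no_residual_root_pos:
  fixes Q :: "pui poly"
  assumes fin: "\<And>i. fin (coeff Q i)" and lc: "lead_coeff Q = 1"
    and noroot: "\<And>r. poly (map_poly st Q) r \<noteq> 0"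
  shows "poly Q x > 0"
proof -
  define p where "p = map_poly st Q"
  have cp: "coeff p i = st (coeff Q i)" for i by (simp add: p_def coeff_map_poly)
  have "degree p \<le> degree Q" by (rule degree_le) (simp add: cp coeff_eq_0)
  moreover have "coeff p (degree Q) = 1" using lc by (simp add: cp)
  hence "degree Q \<le> degree p" by (intro le_degree) simp
  ultimately have dp: "degree p = degree Q" by simp
  have lcp: "lead_coeff p = 1" using \<open>coeff p (degree Q) = 1\<close> dp by simp
  have nr: "poly p r \<noteq> 0" for r using noroot by (simp add: p_def)
  note pos = real_poly_pos_if_no_root[OF lcp nr]
  show ?thesis
  proof (cases "fin x")
    case True
    have "st (poly Q x) > 0" using pos(1) by (simp add: fin_poly(2)[OF fin True] p_def)
    thus ?thesis by (intro st_pos_imp_pos fin_poly(1) fin True)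
  next
    case False
    hence "x \<noteq> 0" by auto
    define y where "y = inverse x"
    have y: "fin y" "st y = 0" "y \<noteq> 0" "inverse y = x"
      using not_fin_inverse[OF False] \<open>x \<noteq> 0\<close> by (simp_all add: y_def)
    have finr: "fin (coeff (reflect_poly Q) i)" for i using fin by (simp add: coeff_reflect_poly)
    have "st (poly (reflect_poly Q) y) = poly (map_poly st (reflect_poly Q)) 0"
      unfolding fin_poly(2)[OF finr y(1)] y(2) ..
    also have "\<dots> = 1" using lc by (simp add: poly_0_coeff_0 coeff_map_poly)
    finally have "poly (reflect_poly Q) y > 0"
      by (intro st_pos_imp_pos fin_poly(1) finr y) simp
    hence "y ^ degree Q * poly Q x > 0" using poly_reflect_poly_nz[OF y(3), of Q] y(4) by simp
    moreover have "y ^ degree Q > 0" using pos(2) dp y(3) by (simp add: zero_less_power_eq)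
    ultimately show ?thesis by (rule zero_less_mult_pos)
  qed
qed

text \<open>By \<open>no_residual_root_pos\<close> the residue polynomial has a root r. It is not a
  pure power of X - r: the vanishing coefficient \<open>c1\<close> would give r = 0, against
  \<open>nz\<close>. Hence it splits into coprime nonconstant factors, Hensel's lemma lifts them,
  and one of the two factors of \<open>Q\<close> changes sign.\<close>

lemma ivt_normalized:
  fixes Q :: "pui poly"
  assumes IH: "\<And>P (a::pui) b. degree P < degree Q \<Longrightarrow> a < b \<Longrightarrow> poly P a * poly P b < 0 \<Longrightarrow>
      \<exists>c>a. c < b \<and> poly P c = 0"
    and fin: "\<And>i. fin (coeff Q i)" and lc: "lead_coeff Q = 1"
    and dQ: "degree Q \<ge> 1" and c1: "coeff Q (degree Q - 1) = 0"
    and nz: "\<exists>i<degree Q. st (coeff Q i) \<noteq> 0"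
    and ab: "a < b" "poly Q a * poly Q b < 0"
  shows "\<exists>c>a. c < b \<and> poly Q c = 0"
proof -
  define p where "p = map_poly st Q"
  have cp: "coeff p i = st (coeff Q i)" for i by (simp add: p_def coeff_map_poly)
  have "degree p \<le> degree Q" by (rule degree_le) (simp add: cp coeff_eq_0)
  moreover have cpQ: "coeff p (degree Q) = 1" using lc by (simp add: cp)
  hence "degree Q \<le> degree p" by (intro le_degree) simp
  ultimately have dp: "degree p = degree Q" by simp
  have "p \<noteq> 0" using cpQ by auto
  have "\<exists>r. poly p r = 0"
  proof (rule ccontr)
    assume "\<not> ?thesis"
    hence "poly Q x > 0" for x using no_residual_root_pos[OF fin lc] by (simp add: p_def)
    hence "poly Q a * poly Q b > 0" by (intro mult_pos_pos)
    thus False using ab(2) by simp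
  qed
  then obtain r where r: "poly p r = 0" ..
  define k where "k = order r p"
  obtain h where h: "p = [:- r, 1:] ^ k * h" "\<not> [:- r, 1:] dvd h"
    using order_decomp[OF \<open>p \<noteq> 0\<close>] unfolding k_def by blast
  have k: "k \<ge> 1" using r \<open>p \<noteq> 0\<close> unfolding k_def by (simp add: order_root Suc_leI)
  have hr: "poly h r \<noteq> 0" using h(2) by (simp add: poly_eq_0_iff_dvd)
  have "h \<noteq> 0" using hr by auto
  have dg: "degree ([:- r, 1:] ^ k) = k" by (simp add: degree_power_eq)
  have dph: "degree p = k + degree h" using h(1) \<open>h \<noteq> 0\<close> dg by (simp add: degree_mult_eq)
  have "degree h \<ge> 1"
  proof (rule ccontr)
    assume "\<not> ?thesis"
    hence d0: "degree h = 0" by simp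
    then obtain c where c: "h = [:c:]" by (rule degree_eq_zeroE)
    have kQ: "k = degree Q" using dp dph d0 by simp
    have coeffp: "coeff p i = of_nat (k choose i) * (- r) ^ (k - i) * c" if "i \<le> k" for i
      using that by (simp add: h(1) c coeff_linear_poly_power)
    have "c = 1" using coeffp[of k] cpQ kQ by simp
    have "coeff p (k - 1) = 0" using c1 by (simp add: cp kQ)
    hence "r = 0" using coeffp[of "k - 1"] k \<open>c = 1\<close> by (auto simp: binomial_eq_0_iff)
    hence "coeff p i = 0" if "i < k" for i using coeffp[of i] that by simp
    thus False using nz by (auto simp: cp kQ)
  qed
  obtain u v where "u * [:- r, 1:] ^ k + v * h = 1" using poly_bezout_linear_power[OF hr] by blast
  from hensel[OF fin lc h(1)[unfolded p_def] _ this] dp dph dg k \<open>degree h \<ge> 1\<close>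
  obtain G H where GH: "Q = G * H" "degree G = k" "degree H = degree h" by auto
  have "(poly G a * poly G b) * (poly H a * poly H b) < 0"
    using ab(2) by (simp add: GH(1) mult_ac)
  hence "poly G a * poly G b < 0 \<or> poly H a * poly H b < 0" by (auto simp: mult_less_0_iff)
  thus ?thesis
  proof
    assume "poly G a * poly G b < 0"
    with IH[of G a b] ab(1) GH dp dph \<open>degree h \<ge> 1\<close> show ?thesis by auto
  next
    assume "poly H a * poly H b < 0"
    with IH[of H a b] ab(1) GH dp dph k show ?thesis by auto
  qed
qed

text \<open>The computation behind the Tschirnhaus shift: terms of lower degree cannot reach index n
  - 1, and the binomial expansion of the top term adds n times \<open>s\<close>.\<close>

lemma coeff_shift_next_to_leading:
  fixes P :: "'a::comm_ring_1 poly"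
  assumes "degree P = n" "n \<ge> 1" "lead_coeff P = 1"
  shows "coeff (pcompose P [:s, 1:]) (n - 1) = of_nat n * s + coeff P (n - 1)"
proof -
  define R where "R = P - monom 1 n - monom (coeff P (n - 1)) (n - 1)"
  have "coeff R i = 0" if "i \<ge> n - 1" for i
    using that assms by (cases "i = n - 1 \<or> i = n") (auto simp: R_def coeff_eq_0)
  hence R: "R = 0 \<or> degree R < n - 1"
    using leading_coeff_0_iff[of R] by (cases "degree R < n - 1") auto
  have cR: "coeff (pcompose R [:s, 1:]) (n - 1) = 0"
  proof (cases "R = 0")
    case False
    have "degree (pcompose R [:s, 1:]) \<le> degree R * degree [:s, 1:]" by (rule degree_pcompose_le)
    thus ?thesis using R False by (intro coeff_eq_0) simp
  qed simp
  have P: "P = monom 1 n + monom (coeff P (n - 1)) (n - 1) + R" by (simp add: R_def)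
  have m: "pcompose (monom c i) [:s, 1:] = smult c ([:s, 1:] ^ i)" for c i
    by (induction i) (simp_all add: monom_0 monom_Suc pcompose_pCons)
  have "pcompose P [:s, 1:] = [:s, 1:] ^ n + smult (coeff P (n - 1)) ([:s, 1:] ^ (n - 1)) + pcompose R [:s, 1:]"
    using arg_cong[OF P, of "\<lambda>p. pcompose p [:s, 1:]"] by (simp only: pcompose_add m smult_1_left)
  hence "coeff (pcompose P [:s, 1:]) (n - 1) = of_nat (n choose (n - 1)) * s + coeff P (n - 1)"
    using assms(2) cR by (simp add: coeff_linear_poly_power)
  moreover have "n choose (n - 1) = n" using assms(2) binomial_symmetric[of "n - 1" n] by simp
  ultimately show ?thesis by simp
qed

text \<open>Replacing x by t^w x makes \<open>ivt_normalized\<close> applicable. Here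
  \<open>w\<close> is an extremal slope of the Newton polygon: the largest exponent for which all
  coefficients become finite, and an index attaining the minimum keeps a nonzero residue.\<close>

lemma ivt_depressed:
  fixes P :: "pui poly"
  assumes IH: "\<And>R (a::pui) b. degree R < degree P \<Longrightarrow> a < b \<Longrightarrow> poly R a * poly R b < 0 \<Longrightarrow>
      \<exists>c>a. c < b \<and> poly R c = 0"
    and lc: "lead_coeff P = 1"
    and dP: "degree P \<ge> 1" and c1: "coeff P (degree P - 1) = 0"
    and ab: "a < b" "poly P a * poly P b < 0"
  shows "\<exists>c>a. c < b \<and> poly P c = 0"
proof -
  define n where "n = degree P"
  define I where "I = {i. i < n \<and> coeff P i \<noteq> 0}"
  show ?thesis
  proof (cases "I = {}")
    \<comment> \<open>Here \<open>P\<close> is the pure power X^n, and a sign change forces a < 0 <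
      b.\<close>
    case True
    have "P = monom 1 n"
    proof (rule poly_eqI)
      fix i
      consider "i < n" | "i = n" | "i > n" by linarith
      thus "coeff P i = coeff (monom 1 n) i"
        using True lc by cases (auto simp: I_def n_def coeff_eq_0)
    qed
    hence px: "poly P x = x ^ n" for x by (simp add: poly_monom)
    hence "(a * b) ^ n < 0" using ab(2) by (simp add: power_mult_distrib)
    hence "a * b < 0" using zero_le_power[of "a * b" n] by (auto simp: not_less[symmetric])
    hence "a < 0" "0 < b" using ab(1) by (auto simp: mult_less_0_iff)
    thus ?thesis using px[of 0] dP by (intro exI[of _ 0]) (simp add: n_def)
  next
    case False
    have "finite I" by (simp add: I_def)
    define w where "w = Min ((\<lambda>i. val (coeff P i) / of_nat (n - i)) ` I)"
    have "w \<in> (\<lambda>i. val (coeff P i) / of_nat (n - i)) ` I"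
      unfolding w_def using False \<open>finite I\<close> by (intro Min_in) auto
    then obtain i0 where i0: "i0 \<in> I" "w = val (coeff P i0) / of_nat (n - i0)" by blast
    have wle: "w * of_nat (n - i) \<le> val (coeff P i)" if "i \<in> I" for i
    proof -
      have "w \<le> val (coeff P i) / of_nat (n - i)" unfolding w_def using that \<open>finite I\<close> by (intro Min_le) auto
      thus ?thesis using that by (simp add: I_def pos_le_divide_eq)
    qed
    \<comment> \<open>The outer factor t^(-n w) restores the leading coefficient 1; exponents in
      coefficient i move down by w (n - i).\<close>
    define Q where "Q = smult (Tm (- of_nat n * w)) (pcompose P [:0, Tm w:])"
    have pQ: "poly Q x = Tm (- of_nat n * w) * poly P (Tm w * x)" for x
      by (simp add: Q_def poly_pcompose mult.commute)
    have cQ: "coeff Q i = Tm (of_nat i * w - of_nat n * w) * coeff P i" for i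
      by (simp add: Q_def coeff_pcompose_linear Tm_power Tm_mult algebra_simps flip: mult.assoc)
    have Tnz: "Tm v \<noteq> 0" for v using Tm_pos[of v] by simp
    have cfQ: "cf (coeff Q i) q = cf (coeff P i) (q + w * of_nat (n - i))" if "i \<le> n" for i q
    proof -
      have "q - (of_nat i * w - of_nat n * w) = q + w * of_nat (n - i)"
        using that by (simp add: of_nat_diff algebra_simps)
      thus ?thesis by (simp only: cQ cf_Tm_mult)
    qed
    have dQ: "degree Q = n"
    proof (rule antisym)
      show "degree Q \<le> n" by (rule degree_le) (simp add: cQ coeff_eq_0 n_def)
      show "n \<le> degree Q" by (rule le_degree) (use lc Tnz in \<open>simp add: cQ n_def\<close>)
    qed
    have "\<exists>c>a / Tm w. c < b / Tm w \<and> poly Q c = 0"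
    proof (rule ivt_normalized)
      show "fin (coeff Q i)" for i
      proof -
        have "coeff P i = 0" if "i > n" using that unfolding n_def by (rule coeff_eq_0)
        then consider "i \<in> I" | "i = n" | "coeff P i = 0" unfolding I_def by force
        thus ?thesis
        proof cases
          case 1
          show ?thesis unfolding fin_def
          proof (intro allI impI)
            fix q :: rat assume "q < 0"
            hence "q + w * of_nat (n - i) < val (coeff P i)" using wle[OF 1] by linarith
            thus "cf (coeff Q i) q = 0" using 1 by (simp add: cfQ I_def cf_less_val)
          qed
        next
          case 2
          thus ?thesis using lc by (simp add: cQ n_def Tm_0)
        qed (simp add: cQ)
      qed
      show "lead_coeff Q = 1" unfolding dQ using lc by (simp add: cQ n_def Tm_0)
      show "degree Q \<ge> 1" using dP dQ by (simp add: n_def)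
      show "coeff Q (degree Q - 1) = 0" unfolding dQ using c1 by (simp add: cQ n_def)
      have "st (coeff Q i0) = cf (coeff P i0) (val (coeff P i0))"
        using i0 by (simp add: st_def cfQ I_def)
      thus "\<exists>i<degree Q. st (coeff Q i) \<noteq> 0"
        using i0 cf_val dQ by (intro exI[of _ i0]) (simp add: I_def)
      show "a / Tm w < b / Tm w" using ab(1) Tm_pos[of w] by (simp add: divide_strict_right_mono)
      have "poly Q (a / Tm w) * poly Q (b / Tm w) = (Tm (- of_nat n * w))\<^sup>2 * (poly P a * poly P b)"
        using Tnz[of w] by (simp add: pQ power2_eq_square)
      thus "poly Q (a / Tm w) * poly Q (b / Tm w) < 0"
        using ab(2) Tnz by (simp add: mult_less_0_iff)
      show "\<exists>c>x. c < y \<and> poly R c = 0"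
        if "degree R < degree Q" "x < y" "poly R x * poly R y < 0" for R :: "pui poly" and x y
        using IH[OF _ that(2,3)] that(1) dQ by (simp add: n_def)
    qed
    then obtain c where c: "a / Tm w < c" "c < b / Tm w" "poly Q c = 0" by blast
    have "a < Tm w * c" "Tm w * c < b" using c(1,2) Tm_pos[of w]
      by (simp_all add: pos_divide_less_eq pos_less_divide_eq mult.commute)
    moreover have "poly P (Tm w * c) = 0" using c(3) Tnz by (simp add: pQ)
    ultimately show ?thesis by blast
  qed
qed

theorem ivt_pui:
  fixes P :: "pui poly"
  assumes "a < b" "poly P a * poly P b < 0"
  shows "\<exists>c>a. c < b \<and> poly P c = 0"
  using assms
proof (induction "degree P" arbitrary: P a b rule: less_induct)
  case less
  define n where "n = degree P"
  have "P \<noteq> 0" using less.prems by auto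
  have "n \<noteq> 0"
  proof
    assume "n = 0"
    then obtain c where "P = [:c:]" unfolding n_def by (rule degree_eq_zeroE)
    thus False using less.prems(2) by (simp add: mult_less_0_iff)
  qed
  define l where "l = lead_coeff P"
  have l: "l \<noteq> 0" using \<open>P \<noteq> 0\<close> by (simp add: l_def)
  define P1 where "P1 = smult (inverse l) P"
  have P1: "degree P1 = n" "lead_coeff P1 = 1" using l by (simp_all add: P1_def n_def l_def)
  \<comment> \<open>This shift removes the coefficient of index n - 1; characteristic 0 permits the
    division.\<close>
  define s where "s = - (coeff P1 (n - 1) / of_nat n)"
  define P2 where "P2 = pcompose P1 [:s, 1:]"
  have p2: "poly P2 x = inverse l * poly P (x + s)" for x
    by (simp add: P2_def P1_def poly_pcompose add.commute)
  have d2: "degree P2 = n" using P1 by (simp add: P2_def degree_pcompose)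
  have "\<exists>c>a - s. c < b - s \<and> poly P2 c = 0"
  proof (rule ivt_depressed)
    show "lead_coeff P2 = 1" unfolding P2_def by (subst lead_coeff_comp) (use P1 in auto)
    show "degree P2 \<ge> 1" using d2 \<open>n \<noteq> 0\<close> by simp
    have "coeff P2 (n - 1) = of_nat n * s + coeff P1 (n - 1)"
      unfolding P2_def using P1 \<open>n \<noteq> 0\<close> by (intro coeff_shift_next_to_leading) auto
    thus "coeff P2 (degree P2 - 1) = 0" using d2 \<open>n \<noteq> 0\<close> by (simp add: s_def)
    show "a - s < b - s" using less.prems(1) by simp
    have "poly P2 (a - s) * poly P2 (b - s) = (inverse l)\<^sup>2 * (poly P a * poly P b)"
      by (simp add: p2 power2_eq_square)
    thus "poly P2 (a - s) * poly P2 (b - s) < 0"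
      using less.prems(2) l by (simp add: mult_less_0_iff)
    show "\<exists>c>x. c < y \<and> poly R c = 0"
      if "degree R < degree P2" "x < y" "poly R x * poly R y < 0" for R :: "pui poly" and x y
      using less.hyps[OF _ that(2,3)] that(1) d2 by (simp add: n_def)
  qed
  then obtain c where c: "a - s < c" "c < b - s" "poly P2 c = 0" by blast
  have "a < c + s" "c + s < b" using c(1,2) by (simp_all add: less_diff_eq diff_less_eq)
  moreover have "poly P (c + s) = 0" using c(3) l by (simp add: p2)
  ultimately show ?case by blast
qed

instance pui :: rcf
proof
  fix a b :: pui and cs
  assume "a < b" "foldr (\<lambda>c v. c + a * v) cs 0 < 0" "0 < foldr (\<lambda>c v. c + b * v) cs 0"
  thus "\<exists>c>a. c < b \<and> foldr (\<lambda>d v. d + c * v) cs 0 = 0"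
    unfolding horner_conv_poly by (intro ivt_pui) (auto simp: mult_less_0_iff)
qed

section \<open>Transfer between the reals and Puiseux series\<close>

no_notation fls_nth (infixl "$$" 75)

section \<open>Abbreviations for first-order statements, and transfer\<close>

abbreviation "PSub a b \<equiv> PAdd a (PNeg b)"

primrec PPow :: "'v rpoly \<Rightarrow> nat \<Rightarrow> 'v rpoly" where
  "PPow p 0 = PConst 1"
| "PPow p (Suc n) = PMul p (PPow p n)"

definition PSum :: "'v rpoly list \<Rightarrow> 'v rpoly" where
  "PSum ps = foldr PAdd ps (PConst 0)"

lemma peval_PPow [simp]: "peval (PPow p n) x = peval p x ^ n"
  by (induction n) auto

lemma peval_PSum [simp]: "peval (PSum ps) x = (\<Sum>p\<leftarrow>ps. peval p x)"
  unfolding PSum_def by (induction ps) auto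

definition Lt :: "'v rpoly \<Rightarrow> 'v rpoly \<Rightarrow> 'v fo" where "Lt a b = Qf (FPos (PSub b a))"
definition Le :: "'v rpoly \<Rightarrow> 'v rpoly \<Rightarrow> 'v fo" where "Le a b = Neg (Lt b a)"
definition Eq :: "'v rpoly \<Rightarrow> 'v rpoly \<Rightarrow> 'v fo" where "Eq a b = Qf (FZero (PSub a b))"
definition Disj :: "'v fo \<Rightarrow> 'v fo \<Rightarrow> 'v fo" where "Disj f g = Neg (Conj (Neg f) (Neg g))"
definition Imp :: "'v fo \<Rightarrow> 'v fo \<Rightarrow> 'v fo" where "Imp f g = Neg (Conj f (Neg g))"
definition All :: "'v \<Rightarrow> 'v fo \<Rightarrow> 'v fo" where "All v f = Neg (Ex v (Neg f))"
definition AllL :: "'v list \<Rightarrow> 'v fo \<Rightarrow> 'v fo" where "AllL vs f = foldr All vs f"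
definition ConjL :: "'v fo list \<Rightarrow> 'v fo" where "ConjL fs = foldr Conj fs (Qf Ftrue)"

lemma sat_simps [simp]:
  "sat (Lt a b) x \<longleftrightarrow> peval a x < peval b x"
  "sat (Le a b) x \<longleftrightarrow> peval a x \<le> peval b x"
  "sat (Eq a b) x \<longleftrightarrow> peval a x = peval b x"
  "sat (Disj f g) x \<longleftrightarrow> sat f x \<or> sat g x"
  "sat (Imp f g) x \<longleftrightarrow> (sat f x \<longrightarrow> sat g x)"
  "sat (All v f) x \<longleftrightarrow> (\<forall>a. sat f (x(v := a)))"
  by (auto simp: Lt_def Le_def Eq_def Disj_def Imp_def All_def)

lemma sat_ConjL [simp]: "sat (ConjL fs) x \<longleftrightarrow> (\<forall>f\<in>set fs. sat f x)"
  unfolding ConjL_def by (induction fs) auto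

lemma sat_AllL: "sat (AllL vs f) x \<longleftrightarrow> (\<forall>z. (\<forall>v. v \<notin> set vs \<longrightarrow> z v = x v) \<longrightarrow> sat f z)"
  unfolding AllL_def
proof (induction vs arbitrary: x)
  case Nil
  have "z = x" if "\<forall>v. z v = x v" for z using that by (simp add: fun_eq_iff)
  thus ?case by auto
next
  case (Cons w vs)
  have "sat (foldr All (w # vs) f) x \<longleftrightarrow>
      (\<forall>a z. (\<forall>v. v \<notin> set vs \<longrightarrow> z v = (x(w := a)) v) \<longrightarrow> sat f z)"
    by (simp add: Cons.IH del: fun_upd_apply)
  also have "\<dots> \<longleftrightarrow> (\<forall>z. (\<forall>v. v \<notin> set (w # vs) \<longrightarrow> z v = x v) \<longrightarrow> sat f z)"
  proof (intro iffI allI impI)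
    fix z assume *: "\<forall>a z. (\<forall>v. v \<notin> set vs \<longrightarrow> z v = (x(w := a)) v) \<longrightarrow> sat f z"
      and z: "\<forall>v. v \<notin> set (w # vs) \<longrightarrow> z v = x v"
    have "\<forall>v. v \<notin> set vs \<longrightarrow> z v = (x(w := z w)) v" using z by simp
    thus "sat f z" using * by blast
  next
    fix a z assume *: "\<forall>z. (\<forall>v. v \<notin> set (w # vs) \<longrightarrow> z v = x v) \<longrightarrow> sat f z"
      and z: "\<forall>v. v \<notin> set vs \<longrightarrow> z v = (x(w := a)) v"
    have "\<forall>v. v \<notin> set (w # vs) \<longrightarrow> z v = x v" using z by simp
    thus "sat f z" using * by blast
  qed
  finally show ?case .
qed

lemma peval_cong: "(\<And>v. v \<in> set_rpoly p \<Longrightarrow> x v = y v) \<Longrightarrow> peval p x = peval p y"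
  by (induction p) auto

lemma holds_cong: "(\<And>v. v \<in> set_sfml f \<Longrightarrow> x v = y v) \<Longrightarrow> holds f x = holds f y"
proof (induction f)
  case (FPos p)
  thus ?case using peval_cong[of p x y] by simp
next
  case (FZero p)
  thus ?case using peval_cong[of p x y] by simp
qed auto

lemma finite_set_rpoly: "finite (set_rpoly p)"
  by (induction p) auto

lemma finite_set_sfml: "finite (set_sfml f)"
  by (induction f) (auto simp: finite_set_rpoly)

lemma sat_of_real: "sat f (\<lambda>v. of_real (x v) :: pui) \<longleftrightarrow> sat f x"
proof -
  obtain g where g: "\<And>x::_ \<Rightarrow> real. holds g x \<longleftrightarrow> sat f x" "\<And>y::_ \<Rightarrow> pui. holds g y \<longleftrightarrow> sat f y"
    using fo_quantifier_elimination[of f, where 'a = real and 'b = pui] by blast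
  show ?thesis unfolding g[symmetric] by (rule holds_of_real)
qed

text \<open>Only the finitely many variables of an equivalent quantifier-free \<open>g\<close>
  matter. Closing \<open>g\<close> over them gives a formula whose truth at the zero tuple expresses
  validity, and truth at real tuples is the same in both fields.\<close>

theorem transfer_to_pui:
  assumes "\<And>x::'v \<Rightarrow> real. sat f x"
  shows "sat f (y :: 'v \<Rightarrow> pui)"
proof -
  obtain g where g: "\<And>x::'v \<Rightarrow> real. holds g x \<longleftrightarrow> sat f x" "\<And>y::'v \<Rightarrow> pui. holds g y \<longleftrightarrow> sat f y"
    using fo_quantifier_elimination[of f, where 'a = real and 'b = pui] by blast
  obtain vs where vs: "set vs = set_sfml g" using finite_list[OF finite_set_sfml[of g]] by blast
  have "sat (AllL vs (Qf g)) (\<lambda>_. 0 :: real)" unfolding sat_AllL using assms g(1) by simp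
  hence *: "sat (AllL vs (Qf g)) (\<lambda>_. of_real 0 :: pui)" using sat_of_real[of "AllL vs (Qf g)" "\<lambda>_. 0"] by blast
  define z where "z = (\<lambda>v. if v \<in> set vs then y v else of_real 0)"
  have "holds g z" using *[unfolded sat_AllL, rule_format, of z] by (simp add: z_def)
  moreover have "holds g z = holds g y" by (rule holds_cong) (simp add: z_def vs)
  ultimately show ?thesis using g(2) by simp
qed

section \<open>The infinitesimal t and small positive reals\<close>

lemma fin_Tm1: "fin (Tm 1)" "st (Tm 1) = 0"
  by (simp_all add: fin_def st_def cf_Tm)

lemma sg_eq_if_st: "fin a \<Longrightarrow> st a \<noteq> 0 \<Longrightarrow> sg a = sg (st a)"
  using st_pos_imp_pos[of a] st_pos_imp_pos[of "- a"]
  by (cases "st a" "0::real" rule: linorder_cases) (simp_all add: sg_def fin_uminus)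

text \<open>Near 0 on the right as well as at t, the sign is that of the lowest nonzero coefficient;
  the induction strips zero coefficients.\<close>

lemma sg_poly_infinitesimal:
  fixes u :: "real poly"
  shows "eventually (\<lambda>r. sg (poly u r) = sg (poly (map_poly of_real u) (Tm 1))) (at_right 0)"
proof (induction u)
  case (pCons a u)
  have P: "poly (map_poly of_real (pCons a u)) (Tm 1) = of_real a + Tm 1 * poly (map_poly of_real u) (Tm 1)"
    by (simp add: map_poly_pCons)
  show ?case
  proof (cases "a = 0")
    case True
    have "eventually (\<lambda>r. r > (0::real)) (at_right 0)" by (rule eventually_at_right_less)
    with pCons.IH show ?thesis
    proof eventually_elim
      case (elim r)
      have s: "sg r = 1" "sg (Tm 1) = 1" using elim(2) Tm_pos[of 1] by simp_all
      have "sg (poly (pCons a u) r) = sg (r * poly u r)" by (simp add: True)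
      also have "\<dots> = sg (Tm 1 * poly (map_poly of_real u) (Tm 1))" by (simp only: sg_mult s elim(1))
      also have "\<dots> = sg (poly (map_poly of_real (pCons a u)) (Tm 1))" unfolding P by (simp add: True)
      finally show ?case .
    qed
  next
    case False
    have "fin (poly (map_poly of_real u) (Tm 1))"
      by (rule fin_poly(1)) (simp_all add: coeff_map_poly fin_Tm1)
    hence f: "fin (Tm 1 * poly (map_poly of_real u) (Tm 1))" "st (Tm 1 * poly (map_poly of_real u) (Tm 1)) = 0"
      by (simp_all add: fin_mult fin_Tm1 st_mult)
    have "sg (poly (map_poly of_real (pCons a u)) (Tm 1)) = sg a"
      unfolding P by (subst sg_eq_if_st) (use f False in \<open>simp_all add: fin_add\<close>)
    moreover have "eventually (\<lambda>r. sg (poly (pCons a u) r) = sg a) (at_right 0)"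
    proof -
      have lim: "(poly (pCons a u) \<longlongrightarrow> poly (pCons a u) 0) (at_right 0)"
        by (intro tendsto_intros)
      show ?thesis
      proof (cases "a > 0")
        case True
        have "eventually (\<lambda>r. poly (pCons a u) r > 0) (at_right 0)"
          by (rule order_tendstoD(1)[OF lim]) (use True in simp)
        thus ?thesis by eventually_elim (use True in \<open>simp add: sg_def\<close>)
      next
        case a: False
        have "eventually (\<lambda>r. poly (pCons a u) r < 0) (at_right 0)"
          by (rule order_tendstoD(2)[OF lim]) (use a False in simp)
        thus ?thesis by eventually_elim (use a False in \<open>simp add: sg_def\<close>)
      qed
    qed
    ultimately show ?thesis by simp
  qed
qed simp

lemma peval_update: "peval p (x(s := r)) =
    poly (upoly (ucoef (map_rpoly (\<lambda>w. if w = s then None else Some w) p)) x) r"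
proof -
  have "(\<lambda>w. case_option r x (if w = s then None else Some w)) = x(s := r)" by auto
  thus ?thesis by (simp add: poly_upoly_ucoef peval_map)
qed

lemma upoly_of_real: "upoly cs (\<lambda>v. of_real (x v)) = map_poly of_real (upoly cs x)"
  by (induction cs) (simp_all add: map_poly_pCons peval_of_real)

text \<open>All parameters other than \<open>s\<close> are real, so the quantifier-free equivalent
  only depends on the signs of finitely many real polynomials in \<open>s\<close>.\<close>

theorem sat_infinitesimal:
  fixes x :: "'v \<Rightarrow> real"
  assumes "sat f ((\<lambda>v. of_real (x v))(s := Tm 1))"
  shows "eventually (\<lambda>r. sat f (x(s := r))) (at_right 0)"
proof -
  obtain g where g: "\<And>x::'v \<Rightarrow> real. holds g x \<longleftrightarrow> sat f x" "\<And>y::'v \<Rightarrow> pui. holds g y \<longleftrightarrow> sat f y"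
    using fo_quantifier_elimination[of f, where 'a = real and 'b = pui] by blast
  have "eventually (\<lambda>r. sg (peval p (x(s := r))) = sg (peval p ((\<lambda>v. of_real (x v))(s := Tm 1)))) (at_right 0)" for p
    unfolding peval_update upoly_of_real by (rule sg_poly_infinitesimal)
  hence "eventually (\<lambda>r. \<forall>p\<in>fpolys g. sg (peval p (x(s := r))) = sg (peval p ((\<lambda>v. of_real (x v))(s := Tm 1)))) (at_right 0)"
    by (intro eventually_ball_finite finite_fpolys) blast
  thus ?thesis
  proof eventually_elim
    case (elim r)
    hence "holds g (x(s := r)) \<longleftrightarrow> holds g ((\<lambda>v. of_real (x v))(s := Tm 1))"
      by (intro holds_cong_signs) blast
    thus ?case using assms g by blast
  qed
qed

section \<open>Bounded continuous semialgebraic functions and their extensions\<close>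

text \<open>Some defining formula, chosen once; by \<open>ext_F1_iff\<close> the extension does not
  depend on the choice.\<close>

definition mf :: "(real^'m) set \<Rightarrow> 'm sfml" where
  "mf M = (SOME \<Phi>. coords ` M = {z. holds_r \<Phi> z})"

definition gf :: "(real^'m) set \<Rightarrow> (real^'m \<Rightarrow> real) \<Rightarrow> 'm option sfml" where
  "gf M f = (SOME \<Phi>. graph_on M f = {z. holds_r \<Phi> z})"

lemma mf: "semialg_set M \<Longrightarrow> coords ` M = {z. holds_r (mf M) z}"
  unfolding semialg_set_def semialg_def mf_def by (rule someI_ex)

lemma gf: "semialg (graph_on M f) \<Longrightarrow> graph_on M f = {z. holds_r (gf M f) z}"
  unfolding semialg_def gf_def by (rule someI_ex)

lemma coords_vec_lambda [simp]: "coords (vec_lambda u) = u"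
  by (simp add: coords_def)

lemma vec_lambda_coords [simp]: "vec_lambda (coords x) = x"
  by (simp add: coords_def)

lemma holds_mf: "semialg_set M \<Longrightarrow> holds (mf M) u \<longleftrightarrow> vec_lambda u \<in> M"
proof -
  assume "semialg_set M"
  hence "holds (mf M) u \<longleftrightarrow> u \<in> coords ` M" using mf[of M] by (simp add: holds_real)
  also have "\<dots> \<longleftrightarrow> vec_lambda u \<in> M"
    by (metis coords_vec_lambda image_iff vec_lambda_coords)
  finally show ?thesis .
qed

lemma case_option_in_graph_on:
  "case_option y u \<in> graph_on M f \<longleftrightarrow> vec_lambda u \<in> M \<and> y = f (vec_lambda u)"
proof
  assume "case_option y u \<in> graph_on M f"
  then obtain x where x: "x \<in> M" "case_option y u = (\<lambda>v. case v of None \<Rightarrow> f x | Some i \<Rightarrow> x $ i)"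
    by (auto simp: graph_on_def)
  have "u i = x $ i" for i using fun_cong[OF x(2), of "Some i"] by simp
  hence "vec_lambda u = x" by (simp add: vec_eq_iff)
  moreover have "y = f x" using fun_cong[OF x(2), of None] by simp
  ultimately show "vec_lambda u \<in> M \<and> y = f (vec_lambda u)" using x by simp
next
  assume *: "vec_lambda u \<in> M \<and> y = f (vec_lambda u)"
  have "case_option y u = (\<lambda>v. case v of None \<Rightarrow> f (vec_lambda u) | Some i \<Rightarrow> vec_lambda u $ i)"
    using * by (auto simp: fun_eq_iff split: option.split)
  thus "case_option y u \<in> graph_on M f" using * unfolding graph_on_def by blast
qed

lemma holds_gf:
  assumes "semialg (graph_on M f)"
  shows "holds (gf M f) (case_option y u) \<longleftrightarrow> vec_lambda u \<in> M \<and> y = f (vec_lambda u)"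
  using gf[OF assms] unfolding holds_real case_option_in_graph_on[symmetric] by simp

text \<open>Formulas over the variables \<^typ>\<open>nat \<times> 'm option\<close>: \<^term>\<open>(k, Some i)\<close> is the
  \<^term>\<open>i\<close>-th coordinate of the \<^term>\<open>k\<close>-th vector, \<^term>\<open>(k, None)\<close> the \<^term>\<open>k\<close>-th scalar.\<close>
abbreviation vv :: "(nat \<times> 'm option \<Rightarrow> 'a) \<Rightarrow> nat \<Rightarrow> 'm \<Rightarrow> 'a" where
  "vv x k \<equiv> \<lambda>i. x (k, Some i)"

definition Inn :: "(real^'m) set \<Rightarrow> nat \<Rightarrow> (nat \<times> 'm option) fo" where
  "Inn M k = Qf (map_sfml (\<lambda>i. (k, Some i)) (mf M))"

definition Gr :: "(real^'m) set \<Rightarrow> (real^'m \<Rightarrow> real) \<Rightarrow> nat \<Rightarrow> nat \<Rightarrow> (nat \<times> 'm option) fo" where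
  "Gr M f k j = Qf (map_sfml (\<lambda>v. case v of None \<Rightarrow> (j, None) | Some i \<Rightarrow> (k, Some i)) (gf M f))"

lemma sat_Inn [simp]: "sat (Inn M k) x \<longleftrightarrow> holds (mf M) (vv x k)"
  by (simp add: Inn_def holds_map)

lemma sat_Gr [simp]: "sat (Gr M f k j) x \<longleftrightarrow> holds (gf M f) (case_option (x (j, None)) (vv x k))"
proof -
  have "(\<lambda>v. x (case v of None \<Rightarrow> (j, None) | Some i \<Rightarrow> (k, Some i))) = case_option (x (j, None)) (vv x k)"
    by (auto simp: fun_eq_iff split: option.split)
  thus ?thesis by (simp add: Gr_def holds_map)
qed

definition SVar :: "nat \<Rightarrow> (nat \<times> 'm option) rpoly" where "SVar k = PVar (k, None)"
definition VVar :: "nat \<Rightarrow> 'm \<Rightarrow> (nat \<times> 'm option) rpoly" where "VVar k i = PVar (k, Some i)"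

lemma peval_vars [simp]: "peval (SVar k) x = x (k, None)" "peval (VVar k i) x = x (k, Some i)"
  by (simp_all add: SVar_def VVar_def)

lemma semialg_if_fo:
  fixes f :: "'v fo"
  assumes "\<And>x. x \<in> S \<longleftrightarrow> sat f x"
  shows "semialg S"
proof -
  obtain g where g: "\<And>x::'v \<Rightarrow> real. holds g x \<longleftrightarrow> sat f x"
    using fo_quantifier_elimination[of f, where 'a = real and 'b = real] by blast
  have "S = {x. holds_r g x}" using g assms by (auto simp: holds_real)
  thus ?thesis unfolding semialg_def by blast
qed

lemma semialg_graph_if_fo:
  fixes M :: "(real^'m) set" and \<phi> :: "(nat \<times> 'm option) fo"
  assumes "\<And>x :: nat \<times> 'm option \<Rightarrow> real.
    sat \<phi> x \<longleftrightarrow> vec_lambda (vv x 0) \<in> M \<and> x (0, None) = F (vec_lambda (vv x 0))"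
  shows "semialg (graph_on M F)"
proof -
  obtain g where g: "\<And>x::nat \<times> 'm option \<Rightarrow> real. holds g x \<longleftrightarrow> sat \<phi> x"
    using fo_quantifier_elimination[of \<phi>, where 'a = real and 'b = real] by blast
  show ?thesis
  \<comment> \<open>\<open>semialg\<close> of the graph wants variables of type
    \<open>'m option\<close>. The map \<open>snd\<close> merges all blocks into one, which is sound
    because the condition only reads block 0.\<close>
  proof (rule semialg_if_fo[of _ "Qf (map_sfml snd g)"])
    fix z :: "'m option \<Rightarrow> real"
    have "z = case_option (z None) (\<lambda>i. z (Some i))" by (auto simp: fun_eq_iff split: option.split)
    hence "z \<in> graph_on M F \<longleftrightarrow> vec_lambda (\<lambda>i. z (Some i)) \<in> M \<and> z None = F (vec_lambda (\<lambda>i. z (Some i)))"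
      using case_option_in_graph_on[of "z None" "\<lambda>i. z (Some i)" M F] by simp
    also have "\<dots> \<longleftrightarrow> sat \<phi> (\<lambda>v. z (snd v))" using assms[of "\<lambda>v. z (snd v)"] by simp
    finally show "z \<in> graph_on M F \<longleftrightarrow> sat (Qf (map_sfml snd g)) z" by (simp add: holds_map g)
  qed
qed

lemma SstarD:
  assumes "f \<in> Sstar M"
  shows "continuous_on M f" "bounded (f ` M)" "semialg (graph_on M f)" "x \<notin> M \<Longrightarrow> f x = 0"
  using assms by (auto simp: Sstar_def)

text \<open>A function defined from two semialgebraic ones by a first-order formula in which the scalars
  0, 1, 2 stand for its value and those of the given functions.\<close>
lemma semialg_graph_binary:
  fixes M :: "(real^'m) set" and R :: "(nat \<times> 'm option) fo"
  assumes M: "semialg_set M" and f: "semialg (graph_on M f)" and g: "semialg (graph_on M g)"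
    and R: "\<And>x :: nat \<times> 'm option \<Rightarrow> real. vec_lambda (vv x 0) \<in> M \<Longrightarrow>
      x (1, None) = f (vec_lambda (vv x 0)) \<Longrightarrow> x (2, None) = g (vec_lambda (vv x 0)) \<Longrightarrow>
      sat R x \<longleftrightarrow> x (0, None) = F (vec_lambda (vv x 0))"
  shows "semialg (graph_on M F)"
proof -
  let ?R = "Ex (1, None) (Ex (2, None) (Conj (Gr M f 0 1) (Conj (Gr M g 0 2) R)))"
  have "sat ?R x \<longleftrightarrow> vec_lambda (vv x 0) \<in> M \<and> x (0, None) = F (vec_lambda (vv x 0))" for x
  proof -
    let ?u = "vec_lambda (vv x 0) :: real^'m"
    let ?x = "x((1, None) := f ?u, (2, None) := g ?u)"
    have "sat ?R x \<longleftrightarrow> ?u \<in> M \<and> sat R ?x" by (auto simp: holds_gf[OF f] holds_gf[OF g])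
    thus ?thesis using R[of ?x] by auto
  qed
  thus ?thesis by (rule semialg_graph_if_fo)
qed

lemma semialg_graph_const:
  assumes "semialg_set M" "\<And>x. x \<in> M \<Longrightarrow> f x = c"
  shows "semialg (graph_on M f)"
  by (rule semialg_graph_if_fo[of "Conj (Inn M 0) (Eq (SVar 0) (PConst c))"])
    (use assms in \<open>auto simp: holds_mf\<close>)

section \<open>Constants, sums and products in \<open>Sstar\<close>\<close>

definition cst :: "(real^'m) set \<Rightarrow> real \<Rightarrow> real^'m \<Rightarrow> real" where
  "cst M c x = (if x \<in> M then c else 0)"

lemma Sstar_cst:
  assumes "semialg_set M"
  shows "cst M c \<in> Sstar M"
proof -
  have "continuous_on M (cst M c)"
    using continuous_on_cong[of M M "cst M c" "\<lambda>_. c"] by (simp add: cst_def)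
  moreover have "bounded (cst M c ` M)"
    by (rule bounded_subset[of "{c}"]) (auto simp: cst_def)
  moreover have "semialg (graph_on M (cst M c))"
    by (rule semialg_graph_const[OF assms]) (simp add: cst_def)
  ultimately show ?thesis by (simp add: Sstar_def cst_def)
qed

lemma Sstar_add:
  assumes M: "semialg_set M" and f: "f \<in> Sstar M" and g: "g \<in> Sstar M"
  shows "(\<lambda>x. f x + g x) \<in> Sstar M"
proof -
  have "semialg (graph_on M (\<lambda>x. f x + g x))"
    by (rule semialg_graph_binary[OF M SstarD(3)[OF f] SstarD(3)[OF g],
          of "Eq (SVar 0) (PAdd (SVar 1) (SVar 2))"]) simp
  thus ?thesis using SstarD[OF f] SstarD[OF g]
    by (auto simp: Sstar_def intro!: continuous_intros bounded_plus_comp)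
qed

lemma Sstar_mult:
  assumes M: "semialg_set M" and f: "f \<in> Sstar M" and g: "g \<in> Sstar M"
  shows "(\<lambda>x. f x * g x) \<in> Sstar M"
proof -
  have "semialg (graph_on M (\<lambda>x. f x * g x))"
    by (rule semialg_graph_binary[OF M SstarD(3)[OF f] SstarD(3)[OF g],
          of "Eq (SVar 0) (PMul (SVar 1) (SVar 2))"]) simp
  moreover obtain B C where BC: "\<And>x. x \<in> M \<Longrightarrow> norm (f x) \<le> B" "\<And>x. x \<in> M \<Longrightarrow> norm (g x) \<le> C"
    using SstarD(2)[OF f] SstarD(2)[OF g] unfolding bounded_iff by blast
  have "norm (f x * g x) \<le> B * C" if "x \<in> M" for x
    unfolding norm_mult by (intro mult_mono' BC that norm_ge_zero)
  hence "bounded ((\<lambda>x. f x * g x) ` M)" by (intro boundedI[of _ "B * C"]) blast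
  ultimately show ?thesis using SstarD[OF f] SstarD[OF g]
    by (auto simp: Sstar_def intro!: continuous_intros)
qed

section \<open>Extending functions to Puiseux points\<close>

definition fext :: "(real^'m) set \<Rightarrow> (real^'m \<Rightarrow> real) \<Rightarrow> ('m \<Rightarrow> pui) \<Rightarrow> pui" where
  "fext M f u = (THE y. holds (gf M f) (case_option y u))"

text \<open>That a formula describes the graph of a function on \<open>M\<close> amounts to three
  first-order statements (it lies over \<open>M\<close>, is total, is single-valued), and each of
  them transfers.\<close>

lemma holds_gf_pui:
  fixes M :: "(real^'m) set" and u :: "'m \<Rightarrow> pui"
  assumes M: "semialg_set M" and f: "semialg (graph_on M f)"
  shows "holds (gf M f) (case_option y u) \<longleftrightarrow> holds (mf M) u \<and> y = fext M f u"
proof -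
  have A: "sat (Imp (Gr M f 0 0) (Inn M 0)) x" "sat (Imp (Inn M 0) (Ex (0, None) (Gr M f 0 0))) x"
    "sat (Imp (Conj (Gr M f 0 0) (Gr M f 0 1)) (Eq (SVar 0) (SVar 1))) x"
    for x :: "nat \<times> 'm option \<Rightarrow> real"
    by (auto simp: holds_gf[OF f] holds_mf[OF M])
  define as where "as a b = (\<lambda>(k :: nat, v). case v of None \<Rightarrow> if k = 0 then a else b | Some i \<Rightarrow> u i)" for a b
  have as: "vv (as a b) k = u" "as a b (0, None) = a" "as a b (Suc 0, None) = b" for a b k
    by (simp_all add: as_def)
  have 1: "holds (gf M f) (case_option y u) \<Longrightarrow> holds (mf M) u" for y
    using transfer_to_pui[OF A(1), of "as y y"] by (simp add: as)
  have 2: "holds (mf M) u \<Longrightarrow> \<exists>y. holds (gf M f) (case_option y u)"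
    using transfer_to_pui[OF A(2), of "as 0 0"] by (simp add: as)
  have 3: "holds (gf M f) (case_option y u) \<Longrightarrow> holds (gf M f) (case_option z u) \<Longrightarrow> y = z" for y z
    using transfer_to_pui[OF A(3), of "as y z"] by (simp add: as)
  have "holds (mf M) u \<Longrightarrow> holds (gf M f) (case_option (fext M f u) u)"
    unfolding fext_def by (rule theI') (use 2 3 in blast)
  thus ?thesis using 1 3 by blast
qed

text \<open>The assumption that scalar \<open>k\<close> is the value of \<open>fs k\<close> at
  vector 0 is itself a formula, so the implication \<open>?R\<close> transfers as a whole.\<close>

lemma fext_transfer:
  fixes M :: "(real^'m) set" and R :: "(nat \<times> 'm option) fo"
  assumes M: "semialg_set M" and f: "\<And>k. k < n \<Longrightarrow> semialg (graph_on M (fs k))"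
    and R: "\<And>x :: nat \<times> 'm option \<Rightarrow> real. vec_lambda (vv x 0) \<in> M \<Longrightarrow>
      (\<And>k. k < n \<Longrightarrow> x (k, None) = fs k (vec_lambda (vv x 0))) \<Longrightarrow> sat R x"
    and x: "holds (mf M) (vv x 0)" "\<And>k. k < n \<Longrightarrow> x (k, None) = fext M (fs k) (vv x 0)"
  shows "sat R (x :: nat \<times> 'm option \<Rightarrow> pui)"
proof -
  let ?R = "Imp (Conj (Inn M 0) (ConjL (map (\<lambda>k. Gr M (fs k) 0 k) [0..<n]))) R"
  have "sat ?R x" for x :: "nat \<times> 'm option \<Rightarrow> real"
    using R[of x] by (simp add: holds_mf[OF M] holds_gf[OF f])
  hence "sat ?R x" by (rule transfer_to_pui)
  thus ?thesis using x by (simp add: holds_gf_pui[OF M f])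
qed

text \<open>A leading term with negative exponent outweighs every real constant.\<close>

lemma fin_if_bounded:
  assumes "\<bar>a\<bar> \<le> of_real C"
  shows "fin a"
proof (rule ccontr)
  assume nf: "\<not> fin a"
  have pos: "fin b" if "b > 0" "b \<le> of_real C" for b :: pui
  proof (rule ccontr)
    assume "\<not> fin b"
    hence v: "b \<noteq> 0" "val b < 0" by (auto simp: fin_iff_val)
    have "b - of_real C > 0"
    proof (rule pui_posI)
      show "cf (b - of_real C) (val b) > 0"
        using v \<open>b > 0\<close> by (simp add: cf_diff cf_of_real ps_const_def pui_pos_iff_val)
      show "cf (b - of_real C) p = 0" if "p < val b" for p
        using that v by (simp add: cf_diff cf_of_real ps_const_def cf_less_val)
    qed
    thus False using \<open>b \<le> of_real C\<close> by simp
  qed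
  have "a \<noteq> 0" using nf by auto
  hence "fin \<bar>a\<bar>" using pos[of "\<bar>a\<bar>"] assms by simp
  hence "fin a" using fin_uminus[of "- a"] by (auto simp: abs_if split: if_splits)
  thus False using nf by blast
qed

lemma fin_fext:
  fixes M :: "(real^'m) set" and u :: "'m \<Rightarrow> pui"
  assumes M: "semialg_set M" and f: "f \<in> Sstar M" and u: "holds (mf M) u"
  shows "fin (fext M f u)"
proof -
  obtain C where C: "\<And>x. x \<in> M \<Longrightarrow> norm (f x) \<le> C"
    using SstarD(2)[OF f] unfolding bounded_iff by blast
  define as where "as = (\<lambda>(k :: nat, v). case v of None \<Rightarrow> fext M f u | Some i \<Rightarrow> u i)"
  have "sat (Conj (Le (SVar 0) (PConst C)) (Le (PNeg (SVar 0)) (PConst C))) as"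
  proof (rule fext_transfer[OF M, where fs = "\<lambda>_. f" and n = 1])
    fix x :: "nat \<times> 'm option \<Rightarrow> real"
    assume "vec_lambda (vv x 0) \<in> M" "\<And>k. k < 1 \<Longrightarrow> x (k, None) = f (vec_lambda (vv x 0))"
    thus "sat (Conj (Le (SVar 0) (PConst C)) (Le (PNeg (SVar 0)) (PConst C))) x"
      using C[of "vec_lambda (vv x 0)"] by (simp add: abs_le_iff)
  qed (use u SstarD(3)[OF f] in \<open>simp_all add: as_def\<close>)
  thus ?thesis by (intro fin_if_bounded[of _ C]) (simp add: as_def abs_le_iff)
qed

lemma fext_add:
  fixes M :: "(real^'m) set" and u :: "'m \<Rightarrow> pui"
  assumes M: "semialg_set M" and f: "f \<in> Sstar M" and g: "g \<in> Sstar M" and u: "holds (mf M) u"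
  shows "fext M (\<lambda>x. f x + g x) u = fext M f u + fext M g u"
    and "fext M (\<lambda>x. f x * g x) u = fext M f u * fext M g u"
proof -
  have "fext M h u = peval p as"
    if h: "h \<in> Sstar M" and as: "as = (\<lambda>(k :: nat, v). case v of None \<Rightarrow> fext M ([h, f, g] ! k) u | Some i \<Rightarrow> u i)"
      and p: "\<And>x :: nat \<times> 'm option \<Rightarrow> real. h (vec_lambda (vv x 0)) = peval p
        (x((1, None) := f (vec_lambda (vv x 0)), (2, None) := g (vec_lambda (vv x 0))))"
    for h p as
  proof -
    have "sat (Eq (SVar 0) p) as"
    proof (rule fext_transfer[OF M, where fs = "\<lambda>k. [h, f, g] ! k" and n = 3])
      show "semialg (graph_on M ([h, f, g] ! k))" if "k < 3" for k
        using that h f g by (auto simp: less_Suc_eq numeral_3_eq_3 SstarD)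
      fix x :: "nat \<times> 'm option \<Rightarrow> real"
      assume "\<And>k. k < 3 \<Longrightarrow> x (k, None) = ([h, f, g] ! k) (vec_lambda (vv x 0))"
      from this[of 0] this[of 1] this[of 2]
      have "x (0, None) = h (vec_lambda (vv x 0))"
        "x((1, None) := f (vec_lambda (vv x 0)), (2, None) := g (vec_lambda (vv x 0))) = x"
        by auto
      thus "sat (Eq (SVar 0) p) x" using p[of x] by simp
    qed (simp_all add: as u)
    thus ?thesis by (simp add: as)
  qed
  note * = this[OF _ refl]
  show "fext M (\<lambda>x. f x + g x) u = fext M f u + fext M g u"
    using *[OF Sstar_add[OF M f g], of "PAdd (SVar 1) (SVar 2)"] by simp
  show "fext M (\<lambda>x. f x * g x) u = fext M f u * fext M g u"
    using *[OF Sstar_mult[OF M f g], of "PMul (SVar 1) (SVar 2)"] by simp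
qed

lemma fext_cst:
  fixes M :: "(real^'m) set" and u :: "'m \<Rightarrow> pui"
  assumes M: "semialg_set M" and u: "holds (mf M) u"
  shows "fext M (cst M c) u = of_real c"
proof -
  define as where "as = (\<lambda>(k :: nat, v). case v of None \<Rightarrow> fext M (cst M c) u | Some i \<Rightarrow> u i)"
  have "sat (Eq (SVar 0) (PConst c)) as"
  proof (rule fext_transfer[OF M, where fs = "\<lambda>_. cst M c" and n = 1])
    fix x :: "nat \<times> 'm option \<Rightarrow> real"
    assume "vec_lambda (vv x 0) \<in> M" "\<And>k. k < 1 \<Longrightarrow> x (k, None) = cst M c (vec_lambda (vv x 0))"
    thus "sat (Eq (SVar 0) (PConst c)) x" by (simp add: cst_def)
  qed (use u SstarD(3)[OF Sstar_cst[OF M]] in \<open>simp_all add: as_def\<close>)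
  thus ?thesis by (simp add: as_def)
qed

section \<open>Agreement with the given definitions of the extensions\<close>

lemma peval_ps_cf: "peval_ps p (\<lambda>v. cf (x v)) = cf (peval p x)"
proof (induction p)
  case (PAdd p q)
  thus ?case by (simp add: fun_eq_iff cf_add ps_add_def)
next
  case (PMul p q)
  thus ?case by (simp add: cf_mult)
next
  case (PNeg p)
  thus ?case by (simp add: fun_eq_iff cf_uminus ps_neg_def)
qed (simp_all add: cf_of_real)

lemma holds_ps_cf: "holds_ps f (\<lambda>v. cf (x v)) \<longleftrightarrow> holds f x"
proof (induction f)
  case (FZero p)
  have "cf a = ps_const 0 \<longleftrightarrow> a = 0" for a
    using cf_of_real[of 0] cf_inject[of a 0] by simp
  thus ?case by (simp add: peval_ps_cf)
qed (simp_all add: peval_ps_cf pui_pos_iff)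

text \<open>\<open>ext_F1\<close> admits any formula defining the set; such formulas are equivalent
  over the reals, and the implication between them transfers.\<close>

lemma ext_F1_iff:
  fixes f :: "'v sfml"
  assumes "S = {y. holds_r f y}"
  shows "z \<in> ext_F1 S \<longleftrightarrow> (\<exists>x. z = (\<lambda>v. cf (x v)) \<and> holds f x)"
proof
  assume "z \<in> ext_F1 S"
  then obtain g where z: "\<And>v. is_puiseux (z v)" and g: "S = {y. holds_r g y}" "holds_ps g z"
    by (auto simp: ext_F1_def)
  define x where "x v = Abs_pui (z v)" for v
  have zx: "z = (\<lambda>v. cf (x v))" using z by (simp add: x_def Abs_pui_inverse)
  have "sat (Imp (Qf g) (Qf f)) x"
    by (rule transfer_to_pui) (use assms g(1) in \<open>auto simp: holds_real\<close>)
  moreover have "holds g x" using g(2) unfolding zx holds_ps_cf .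
  ultimately show "\<exists>x. z = (\<lambda>v. cf (x v)) \<and> holds f x" using zx by auto
next
  assume "\<exists>x. z = (\<lambda>v. cf (x v)) \<and> holds f x"
  thus "z \<in> ext_F1 S" using assms is_puiseux_cf unfolding ext_F1_def by (auto simp: holds_ps_cf)
qed

definition pathF :: "('m \<Rightarrow> nat \<Rightarrow> real) \<Rightarrow> 'm \<Rightarrow> pui" where
  "pathF \<alpha> i = ser 1 (\<alpha> i)"

lemma cf_pathF: "cf (pathF \<alpha> i) = path_F1 \<alpha> i"
proof
  fix q
  show "cf (pathF \<alpha> i) q = path_F1 \<alpha> i q"
    by (auto simp: pathF_def ser_def cf_emb psemb_def path_F1_def fps_to_ps_def)
qed

lemma path_in_ext_iff:
  assumes "semialg_set M"
  shows "path_F1 \<alpha> \<in> ext_F1 (coords ` M) \<longleftrightarrow> holds (mf M) (pathF \<alpha>)"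
proof -
  have p: "path_F1 \<alpha> = (\<lambda>v. cf (pathF \<alpha> v))" by (simp add: cf_pathF)
  have "x = pathF \<alpha>" if "(\<lambda>v. cf (pathF \<alpha> v)) = (\<lambda>v. cf (x v))" for x
    using fun_cong[OF that] by (auto simp: cf_inject)
  thus ?thesis unfolding ext_F1_iff[OF mf[OF assms]] p by blast
qed

text \<open>The description in \<open>f_F1\<close> ranges over arbitrary coefficient functions;
  membership in the extension forces a Puiseux series, to which \<open>holds_gf_pui\<close>
  applies.\<close>

lemma f_F1_eq:
  assumes M: "semialg_set M" and f: "semialg (graph_on M f)" and u: "holds (mf M) (pathF \<alpha>)"
  shows "f_F1 M f \<alpha> = cf (fext M f (pathF \<alpha>))"
  unfolding f_F1_def
proof (rule the_equality)
  have eq: "(\<lambda>v. case v of None \<Rightarrow> cf y | Some i \<Rightarrow> path_F1 \<alpha> i) = (\<lambda>v. cf (case_option y (pathF \<alpha>) v))" for y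
    by (auto simp: fun_eq_iff cf_pathF split: option.split)
  show "(\<lambda>v. case v of None \<Rightarrow> cf (fext M f (pathF \<alpha>)) | Some i \<Rightarrow> path_F1 \<alpha> i) \<in> ext_F1 (graph_on M f)"
    unfolding ext_F1_iff[OF gf[OF f]] eq
    by (rule exI[of _ "case_option (fext M f (pathF \<alpha>)) (pathF \<alpha>)"]) (simp add: holds_gf_pui[OF M f] u)
  fix y assume "(\<lambda>v. case v of None \<Rightarrow> y | Some i \<Rightarrow> path_F1 \<alpha> i) \<in> ext_F1 (graph_on M f)"
  then obtain x where x: "(\<lambda>v. case v of None \<Rightarrow> y | Some i \<Rightarrow> path_F1 \<alpha> i) = (\<lambda>v. cf (x v))" "holds (gf M f) x"
    unfolding ext_F1_iff[OF gf[OF f]] by blast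
  have "cf (x (Some i)) = cf (pathF \<alpha> i)" for i using fun_cong[OF x(1), of "Some i"] by (simp add: cf_pathF)
  hence "x (Some i) = pathF \<alpha> i" for i by (simp only: cf_inject)
  hence "x = case_option (x None) (pathF \<alpha>)" by (auto simp: fun_eq_iff split: option.split)
  hence "holds (gf M f) (case_option (x None) (pathF \<alpha>))" using x(2) by simp
  hence "x None = fext M f (pathF \<alpha>)" by (simp add: holds_gf_pui[OF M f])
  thus "y = cf (fext M f (pathF \<alpha>))" using fun_cong[OF x(1), of None] by simp
qed

lemma mstar_path_eq:
  assumes M: "semialg_set M" and u: "holds (mf M) (pathF \<alpha>)"
  shows "mstar_path M \<alpha> = {f \<in> Sstar M. st (fext M f (pathF \<alpha>)) = 0}"
  unfolding mstar_path_def st_def using f_F1_eq[OF M SstarD(3) u] by auto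

lemma mstar_path_in_betaS:
  assumes M: "semialg_set M" and u: "holds (mf M) (pathF \<alpha>)"
  shows "mstar_path M \<alpha> \<in> betaS M"
proof -
  define \<phi> where "\<phi> f = st (fext M f (pathF \<alpha>))" for f
  let ?p = "mstar_path M \<alpha>"
  have p: "?p = {f \<in> Sstar M. \<phi> f = 0}" unfolding \<phi>_def by (rule mstar_path_eq[OF M u])
  have add: "\<phi> (\<lambda>x. f x + g x) = \<phi> f + \<phi> g" and mult: "\<phi> (\<lambda>x. f x * g x) = \<phi> f * \<phi> g"
    if "f \<in> Sstar M" "g \<in> Sstar M" for f g
    using that by (simp_all add: \<phi>_def fext_add[OF M _ _ u] st_mult fin_fext[OF M _ u])
  have cst: "\<phi> (cst M c) = c" for c by (simp add: \<phi>_def fext_cst[OF M u])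
  have zero: "(\<lambda>x. 0) = cst M 0" by (simp add: cst_def fun_eq_iff)
  have inp: "f \<in> ?p \<longleftrightarrow> f \<in> Sstar M \<and> \<phi> f = 0" for f unfolding p by blast
  have "is_ideal M ?p"
    unfolding is_ideal_def
  proof (intro conjI ballI)
    show "?p \<subseteq> Sstar M" unfolding p by blast
    show "(\<lambda>x. 0) \<in> ?p" unfolding inp zero using Sstar_cst[OF M] cst by blast
    show "(\<lambda>x. f x + g x) \<in> ?p" if "f \<in> ?p" "g \<in> ?p" for f g
      using that unfolding inp by (simp add: Sstar_add[OF M] add)
    show "(\<lambda>x. g x * f x) \<in> ?p" if "f \<in> ?p" "g \<in> Sstar M" for f g
      using that unfolding inp by (simp add: Sstar_mult[OF M] mult)
  qed
  moreover have "cst M 1 \<notin> ?p" unfolding inp cst by simp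
  hence "?p \<noteq> Sstar M" using Sstar_cst[OF M] by blast
  moreover have "J = ?p \<or> J = Sstar M" if J: "is_ideal M J" "?p \<subseteq> J" for J
  proof (cases "J = ?p")
    case False
    have JS: "J \<subseteq> Sstar M" using J(1) by (simp add: is_ideal_def)
    then obtain f where f: "f \<in> J" "f \<in> Sstar M" "\<phi> f \<noteq> 0" using False J(2) unfolding p by blast
    let ?c = "\<phi> f"
    have Jadd: "(\<lambda>x. a x + b x) \<in> J" if "a \<in> J" "b \<in> J" for a b
      using J(1) that unfolding is_ideal_def by blast
    have Jmult: "(\<lambda>x. b x * a x) \<in> J" if "a \<in> J" "b \<in> Sstar M" for a b
      using J(1) that unfolding is_ideal_def by blast
    \<comment> \<open>Subtracting the constant \<open>?c\<close> from \<open>f\<close> gives an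
      element of the kernel, hence of \<open>J\<close>. So \<open>J\<close> contains a nonzero
      constant, which is a unit.\<close>
    have "(\<lambda>x. cst M (- 1) x * f x) \<in> J" by (rule Jmult[OF f(1) Sstar_cst[OF M]])
    moreover have "(\<lambda>x. f x + cst M (- ?c) x) \<in> ?p"
      unfolding inp add[OF f(2) Sstar_cst[OF M]] cst
      using Sstar_add[OF M f(2) Sstar_cst[OF M]] by simp
    hence "(\<lambda>x. f x + cst M (- ?c) x) \<in> J" using J(2) by blast
    ultimately have "(\<lambda>x. cst M (- 1) x * f x + (f x + cst M (- ?c) x)) \<in> J" by (rule Jadd)
    moreover have "(\<lambda>x. cst M (- 1) x * f x + (f x + cst M (- ?c) x)) = cst M (- ?c)"
      using SstarD(4)[OF f(2)] by (auto simp: fun_eq_iff cst_def)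
    ultimately have c: "cst M (- ?c) \<in> J" by simp
    have "g \<in> J" if g: "g \<in> Sstar M" for g
    proof -
      have "(\<lambda>x. (g x * cst M (- 1 / ?c) x) * cst M (- ?c) x) \<in> J"
        by (rule Jmult[OF c Sstar_mult[OF M g Sstar_cst[OF M]]])
      moreover have "(\<lambda>x. (g x * cst M (- 1 / ?c) x) * cst M (- ?c) x) = g"
        using SstarD(4)[OF g] f(3) by (auto simp: fun_eq_iff cst_def)
      ultimately show ?thesis by simp
    qed
    thus ?thesis using JS by blast
  qed simp
  ultimately show ?thesis unfolding betaS_def is_max_ideal_def by blast
qed

section \<open>Bump functions along a formal path\<close>

text \<open>\<open>PSum\<close> takes a list, so sums over the index type need a fixed enumeration
  of it.\<close>

definition ilist :: "'m::finite list" where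
  "ilist = (SOME xs. set xs = UNIV \<and> distinct xs)"

lemma ilist: "set (ilist :: 'm::finite list) = UNIV" "distinct (ilist :: 'm list)"
proof -
  have "\<exists>xs :: 'm list. set xs = UNIV \<and> distinct xs" by (rule finite_distinct_list) simp
  hence "set (ilist :: 'm list) = UNIV \<and> distinct (ilist :: 'm list)" unfolding ilist_def by (rule someI_ex)
  thus "set (ilist :: 'm list) = UNIV" "distinct (ilist :: 'm list)" by auto
qed

lemma sum_list_ilist: "(\<Sum>i\<leftarrow>ilist. f i) = (\<Sum>i\<in>UNIV. f i)"
  unfolding ilist(1)[symmetric] by (rule sum_list_distinct_conv_sum_set[OF ilist(2)])

text \<open>Polymorphic in the field, because it is used at real parameters and at
  \<open>Tm 1\<close>.\<close>

definition tr :: "('m \<Rightarrow> nat \<Rightarrow> real) \<Rightarrow> nat \<Rightarrow> 'a::rcf \<Rightarrow> 'm \<Rightarrow> 'a" where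
  "tr \<alpha> N s i = (\<Sum>l\<le>N. of_real (\<alpha> i l) * s ^ l)"

text \<open>Squared distance: polynomial in the coordinates and meaningful in both fields.\<close>

definition sqd :: "('m::finite \<Rightarrow> 'a::rcf) \<Rightarrow> ('m \<Rightarrow> 'a) \<Rightarrow> 'a" where
  "sqd x y = (\<Sum>i\<in>UNIV. (x i - y i)\<^sup>2)"

definition Tp :: "('m \<Rightarrow> nat \<Rightarrow> real) \<Rightarrow> nat \<Rightarrow> (nat \<times> 'm option) rpoly \<Rightarrow> 'm \<Rightarrow> (nat \<times> 'm option) rpoly" where
  "Tp \<alpha> N v i = PSum (map (\<lambda>l. PMul (PConst (\<alpha> i l)) (PPow v l)) [0..<Suc N])"

definition Sq :: "nat \<Rightarrow> ('m::finite \<Rightarrow> (nat \<times> 'm option) rpoly) \<Rightarrow> (nat \<times> 'm option) rpoly" where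
  "Sq k p = PSum (map (\<lambda>i. PPow (PSub (VVar k i) (p i)) 2) ilist)"

lemma peval_Tp [simp]: "peval (Tp \<alpha> N v i) x = tr \<alpha> N (peval v x) i"
  unfolding Tp_def tr_def peval_PSum map_map comp_def
  by (subst sum_list_distinct_conv_sum_set) (simp_all add: atLeast0LessThan lessThan_Suc_atMost del: upt_Suc)

lemma peval_Sq [simp]: "peval (Sq k p) x = sqd (vv x k) (\<lambda>i. peval (p i) x)"
  by (simp add: Sq_def sqd_def comp_def sum_list_ilist)

lemma sqd_real: "sqd x y = (norm (vec_lambda x - vec_lambda y :: real^'m::finite))\<^sup>2"
  by (simp only: sqd_def power2_norm_eq_inner inner_vec_def) (simp add: power2_eq_square)

definition tpath :: "('m::finite \<Rightarrow> nat \<Rightarrow> real) \<Rightarrow> nat \<Rightarrow> real \<Rightarrow> real^'m" where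
  "tpath \<alpha> N s = vec_lambda (tr \<alpha> N s)"

lemma tpath_0: "tpath \<alpha> N 0 = path_origin \<alpha>"
proof -
  have "tr \<alpha> N (0 :: real) i = \<alpha> i 0" for i
    unfolding tr_def by (subst sum.remove[of _ 0]) (auto simp: power_0_left)
  thus ?thesis by (simp add: tpath_def path_origin_def vec_eq_iff)
qed

lemma continuous_on_tpath: "continuous_on S (tpath \<alpha> N)"
  unfolding tpath_def[abs_def] tr_def[abs_def] by (intro continuous_intros)

text \<open>For s > 0, a cone of height 1 over the ball of radius s^N, cut off at 0.\<close>

definition bterm :: "('m::finite \<Rightarrow> nat \<Rightarrow> real) \<Rightarrow> nat \<Rightarrow> real^'m \<Rightarrow> real \<Rightarrow> real" where
  "bterm \<alpha> N x s = max 0 (1 - norm (x - tpath \<alpha> N s) / s ^ N)"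

text \<open>A bump function along the truncated path: it is 1 on the path and lives on the union of the
  balls of radius \<^term>\<open>s ^ N\<close> around its points of parameter \<^term>\<open>s \<le> c\<close>.\<close>
definition bump :: "(real^'m) set \<Rightarrow> ('m::finite \<Rightarrow> nat \<Rightarrow> real) \<Rightarrow> nat \<Rightarrow> real \<Rightarrow> real^'m \<Rightarrow> real" where
  "bump M \<alpha> N c x = (if x \<in> M then (SUP s\<in>{0<..c}. bterm \<alpha> N x s) else 0)"

lemma bterm_bounds: "0 \<le> bterm \<alpha> N x s" "0 < s \<Longrightarrow> bterm \<alpha> N x s \<le> 1"
  by (simp_all add: bterm_def)

lemma bump_le_iff:
  assumes "x \<in> M" "c > 0"
  shows "bump M \<alpha> N c x \<le> y \<longleftrightarrow> (\<forall>s. 0 < s \<and> s \<le> c \<longrightarrow> bterm \<alpha> N x s \<le> y)"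
proof -
  have ne: "{0<..c} \<noteq> {}" using assms by auto
  have "bdd_above (bterm \<alpha> N x ` {0<..c})" by (rule bdd_aboveI[of _ 1]) (auto simp: bterm_bounds)
  from cSUP_le_iff[OF ne this, of y] show ?thesis using assms by (auto simp: bump_def)
qed

text \<open>Norm and quotient are cleared by squaring, legitimate for y < 1, so that the bound
  becomes polynomial and can enter the formula \<open>Ub\<close>.\<close>

lemma bterm_le_iff:
  assumes "s > 0"
  shows "bterm \<alpha> N x s \<le> y \<longleftrightarrow>
    0 \<le> y \<and> (1 \<le> y \<or> s ^ (2 * N) * (1 - y)\<^sup>2 \<le> sqd (coords x) (tr \<alpha> N s))"
proof -
  let ?n = "norm (x - tpath \<alpha> N s)"
  have sN: "s ^ N > 0" using assms by simp
  have d: "sqd (coords x) (tr \<alpha> N s) = ?n\<^sup>2" by (simp add: sqd_real tpath_def)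
  have "1 - ?n / s ^ N \<le> y \<longleftrightarrow> 1 \<le> y \<or> s ^ (2 * N) * (1 - y)\<^sup>2 \<le> ?n\<^sup>2"
  proof (cases "1 \<le> y")
    case True
    have "?n / s ^ N \<ge> 0" using sN by simp
    thus ?thesis using True by linarith
  next
    case False
    have "1 - ?n / s ^ N \<le> y \<longleftrightarrow> 1 - y \<le> ?n / s ^ N" by linarith
    also have "\<dots> \<longleftrightarrow> s ^ N * (1 - y) \<le> ?n" by (simp add: pos_le_divide_eq[OF sN] mult.commute)
    also have "\<dots> \<longleftrightarrow> (s ^ N * (1 - y))\<^sup>2 \<le> ?n\<^sup>2"
      using False sN by (intro power_mono_iff[symmetric]) auto
    also have "(s ^ N * (1 - y))\<^sup>2 = s ^ (2 * N) * (1 - y)\<^sup>2"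
      by (simp add: power_mult_distrib power_mult[symmetric] mult.commute)
    finally show ?thesis using False by simp
  qed
  thus ?thesis by (simp add: bterm_def d)
qed

text \<open>The scalar \<^term>\<open>k\<close> bounds the bump function at vector 0 from above.\<close>
definition Ub :: "('m::finite \<Rightarrow> nat \<Rightarrow> real) \<Rightarrow> nat \<Rightarrow> real \<Rightarrow> nat \<Rightarrow> (nat \<times> 'm option) fo" where
  "Ub \<alpha> N c k = All (3, None) (Imp (Conj (Lt (PConst 0) (SVar 3)) (Le (SVar 3) (PConst c)))
      (Conj (Le (PConst 0) (SVar k)) (Disj (Le (PConst 1) (SVar k))
        (Le (PMul (PPow (SVar 3) (2 * N)) (PPow (PSub (PConst 1) (SVar k)) 2)) (Sq 0 (Tp \<alpha> N (SVar 3)))))))"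

lemma sat_Ub:
  assumes "k \<noteq> 3" "c > 0" "vec_lambda (vv x 0) \<in> M"
  shows "sat (Ub \<alpha> N c k) x \<longleftrightarrow> bump M \<alpha> N c (vec_lambda (vv x 0)) \<le> x (k, None)"
  unfolding bump_le_iff[OF assms(3,2)] using assms(1)
  by (simp add: Ub_def bterm_le_iff)

text \<open>The supremum is definable as the least scalar that satisfies \<open>Ub\<close>.\<close>

lemma semialg_bump:
  assumes M: "semialg_set M" and "c > 0"
  shows "semialg (graph_on M (bump M \<alpha> N c))"
proof -
  let ?R = "Conj (Inn M 0) (Conj (Ub \<alpha> N c 0) (All (1, None) (Imp (Ub \<alpha> N c 1) (Le (SVar 0) (SVar 1)))))"
  have "sat ?R x \<longleftrightarrow> vec_lambda (vv x 0) \<in> M \<and> x (0, None) = bump M \<alpha> N c (vec_lambda (vv x 0))"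
    for x :: "nat \<times> 'a option \<Rightarrow> real"
  proof -
    let ?b = "bump M \<alpha> N c (vec_lambda (vv x 0))"
    have eq: "y = b \<longleftrightarrow> b \<le> y \<and> (\<forall>z. b \<le> z \<longrightarrow> y \<le> z)" for y b :: real by auto
    have "sat (Ub \<alpha> N c (Suc 0)) (x((Suc 0, None) := a)) \<longleftrightarrow> ?b \<le> a" if "vec_lambda (vv x 0) \<in> M" for a
      using sat_Ub[of "Suc 0" c "x((Suc 0, None) := a)" M \<alpha> N] that \<open>c > 0\<close> by simp
    thus ?thesis
      using eq[of "x (0, None)" ?b] sat_Ub[of 0 c x M \<alpha> N] \<open>c > 0\<close> by (auto simp: holds_mf[OF M])
  qed
  thus ?thesis by (rule semialg_graph_if_fo)
qed

text \<open>Terms with small s vanish near \<open>x0\<close>: there the path runs close to its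
  origin and its balls are small. All other terms share the Lipschitz constant 1 / s0^N, which the
  supremum inherits.\<close>

lemma bump_locally_lipschitz:
  assumes "c > 0" "N \<ge> 1" and x0: "x0 \<noteq> path_origin \<alpha>"
  shows "\<exists>\<rho>>0. \<exists>L>0. \<forall>x\<in>M. \<forall>x'\<in>M. dist x x0 < \<rho> \<longrightarrow> dist x' x0 < \<rho> \<longrightarrow>
    bump M \<alpha> N c x \<le> bump M \<alpha> N c x' + L * dist x x'"
proof -
  define \<eta> where "\<eta> = dist x0 (tpath \<alpha> N 0)"
  have \<eta>: "\<eta> > 0" using x0 by (simp add: \<eta>_def tpath_0)
  have "\<exists>d>0. \<forall>s. dist s 0 < d \<longrightarrow> dist (tpath \<alpha> N s) (tpath \<alpha> N 0) < \<eta> / 3"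
    using continuous_on_tpath[of UNIV \<alpha> N, unfolded continuous_on_iff] \<eta> by (metis UNIV_I divide_pos_pos zero_less_numeral)
  then obtain d where d: "d > 0" "\<And>s. dist s 0 < d \<Longrightarrow> dist (tpath \<alpha> N s) (tpath \<alpha> N 0) < \<eta> / 3" by blast
  \<comment> \<open>One third of \<eta> each goes to the distance from x to \<open>x0\<close>, to
    the drift of the path from its origin, and to the radius, for which s^N \<le> s < s0.\<close>
  define s0 where "s0 = min d (min 1 (\<eta> / 3))"
  have s0: "s0 > 0" "s0 \<le> d" "s0 \<le> 1" "s0 \<le> \<eta> / 3" using d \<eta> by (auto simp: s0_def)
  have "bump M \<alpha> N c x \<le> bump M \<alpha> N c x' + 1 / s0 ^ N * dist x x'"
    if M: "x \<in> M" "x' \<in> M" and x: "dist x x0 < \<eta> / 3" for x x'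
    unfolding bump_le_iff[OF M(1) \<open>c > 0\<close>]
  proof (intro allI impI)
    fix s assume s: "0 < s \<and> s \<le> c"
    have b: "bterm \<alpha> N x' s \<le> bump M \<alpha> N c x'"
      using bump_le_iff[OF M(2) \<open>c > 0\<close>, of \<alpha> N "bump M \<alpha> N c x'"] s by simp
    have L: "0 \<le> 1 / s0 ^ N * dist x x'" using s0 by simp
    show "bterm \<alpha> N x s \<le> bump M \<alpha> N c x' + 1 / s0 ^ N * dist x x'"
    proof (cases "s < s0")
      case True
      have "dist (tpath \<alpha> N s) (tpath \<alpha> N 0) < \<eta> / 3" using s True s0 by (intro d) simp
      moreover have "\<eta> \<le> dist x0 x + dist x (tpath \<alpha> N s) + dist (tpath \<alpha> N s) (tpath \<alpha> N 0)"
        unfolding \<eta>_def by metric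
      ultimately have "dist x (tpath \<alpha> N s) > \<eta> / 3" using x by (simp add: dist_commute)
      moreover have "s ^ N \<le> s ^ 1" using s True s0 \<open>N \<ge> 1\<close> by (intro power_decreasing) auto
      ultimately have "s ^ N \<le> norm (x - tpath \<alpha> N s)" using True s0 by (simp add: dist_norm)
      hence "bterm \<alpha> N x s = 0" using s by (simp add: bterm_def)
      thus ?thesis using b L bterm_bounds(1)[of \<alpha> N x' s] by linarith
    next
      case False
      have "norm (x' - tpath \<alpha> N s) \<le> norm (x - tpath \<alpha> N s) + dist x x'"
        unfolding dist_norm[symmetric] by metric
      hence "norm (x' - tpath \<alpha> N s) / s ^ N \<le> (norm (x - tpath \<alpha> N s) + dist x x') / s ^ N"
        using s by (intro divide_right_mono) auto
      moreover have "dist x x' / s ^ N \<le> dist x x' / s0 ^ N"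
        using s0 False by (intro divide_left_mono power_mono mult_pos_pos zero_less_power) auto
      ultimately have "1 - norm (x - tpath \<alpha> N s) / s ^ N \<le> 1 - norm (x' - tpath \<alpha> N s) / s ^ N + 1 / s0 ^ N * dist x x'"
        by (simp add: add_divide_distrib)
      hence "bterm \<alpha> N x s \<le> bterm \<alpha> N x' s + 1 / s0 ^ N * dist x x'"
        using L unfolding bterm_def by linarith
      thus ?thesis using b by linarith
    qed
  qed
  thus ?thesis using \<eta> s0 by (intro exI[of _ "\<eta> / 3"] conjI exI[of _ "1 / s0 ^ N"]) auto
qed

lemma Sstar_bump:
  assumes M: "semialg_set M" and "path_origin \<alpha> \<notin> M" "c > 0" "N \<ge> 1"
  shows "bump M \<alpha> N c \<in> Sstar M"
proof -
  have "continuous_on M (bump M \<alpha> N c)"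
    unfolding continuous_on_iff
  proof (intro ballI allI impI)
    fix x0 and e :: real assume x0: "x0 \<in> M" and "e > 0"
    have "x0 \<noteq> path_origin \<alpha>" using x0 assms(2) by auto
    from bump_locally_lipschitz[OF assms(3,4) this, of M] obtain \<rho> L where \<rho>: "\<rho> > 0" "L > 0"
      "\<forall>x\<in>M. \<forall>x'\<in>M. dist x x0 < \<rho> \<longrightarrow> dist x' x0 < \<rho> \<longrightarrow> bump M \<alpha> N c x \<le> bump M \<alpha> N c x' + L * dist x x'"
      by blast
    show "\<exists>d>0. \<forall>x\<in>M. dist x x0 < d \<longrightarrow> dist (bump M \<alpha> N c x) (bump M \<alpha> N c x0) < e"
    proof (intro exI[of _ "min \<rho> (e / L)"] conjI ballI impI)
      fix x assume x: "x \<in> M" "dist x x0 < min \<rho> (e / L)"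
      have "bump M \<alpha> N c x \<le> bump M \<alpha> N c x0 + L * dist x x0"
        "bump M \<alpha> N c x0 \<le> bump M \<alpha> N c x + L * dist x0 x"
        using \<rho>(3) x x0 \<rho>(1) by auto
      moreover have "L * dist x x0 < e" using x(2) \<rho>(2) by (simp add: pos_less_divide_eq mult.commute)
      ultimately show "dist (bump M \<alpha> N c x) (bump M \<alpha> N c x0) < e"
        by (simp add: dist_real_def dist_commute abs_less_iff)
    qed (use \<rho> \<open>e > 0\<close> in auto)
  qed
  moreover have "0 \<le> bump M \<alpha> N c x \<and> bump M \<alpha> N c x \<le> 1" if "x \<in> M" for x
    using bump_le_iff[OF that assms(3), of \<alpha> N 1] bterm_bounds(2)
      bump_le_iff[OF that assms(3), of \<alpha> N "bump M \<alpha> N c x"] bterm_bounds(1)[of \<alpha> N x c] assms(3)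
    by (meson order.trans order_refl)
  hence "bounded (bump M \<alpha> N c ` M)" by (intro boundedI[of _ 1]) auto
  ultimately show ?thesis using semialg_bump[OF M \<open>c > 0\<close>] by (simp add: Sstar_def bump_def)
qed

section \<open>The formal path and its truncations\<close>

lemma ser_unfold: "ser 1 c = of_real (c 0) + Tm 1 * ser 1 (\<lambda>k. c (Suc k))"
proof (rule pui_eqI)
  fix q
  have ser: "cf (ser 1 b) q = (if q \<in> \<int> \<and> q \<ge> 0 then b (nat \<lfloor>q\<rfloor>) else 0)" for b q
    by (simp add: ser_def cf_emb psemb_def)
  show "cf (ser 1 c) q = cf (of_real (c 0) + Tm 1 * ser 1 (\<lambda>k. c (Suc k))) q"
  proof (cases "q \<in> \<int>")
    case True
    then obtain n where q: "q = of_int n" by (rule Ints_cases)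
    have z: "(rat_of_int n - 1) \<in> \<int>" by simp
    have n1: "rat_of_int n - 1 = of_int (n - 1)" by simp
    consider "n < 0" | "n = 0" | "n > 0" by linarith
    thus ?thesis
    proof cases
      case 3
      hence "Suc (nat (n - 1)) = nat n" by simp
      thus ?thesis using 3 unfolding q cf_add cf_Tm_mult ser n1 by (simp add: cf_of_real ps_const_def)
    qed (simp_all add: q cf_add cf_Tm_mult ser cf_of_real ps_const_def n1 del: of_int_diff One_nat_def)
  next
    case False
    hence "q - 1 \<notin> \<int>" using Ints_add[of "q - 1" 1] by auto
    moreover have "q \<noteq> 0" using False by auto
    ultimately show ?thesis using False
      by (simp add: cf_add cf_Tm_mult ser cf_of_real ps_const_def del: One_nat_def)
  qed
qed

lemma fin_ser: "d > 0 \<Longrightarrow> fin (ser d c)"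
  by (auto simp: fin_def ser_def cf_emb psemb_def mult_less_0_iff)

lemma pathF_truncate:
  "pathF \<alpha> i = tr \<alpha> N (Tm 1) i + Tm 1 ^ Suc N * ser 1 (\<lambda>k. \<alpha> i (Suc N + k))"
proof (induction N)
  case 0
  show ?case using ser_unfold[of "\<alpha> i"] by (simp add: pathF_def tr_def)
next
  case (Suc N)
  show ?case
    unfolding Suc using ser_unfold[of "\<lambda>k. \<alpha> i (Suc N + k)"] by (simp add: tr_def algebra_simps)
qed

text \<open>The truncation error is small even relative to the ball: beside the squared radius
  t^(2N) it carries a further factor t^2.\<close>

lemma sqd_pathF_tr:
  "\<exists>B. fin B \<and> sqd (pathF \<alpha>) (tr \<alpha> N (Tm 1)) = Tm 1 ^ (2 * N) * ((Tm 1)\<^sup>2 * B)"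
proof (intro exI conjI)
  have fin_sum: "fin (\<Sum>i\<in>A. f i)" if "\<And>i. fin (f i)" for A :: "'a set" and f
    using that by (induction A rule: infinite_finite_induct) (auto intro: fin_add)
  show "fin (\<Sum>i\<in>UNIV. (ser 1 (\<lambda>k. \<alpha> i (Suc N + k)))\<^sup>2)"
    by (intro fin_sum) (auto simp: power2_eq_square intro!: fin_mult fin_ser)
  have "pathF \<alpha> i - tr \<alpha> N (Tm 1) i = Tm 1 ^ Suc N * ser 1 (\<lambda>k. \<alpha> i (Suc N + k))" for i
    by (subst pathF_truncate[of \<alpha> i N]) simp
  thus "sqd (pathF \<alpha>) (tr \<alpha> N (Tm 1)) =
      Tm 1 ^ (2 * N) * ((Tm 1)\<^sup>2 * (\<Sum>i\<in>UNIV. (ser 1 (\<lambda>k. \<alpha> i (Suc N + k)))\<^sup>2))"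
    unfolding sqd_def by (simp add: sum_distrib_left power_mult_distrib power_add[symmetric] power_mult[symmetric] mult.assoc[symmetric] mult.commute[of _ 2] flip: power_Suc)
qed

text \<open>The parameter s = t lies below every real c > 0. The transferred bound \<open>Ub\<close>
  at this parameter shows that the value \<open>?h\<close> is at least 1, or that
  \<open>(1 - ?h)^2\<close> is at most t^2 times a finite element and so \<open>?h\<close> has
  residue 1.\<close>

lemma st_bump_pathF:
  fixes M :: "(real^'m) set"
  assumes M: "semialg_set M" and u: "holds (mf M) (pathF \<alpha>)" and "path_origin \<alpha> \<notin> M" "c > 0" "N \<ge> 1"
  shows "st (fext M (bump M \<alpha> N c) (pathF \<alpha>)) \<noteq> 0"
proof -
  let ?h = "fext M (bump M \<alpha> N c) (pathF \<alpha>)"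
  note S = Sstar_bump[OF M assms(3-5)]
  have fin: "fin ?h" by (rule fin_fext[OF M S u])
  define as where "as = (\<lambda>(k :: nat, v). case v of None \<Rightarrow> ?h | Some i \<Rightarrow> pathF \<alpha> i)"
  have "sat (Ub \<alpha> N c 0) as"
  proof (rule fext_transfer[OF M, where fs = "\<lambda>_. bump M \<alpha> N c" and n = 1])
    fix x :: "nat \<times> 'm option \<Rightarrow> real"
    assume "vec_lambda (vv x 0) \<in> M" "\<And>k. k < 1 \<Longrightarrow> x (k, None) = bump M \<alpha> N c (vec_lambda (vv x 0))"
    thus "sat (Ub \<alpha> N c 0) x" using sat_Ub[of 0 c x M \<alpha> N] \<open>c > 0\<close> by simp
  qed (use u SstarD(3)[OF S] in \<open>simp_all add: as_def\<close>)
  moreover have "Tm 1 < of_real c" by (rule st_less_imp_less) (use \<open>c > 0\<close> in \<open>simp_all add: fin_Tm1\<close>)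
  ultimately have "1 \<le> ?h \<or> Tm 1 ^ (2 * N) * (1 - ?h)\<^sup>2 \<le> sqd (pathF \<alpha>) (tr \<alpha> N (Tm 1))"
    using Tm_pos[of 1] by (auto simp: Ub_def as_def)
  thus ?thesis
  proof
    assume "1 \<le> ?h"
    thus ?thesis using st_mono[of 1 ?h] fin by auto
  next
    assume le: "Tm 1 ^ (2 * N) * (1 - ?h)\<^sup>2 \<le> sqd (pathF \<alpha>) (tr \<alpha> N (Tm 1))"
    obtain B where B: "fin B" "sqd (pathF \<alpha>) (tr \<alpha> N (Tm 1)) = Tm 1 ^ (2 * N) * ((Tm 1)\<^sup>2 * B)"
      using sqd_pathF_tr by blast
    have "(1 - ?h)\<^sup>2 \<le> (Tm 1)\<^sup>2 * B" using le Tm_pos[of 1] unfolding B(2) by (simp add: mult_le_cancel_left_pos)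
    hence "st ((1 - ?h)\<^sup>2) \<le> st ((Tm 1)\<^sup>2 * B)"
      by (intro st_mono) (auto simp: power2_eq_square intro!: fin_mult fin_diff fin fin_Tm1 B)
    also have "\<dots> = 0" using B(1) by (simp add: power2_eq_square st_mult fin_mult fin_Tm1)
    finally have "(1 - st ?h)\<^sup>2 \<le> 0" using fin by (simp add: power2_eq_square st_mult fin_diff)
    thus ?thesis by auto
  qed
qed

section \<open>Lower bounds near the path\<close>

definition vs1 :: "(nat \<times> 'm::finite option) list" where
  "vs1 = map (\<lambda>i. (1, Some i)) ilist"

definition upd1 :: "(nat \<times> 'm option \<Rightarrow> 'a) \<Rightarrow> ('m \<Rightarrow> 'a) \<Rightarrow> 'a \<Rightarrow> nat \<times> 'm option \<Rightarrow> 'a" where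
  "upd1 x u a = (\<lambda>v. case v of (k, None) \<Rightarrow> if k = 1 then a else x v | (k, Some i) \<Rightarrow> if k = 1 then u i else x v)"

lemma upd1_simps [simp]: "upd1 x u a (k, None) = (if k = 1 then a else x (k, None))"
  "upd1 x u a (k, Some i) = (if k = 1 then u i else x (k, Some i))"
  by (simp_all add: upd1_def)

lemma sat_all_vector:
  fixes x :: "nat \<times> 'm::finite option \<Rightarrow> 'a::rcf"
  shows "sat (AllL vs1 (All (1, None) f)) x \<longleftrightarrow>
    (\<forall>u a. sat f (upd1 x u a))"
proof -
  have vs: "set vs1 = {(1, Some i) | i::'m. True}" using ilist by (auto simp: vs1_def)
  show ?thesis
    unfolding sat_AllL
  proof (intro iffI allI impI)
    fix u a assume *: "\<forall>z. (\<forall>v. v \<notin> set vs1 \<longrightarrow> z v = x v) \<longrightarrow> sat (All (1, None) f) z"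
    let ?z = "\<lambda>v. case v of (k, None) \<Rightarrow> x v | (k, Some i) \<Rightarrow> if k = 1 then u i else x v"
    have "sat (All (1, None) f) ?z" using *[rule_format, of ?z] by (auto simp: vs split: option.split)
    hence "sat f (?z((1, None) := a))" by simp
    also have "?z((1, None) := a) = (upd1 x u a)"
      by (auto simp: upd1_def fun_eq_iff split: option.split)
    finally show "sat f \<dots>" .
  next
    fix z assume *: "\<forall>u a. sat f (upd1 x u a)"
      and z: "\<forall>v. v \<notin> set vs1 \<longrightarrow> z v = x v"
    have "z((1, None) := a) = upd1 x (vv z 1) a" for a
      using z by (auto simp: upd1_def fun_eq_iff vs split: option.split)
    thus "sat (All (1, None) f) z" using * by simp
  qed
qed

text \<open>Continuity enters through its epsilon-delta formula, which transfers. Scalar 2 bounds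
  the squared distance; vector 1 and scalar 1 are the nearby point and its value. Squaring
  \<open>f\<close> replaces the absolute value.\<close>

lemma fext_lower_bound_nbhd:
  fixes M :: "(real^'m) set" and w :: "'m \<Rightarrow> pui"
  assumes M: "semialg_set M" and f: "f \<in> Sstar M" and w: "holds (mf M) w" and e: "of_real e < (fext M f w)\<^sup>2"
  shows "\<exists>\<delta>>0. \<forall>u. holds (mf M) u \<longrightarrow> sqd u w < \<delta> \<longrightarrow> of_real e < (fext M f u)\<^sup>2"
proof -
  let ?G = "Imp (Conj (Gr M f 1 1) (Lt (Sq 1 (VVar 0)) (SVar 2))) (Lt (PConst e) (PPow (SVar 1) 2))"
  let ?F = "Imp (Lt (PConst e) (PPow (SVar 0) 2)) (Ex (2, None) (Conj (Lt (PConst 0) (SVar 2)) (AllL vs1 (All (1, None) ?G))))"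
  define as where "as = (\<lambda>(k :: nat, v). case v of None \<Rightarrow> fext M f w | Some i \<Rightarrow> w i)"
  have "sat ?F as"
  proof (rule fext_transfer[OF M, where fs = "\<lambda>_. f" and n = 1])
    fix x :: "nat \<times> 'm option \<Rightarrow> real"
    let ?a = "vec_lambda (vv x 0) :: real^'m"
    assume a: "?a \<in> M" "\<And>k. k < 1 \<Longrightarrow> x (k, None) = f ?a"
    show "sat ?F x"
    proof (cases "e < (f ?a)\<^sup>2")
      case True
      have "continuous_on M (\<lambda>x. (f x)\<^sup>2)" using SstarD(1)[OF f] by (intro continuous_intros)
      then obtain d where d: "d > 0" "\<And>y. y \<in> M \<Longrightarrow> dist y ?a < d \<Longrightarrow> dist ((f y)\<^sup>2) ((f ?a)\<^sup>2) < (f ?a)\<^sup>2 - e"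
        using a(1) True unfolding continuous_on_iff by (metis diff_gt_0_iff_gt)
      have "e < (f (vec_lambda u))\<^sup>2" if "vec_lambda u \<in> M" "sqd u (vv x 0) < d\<^sup>2" for u
      proof -
        have "norm (vec_lambda u - ?a) < d" using that(2) d(1) unfolding sqd_real by (rule power2_less_imp_less[OF _ less_imp_le])
        hence "dist ((f (vec_lambda u))\<^sup>2) ((f ?a)\<^sup>2) < (f ?a)\<^sup>2 - e" by (intro d that) (simp add: dist_norm)
        thus ?thesis by (simp add: dist_real_def abs_less_iff)
      qed
      hence "\<forall>u a. sat ?G (upd1 (x((2, None) := d\<^sup>2)) u a)"
        by (simp add: holds_gf[OF SstarD(3)[OF f]])
      hence "sat (AllL vs1 (All (1, None) ?G)) (x((2, None) := d\<^sup>2))"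
        unfolding sat_all_vector .
      thus ?thesis using d(1) by (auto intro!: exI[of _ "d\<^sup>2"] simp del: sat_simps(6))
    qed (use a in simp)
  qed (use w SstarD(3)[OF f] in \<open>simp_all add: as_def\<close>)
  then obtain \<delta> where \<delta>: "\<delta> > 0" "sat (AllL vs1 (All (1, None) ?G)) (as((2, None) := \<delta>))"
    using e by (auto simp: as_def simp del: sat_simps(6))
  have "of_real e < (fext M f u)\<^sup>2" if "holds (mf M) u" "sqd u w < \<delta>" for u
    using \<delta>(2)[unfolded sat_all_vector, rule_format, of u "fext M f u"] that
    by (simp add: holds_gf_pui[OF M SstarD(3)[OF f]] as_def)
  thus ?thesis using \<delta>(1) by blast
qed

lemma lower_bound_along_path:
  fixes M :: "(real^'m) set"
  assumes M: "semialg_set M" and f: "f \<in> Sstar M" and u: "holds (mf M) (pathF \<alpha>)"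
    and e: "of_real e < (fext M f (pathF \<alpha>))\<^sup>2"
  shows "\<exists>N\<ge>1. eventually (\<lambda>s. \<forall>x\<in>M. sqd (coords x) (tr \<alpha> N s) < s ^ (2 * N) \<longrightarrow> e < (f x)\<^sup>2) (at_right 0)"
proof -
  obtain \<delta> where \<delta>: "\<delta> > 0" "\<And>w. holds (mf M) w \<Longrightarrow> sqd w (pathF \<alpha>) < \<delta> \<Longrightarrow> of_real e < (fext M f w)\<^sup>2"
    using fext_lower_bound_nbhd[OF M f u e] by blast
  \<comment> \<open>With 2N above the valuation of \<delta>, every finite multiple of t^(2N) is
    below \<delta>.\<close>
  obtain N0 :: nat where N0: "val \<delta> < of_nat N0" using reals_Archimedean2 by blast
  define N where "N = Suc N0"
  have N: "N \<ge> 1" "val \<delta> < of_nat (2 * N)" using N0 by (simp_all add: N_def)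
  let ?G = "Imp (Conj (Gr M f 1 1) (Lt (Sq 1 (Tp \<alpha> N (SVar 3))) (PPow (SVar 3) (2 * N)))) (Lt (PConst e) (PPow (SVar 1) 2))"
  have close: "sqd w (pathF \<alpha>) < \<delta>" if w: "sqd w (tr \<alpha> N (Tm 1)) < Tm 1 ^ (2 * N)" for w
  proof -
    obtain B where B: "fin B" "sqd (pathF \<alpha>) (tr \<alpha> N (Tm 1)) = Tm 1 ^ (2 * N) * ((Tm 1)\<^sup>2 * B)"
      using sqd_pathF_tr by blast
    have T: "Tm 1 ^ (2 * N) = Tm (of_nat (2 * N))" using Tm_power[of 1 "2 * N"] by (simp only: mult_1_right)
    \<comment> \<open>The triangle inequality for squared distances, at the price of a factor
      2.\<close>
    have "(w i - pathF \<alpha> i)\<^sup>2 \<le> 2 * (w i - tr \<alpha> N (Tm 1) i)\<^sup>2 + 2 * (pathF \<alpha> i - tr \<alpha> N (Tm 1) i)\<^sup>2" for i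
    proof -
      have "2 * (w i - tr \<alpha> N (Tm 1) i)\<^sup>2 + 2 * (pathF \<alpha> i - tr \<alpha> N (Tm 1) i)\<^sup>2 - (w i - pathF \<alpha> i)\<^sup>2
        = ((w i - tr \<alpha> N (Tm 1) i) + (pathF \<alpha> i - tr \<alpha> N (Tm 1) i))\<^sup>2"
        by (simp add: power2_eq_square algebra_simps)
      also have "\<dots> \<ge> 0" by simp
      finally show ?thesis by simp
    qed
    hence "sqd w (pathF \<alpha>) \<le> 2 * sqd w (tr \<alpha> N (Tm 1)) + 2 * sqd (pathF \<alpha>) (tr \<alpha> N (Tm 1))"
      unfolding sqd_def by (simp add: sum_distrib_left sum.distrib[symmetric] sum_mono)
    also have "\<dots> < 2 * Tm 1 ^ (2 * N) + 2 * sqd (pathF \<alpha>) (tr \<alpha> N (Tm 1))" using w by simp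
    also have "\<dots> = Tm (of_nat (2 * N)) * (1 + 1 + (Tm 1 * Tm 1 * B + Tm 1 * Tm 1 * B))"
      unfolding B(2) T power2_eq_square by (simp add: algebra_simps del: of_nat_mult)
    also have "\<dots> < \<delta>"
    proof -
      let ?E = "1 + 1 + (Tm 1 * Tm 1 * B + Tm 1 * Tm 1 * B)"
      have fE: "fin ?E" by (intro fin_add fin_mult fin_Tm1 B fin_simps)
      \<comment> \<open>All exponents of the product are at least 2N, so up to
        \<open>val \<delta>\<close> the difference below has the coefficients of \<delta>.\<close>
      have z: "cf (Tm (of_nat (2 * N)) * ?E) q = 0" if "q \<le> val \<delta>" for q
        using fE that N(2) unfolding cf_Tm_mult fin_def by simp
      have "0 < \<delta> - Tm (of_nat (2 * N)) * ?E"
      proof (rule pui_posI[of _ "val \<delta>"])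
        show "0 < cf (\<delta> - Tm (of_nat (2 * N)) * ?E) (val \<delta>)"
          unfolding cf_diff z[OF order_refl] using \<delta>(1) by (simp add: pui_pos_iff_val)
        show "cf (\<delta> - Tm (of_nat (2 * N)) * ?E) p = 0" if "p < val \<delta>" for p
          unfolding cf_diff z[OF less_imp_le[OF that]] using cf_less_val[OF _ that] \<delta>(1) by simp
      qed
      thus ?thesis by simp
    qed
    finally show ?thesis .
  qed
  \<comment> \<open>After truncation \<alpha> enters \<open>?G\<close> only by real constants.
    Scalar 3, set to t, is the only free nonreal input left once \<open>w\<close> and
    \<open>a\<close> are quantified, as \<open>sat_infinitesimal\<close> demands.\<close>
  have "sat ?G (upd1 ((\<lambda>_. of_real 0)((3, None) := Tm 1)) w a)" for w a
    using \<delta>(2)[of w] close[of w] by (simp add: holds_gf_pui[OF M SstarD(3)[OF f]])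
  hence "sat (AllL vs1 (All (1, None) ?G)) ((\<lambda>_. of_real 0)((3, None) := Tm 1))"
    unfolding sat_all_vector by blast
  from sat_infinitesimal[OF this]
  have "eventually (\<lambda>s::real. sat (AllL vs1 (All (1, None) ?G)) ((\<lambda>_. 0)((3, None) := s))) (at_right 0)" .
  hence "eventually (\<lambda>s. \<forall>x\<in>M. sqd (coords x) (tr \<alpha> N s) < s ^ (2 * N) \<longrightarrow> e < (f x)\<^sup>2) (at_right 0)"
  proof eventually_elim
    case (elim s)
    show ?case
    proof (intro ballI impI)
      fix x assume x: "x \<in> M" "sqd (coords x) (tr \<alpha> N s) < s ^ (2 * N)"
      from elim[unfolded sat_all_vector, rule_format, of "coords x" "f x"] x show "e < (f x)\<^sup>2"
        by (simp add: holds_gf[OF SstarD(3)[OF f]])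
    qed
  qed
  thus ?thesis using N(1) by blast
qed

text \<open>Equal to h / f wherever f^2 \<ge> e; the maximum keeps the denominator away from 0
  elsewhere, which gives continuity and boundedness on all of \<open>M\<close>.\<close>

lemma Sstar_truncated_quotient:
  assumes M: "semialg_set M" and h: "h \<in> Sstar M" and f: "f \<in> Sstar M" and "e > 0"
  shows "(\<lambda>x. h x * f x / max ((f x)\<^sup>2) e) \<in> Sstar M"
proof -
  have pos: "max ((f x)\<^sup>2) e > 0" for x using \<open>e > 0\<close> by simp
  let ?R = "Disj (Conj (Le (PPow (SVar 2) 2) (PConst e)) (Eq (PMul (SVar 0) (PConst e)) (PMul (SVar 1) (SVar 2))))
    (Conj (Lt (PConst e) (PPow (SVar 2) 2)) (Eq (PMul (SVar 0) (PPow (SVar 2) 2)) (PMul (SVar 1) (SVar 2))))"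
  have "semialg (graph_on M (\<lambda>x. h x * f x / max ((f x)\<^sup>2) e))"
  proof (rule semialg_graph_binary[OF M SstarD(3)[OF h] SstarD(3)[OF f], of ?R])
    fix x :: "nat \<times> 'a option \<Rightarrow> real"
    let ?a = "vec_lambda (vv x 0) :: real^'a"
    assume x: "x (1, None) = h ?a" "x (2, None) = f ?a"
    have "sat ?R x \<longleftrightarrow> x (0, None) * max ((f ?a)\<^sup>2) e = h ?a * f ?a"
      using x by (auto simp: max_def)
    also have "\<dots> \<longleftrightarrow> x (0, None) = h ?a * f ?a / max ((f ?a)\<^sup>2) e"
      using pos[of ?a] by (intro eq_divide_eq[THEN trans, symmetric]) auto
    finally show "sat ?R x \<longleftrightarrow> x (0, None) = h ?a * f ?a / max ((f ?a)\<^sup>2) e" .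
  qed
  moreover have "continuous_on M (\<lambda>x. h x * f x / max ((f x)\<^sup>2) e)"
    using SstarD(1)[OF h] SstarD(1)[OF f] pos by (intro continuous_intros) (auto simp: less_imp_neq[symmetric])
  moreover obtain C where C: "\<And>x. x \<in> M \<Longrightarrow> norm (h x * f x) \<le> C"
    using SstarD(2)[OF Sstar_mult[OF M h f]] unfolding bounded_iff by blast
  have "norm (h x * f x / max ((f x)\<^sup>2) e) \<le> C / e" if "x \<in> M" for x
  proof -
    have "norm (h x * f x / max ((f x)\<^sup>2) e) = norm (h x * f x) / max ((f x)\<^sup>2) e"
      using pos[of x] by (simp add: norm_divide)
    also have "\<dots> \<le> C / e" by (intro frac_le) (use C[OF that] \<open>e > 0\<close> in \<open>auto intro: order_trans[OF norm_ge_zero]\<close>)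
    finally show ?thesis .
  qed
  hence "bounded ((\<lambda>x. h x * f x / max ((f x)\<^sup>2) e) ` M)" by (intro boundedI[of _ "C / e"]) blast
  ultimately show ?thesis using SstarD(4)[OF h] by (simp add: Sstar_def)
qed

lemma bump_pos_imp:
  assumes "x \<in> M" "c > 0" "bump M \<alpha> N c x \<noteq> 0"
  shows "\<exists>s. 0 < s \<and> s \<le> c \<and> sqd (coords x) (tr \<alpha> N s) < s ^ (2 * N)"
proof (rule ccontr)
  assume neg: "\<not> ?thesis"
  have "bump M \<alpha> N c x \<le> 0" unfolding bump_le_iff[OF assms(1,2)]
    using neg by (auto simp: bterm_le_iff not_less)
  moreover have "bterm \<alpha> N x c \<le> bump M \<alpha> N c x"
    using bump_le_iff[OF assms(1,2), of \<alpha> N "bump M \<alpha> N c x"] assms(2) by simp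
  ultimately show False using assms(3) bterm_bounds(1)[of \<alpha> N x c] by linarith
qed

lemma zariski_open_Dopen:
  assumes "h \<in> Sstar M"
  shows "zariski_open M (Dopen M h)"
  unfolding zariski_open_def
  by (intro conjI ballI bexI[of _ h]) (auto simp: Dopen_def assms)

theorem theorem4p9:
  fixes M :: "(real^'m) set"
  assumes "bounded M" and "semialg_set M"
  shows "\<forall>p \<in> hat_boundary M. has_countable_nbhd_basis M p"
proof
  fix p assume "p \<in> hat_boundary M"
  then obtain \<alpha> where p: "p = mstar_path M \<alpha>" and path: "path_F1 \<alpha> \<in> ext_F1 (coords ` M)"
    and orig: "path_origin \<alpha> \<notin> M"
    by (auto simp: hat_boundary_def)
  note M = assms(2)
  have u: "holds (mf M) (pathF \<alpha>)" using path path_in_ext_iff[OF M] by blast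
  have pb: "p \<in> betaS M" unfolding p by (rule mstar_path_in_betaS[OF M u])
  have inp: "f \<in> p \<longleftrightarrow> f \<in> Sstar M \<and> st (fext M f (pathF \<alpha>)) = 0" for f
    unfolding p mstar_path_eq[OF M u] by blast
  \<comment> \<open>\<open>Suc\<close> shifts the indices so that the exponent is at least 1 and the
    bound on s is positive.\<close>
  define h where "h N j = bump M \<alpha> (Suc N) (inverse (real (Suc j)))" for N j
  have hS: "h N j \<in> Sstar M" and hp: "h N j \<notin> p" for N j
    using Sstar_bump[OF M orig, of "inverse (real (Suc j))" "Suc N"]
      st_bump_pathF[OF M u orig, of "inverse (real (Suc j))" "Suc N"]
    by (simp_all add: h_def inp)
  define B where "B n = (case prod_decode n of (N, j) \<Rightarrow> Dopen M (h N j))" for n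
  show "has_countable_nbhd_basis M p"
    unfolding has_countable_nbhd_basis_def
  proof (intro exI[of _ B] conjI allI impI)
    fix n
    obtain N j where n: "prod_decode n = (N, j)" by (cases "prod_decode n")
    show "zariski_open M (B n)" using zariski_open_Dopen[OF hS[of N j]] by (simp add: B_def n)
    show "p \<in> B n" using pb hp[of N j] by (simp add: B_def n Dopen_def)
  next
    fix U assume U: "zariski_open M U \<and> p \<in> U"
    then obtain f where f: "f \<in> Sstar M" "f \<notin> p" "Dopen M f \<subseteq> U"
    proof -
      have "\<exists>f\<in>Sstar M. p \<in> Dopen M f \<and> Dopen M f \<subseteq> U" using U unfolding zariski_open_def by blast
      then obtain f where "f \<in> Sstar M" "p \<in> Dopen M f" "Dopen M f \<subseteq> U" by blast
      thus ?thesis using that[of f] by (simp add: Dopen_def)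
    qed
    define y where "y = fext M f (pathF \<alpha>)"
    have "st y \<noteq> 0" using f inp by (simp add: y_def)
    \<comment> \<open>Half of the squared residue is a positive real strictly below it, and
      comparing residues puts \<open>e\<close> below the square of \<open>y\<close> in
      \<open>pui\<close>.\<close>
    define e where "e = (st y)\<^sup>2 / 2"
    have "e > 0" using \<open>st y \<noteq> 0\<close> by (simp add: e_def)
    have fy: "fin y" unfolding y_def by (rule fin_fext[OF M f(1) u])
    have "of_real e < y\<^sup>2"
    proof (rule st_less_imp_less)
      have sq: "st (y\<^sup>2) = (st y)\<^sup>2" unfolding power2_eq_square by (rule st_mult[OF fy fy])
      have "(st y)\<^sup>2 > 0" using \<open>st y \<noteq> 0\<close> by simp
      thus "st (of_real e) < st (y\<^sup>2)" unfolding sq st_simps(3) e_def by linarith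
    qed (simp_all add: power2_eq_square fin_mult fy)
    from lower_bound_along_path[OF M f(1) u this[unfolded y_def]]
    obtain N where N: "N \<ge> 1"
      "eventually (\<lambda>s. \<forall>x\<in>M. sqd (coords x) (tr \<alpha> N s) < s ^ (2 * N) \<longrightarrow> e < (f x)\<^sup>2) (at_right 0)" by blast
    from N(2)[unfolded eventually_at_right_field] obtain b where b: "b > 0"
      "\<forall>s>0. s < b \<longrightarrow> (\<forall>x\<in>M. sqd (coords x) (tr \<alpha> N s) < s ^ (2 * N) \<longrightarrow> e < (f x)\<^sup>2)" by blast
    obtain j where j: "inverse (real (Suc j)) < b" using reals_Archimedean[OF b(1)] by blast
    obtain N' where N': "N = Suc N'" using N(1) by (cases N) auto
    let ?h = "h N' j"
    let ?g = "\<lambda>x. ?h x * f x / max ((f x)\<^sup>2) e"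
    have gS: "?g \<in> Sstar M" by (rule Sstar_truncated_quotient[OF M hS f(1) \<open>e > 0\<close>])
    \<comment> \<open>Where \<open>?h\<close> is 0 both sides vanish; elsewhere x lies in a ball of
      some parameter s < b, so f^2 exceeds e and the maximum in \<open>?g\<close> equals
      f^2.\<close>
    have gf: "?g x * f x = ?h x" for x
    proof (cases "?h x = 0")
      case False
      hence x: "x \<in> M" using SstarD(4)[OF hS] by blast
      obtain s where s: "0 < s" "s \<le> inverse (real (Suc j))" "sqd (coords x) (tr \<alpha> N s) < s ^ (2 * N)"
        using bump_pos_imp[OF x, of "inverse (real (Suc j))" \<alpha> N] False by (auto simp: h_def N')
      have "s < b" using s(2) j by simp
      hence fe: "e < (f x)\<^sup>2" using b(2) s(1,3) x by blast
      hence m: "max ((f x)\<^sup>2) e = f x * f x" by (simp add: power2_eq_square)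
      have "f x \<noteq> 0" using fe \<open>e > 0\<close> by auto
      thus ?thesis unfolding m by simp
    qed simp
    have "Dopen M ?h \<subseteq> Dopen M f"
    proof
      fix I assume I: "I \<in> Dopen M ?h"
      have "f \<notin> I"
      proof
        assume fI: "f \<in> I"
        have "\<forall>f\<in>I. \<forall>g\<in>Sstar M. (\<lambda>x. g x * f x) \<in> I"
          using I by (simp add: Dopen_def betaS_def is_max_ideal_def is_ideal_def)
        from bspec[OF bspec[OF this fI] gS] have "?h \<in> I" unfolding gf .
        thus False using I by (simp add: Dopen_def)
      qed
      with I show "I \<in> Dopen M f" by (simp add: Dopen_def)
    qed
    hence "B (prod_encode (N', j)) \<subseteq> U" using f(3) by (simp add: B_def)
    thus "\<exists>n. B n \<subseteq> U" by blast
  qed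
qed

end
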